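(* Let $\varphi$ be a compactly supported smooth differential form of bidegree $(n-1,n-1)$ on the unit ball $\mathbb B_n\subset\mathbb C^n$, and let $D\varphi$ be the function defined by $\frac{i}{2\pi}\partial\bar\partial\varphi = D\varphi\, d\mu$. Let $f_L$ be the hyperbolic Gaussian analytic function of intensity $L$ and $I_L(\varphi)=\int_{Z_{f_L}}\varphi$. Then, as $L\to\infty$, \[ \operatorname{Var}[I_L(\varphi)] = n!\,\zeta(n+2)\left(\int_{\mathbb B_n}(D\varphi)^2\,d\mu\right)\frac{1}{L^n}+O\!\left(\frac{\log L}{L^{n+1}}\right), \] where $\zeta$ is the Riemann zeta function.
   Context: $\mathbb B_n$ is the open unit ball of $\mathbb C^n$; $\nu$ is Lebesgue measure normalised by $\nu(\mathbb B_n)=1$; $d\mu(z)=\frac{d\nu(z)}{(1-|z|^2)^{n+1}}$. One has $\mu=\omega^n$, where $\omega=\frac{i}{2\pi}\partial\bar\partial\log\frac{1}{1-|z|^2}$; top-degree forms are identified with measures accordingly. For real $L>0$, the hyperbolic Gaussian analytic function of intensity $L$ is the random holomorphic function \[ f_L(z)=\sum_{\alpha} a_\alpha\left(\frac{\Gamma(L+|\alpha|)}{\alpha!\,\Gamma(L)}\right)^{1/2}z^\alpha,\qquad z\in\mathbb B_n, \] where $\alpha$ ranges over multi-indices in $\mathbb Z_{\ge0}^n$ and the $a_\alpha$ are i.i.d. complex Gaussians of mean $0$ and variance $1$. Its covariance kernel is $K_L(z,w)=\mathbb E[f_L(z)\overline{f_L(w)}]=(1-z\cdot\bar w)^{-L}$.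 $Z_{f_L}$ is the zero set of $f_L$, and $[Z_{f_L}]=\frac{i}{2\pi}\partial\bar\partial\log|f_L|^2$ is its integration current. By definition $I_L(\varphi)=\int_{Z_{f_L}}\varphi=\int_{\mathbb B_n}\varphi\wedge[Z_{f_L}]$.
   Formalization: The function Dφ is assumed real-valued, as it is for every real form φ; for complex forms the formula fails (for φ = iψ with ψ real the variance is positive but the displayed main term is negative). *)

theory Defs
  imports "HOL-Probability.Probability"
begin

section \<open>Smooth functions\<close>

fun Ck_on :: "nat \<Rightarrow> 'a::real_normed_vector set \<Rightarrow> ('a \<Rightarrow> 'b::real_normed_vector) \<Rightarrow> bool" where
  "Ck_on 0 S f \<longleftrightarrow> continuous_on S f"
| "Ck_on (Suc k) S f \<longleftrightarrow>
     (\<forall>x\<in>S. f differentiable (at x)) \<and>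
     (\<forall>v. Ck_on k S (\<lambda>x. frechet_derivative f (at x) v))"

text \<open>Only meant for open \<open>S\<close> in a finite-dimensional space.\<close>

definition smooth_on :: "'a::real_normed_vector set \<Rightarrow> ('a \<Rightarrow> 'b::real_normed_vector) \<Rightarrow> bool" where
  "smooth_on S f \<longleftrightarrow> (\<forall>k. Ck_on k S f)"


section \<open>Differential forms on complex Euclidean space\<close>

text \<open>
  A \<open>k\<close>-form is a map sending a point and a list of \<open>k\<close> tangent vectors to a complex number;
  lists of other lengths are never looked at. Wedge products follow the determinant convention,
  \<open>(\<theta> \<and> \<eta>)(v, w) = \<theta> v * \<eta> w - \<theta> w * \<eta> v\<close> for 1-forms.
\<close>

type_synonym 'n covector = "complex ^ 'n \<Rightarrow> complex"
type_synonym 'n multicovector = "(complex ^ 'n) list \<Rightarrow> complex"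
type_synonym 'n form = "complex ^ 'n \<Rightarrow> 'n multicovector"

definition wedge1 :: "'n::finite covector \<Rightarrow> 'n multicovector \<Rightarrow> 'n multicovector" where
  "wedge1 \<theta> \<alpha> vs =
     (\<Sum>i<length vs. (- 1) ^ i * \<theta> (vs ! i) * \<alpha> (take i vs @ drop (Suc i) vs))"

fun wedge_list :: "'n::finite covector list \<Rightarrow> 'n multicovector" where
  "wedge_list [] = (\<lambda>_. 1)"
| "wedge_list (\<theta> # \<theta>s) = wedge1 \<theta> (wedge_list \<theta>s)"

definition dz :: "'n::finite \<Rightarrow> 'n covector" where
  "dz j v = v $ j"

definition dzbar :: "'n::finite \<Rightarrow> 'n covector" where
  "dzbar j v = cnj (v $ j)"

text \<open>
  Smooth forms of bidegree \<open>(p, q)\<close>: smooth combinations of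
  \<open>dz\<^bsub>j1\<^esub> \<and> \<dots> \<and> dz\<^bsub>jp\<^esub> \<and> dzbar\<^bsub>k1\<^esub> \<and> \<dots> \<and> dzbar\<^bsub>kq\<^esub>\<close>. All index lists, not only the increasing ones,
  are allowed; this spans the same space and needs no ordering of the index type.
\<close>

definition smooth_pq_form :: "nat \<Rightarrow> nat \<Rightarrow> (complex ^ 'n::finite) set \<Rightarrow> 'n form \<Rightarrow> bool" where
  "smooth_pq_form p q S \<phi> \<longleftrightarrow>
     (\<exists>c. (\<forall>js ks. smooth_on S (c js ks)) \<and>
          (\<forall>z\<in>S. \<forall>vs. length vs = p + q \<longrightarrow>
             \<phi> z vs = (\<Sum>js\<in>{js. length js = p}. \<Sum>ks\<in>{ks. length ks = q}.
                         c js ks z * wedge_list (map dz js @ map dzbar ks) vs)))"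

definition compactly_supported_form :: "nat \<Rightarrow> (complex ^ 'n::finite) set \<Rightarrow> 'n form \<Rightarrow> bool" where
  "compactly_supported_form k S \<phi> \<longleftrightarrow>
     (\<exists>K. compact K \<and> K \<subseteq> S \<and> (\<forall>z\<in>S - K. \<forall>vs. length vs = k \<longrightarrow> \<phi> z vs = 0))"

text \<open>The Wirtinger derivatives \<open>\<partial>/\<partial>z\<^sub>j\<close> and \<open>\<partial>/\<partial>zbar\<^sub>j\<close>.\<close>

definition wirtinger :: "'n::finite \<Rightarrow> (complex ^ 'n \<Rightarrow> complex) \<Rightarrow> complex ^ 'n \<Rightarrow> complex" where
  "wirtinger j f z =
     (frechet_derivative f (at z) (axis j 1) - \<i> * frechet_derivative f (at z) (axis j \<i>)) / 2"

definition wirtinger_bar :: "'n::finite \<Rightarrow> (complex ^ 'n \<Rightarrow> complex) \<Rightarrow> complex ^ 'n \<Rightarrow> complex" where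
  "wirtinger_bar j f z =
     (frechet_derivative f (at z) (axis j 1) + \<i> * frechet_derivative f (at z) (axis j \<i>)) / 2"

definition del :: "'n::finite form \<Rightarrow> 'n form" where
  "del \<phi> z vs = (\<Sum>j\<in>UNIV. wedge1 (dz j) (\<lambda>ws. wirtinger j (\<lambda>w. \<phi> w ws) z) vs)"

definition delbar :: "'n::finite form \<Rightarrow> 'n form" where
  "delbar \<phi> z vs = (\<Sum>j\<in>UNIV. wedge1 (dzbar j) (\<lambda>ws. wirtinger_bar j (\<lambda>w. \<phi> w ws) z) vs)"

definition i_del_delbar :: "'n::finite form \<Rightarrow> 'n form" where
  "i_del_delbar \<phi> z vs = \<i> / (2 * of_real pi) * del (delbar \<phi>) z vs"

text \<open>
  The positively oriented real basis \<open>e\<^sub>1, \<i>e\<^sub>1, \<dots>, e\<^sub>n, \<i>e\<^sub>n\<close>. The chosen enumeration of the indices is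
  irrelevant to top-degree forms, since the vectors are permuted in pairs. The value of
  a top-degree form on this basis is its coefficient with respect to the Euclidean volume form
  \<open>dx\<^sub>1 \<and> dy\<^sub>1 \<and> \<dots> \<and> dx\<^sub>n \<and> dy\<^sub>n\<close>, that is, the Lebesgue density of the corresponding measure.
\<close>

definition std_frame :: "(complex ^ 'n::finite) list" where
  "std_frame = concat (map (\<lambda>j. [axis j 1, axis j \<i>]) (SOME js. distinct js \<and> set js = UNIV))"

definition top_density :: "'n::finite multicovector \<Rightarrow> complex" where
  "top_density \<alpha> = \<alpha> std_frame"

definition form_integral :: "(complex ^ 'n::finite) set \<Rightarrow> 'n form \<Rightarrow> complex" where
  "form_integral S \<eta> = (LINT z:S|lborel. top_density (\<eta> z))"


section \<open>The invariant measure of the unit ball\<close>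

definition ball_measure :: "(complex ^ 'n::finite) measure" where
  "ball_measure = uniform_measure lborel (ball 0 1)"

definition invariant_measure :: "(complex ^ 'n::finite) measure" where
  "invariant_measure =
     density ball_measure (\<lambda>z. ennreal (1 / (1 - (norm z)\<^sup>2) ^ (CARD('n) + 1)))"

text \<open>The density of the invariant measure with respect to Lebesgue measure, inside the ball.\<close>

definition invariant_density :: "complex ^ 'n::finite \<Rightarrow> real" where
  "invariant_density z =
     1 / (measure lborel (ball (0 :: complex ^ 'n) 1) * (1 - (norm z)\<^sup>2) ^ (CARD('n) + 1))"

lemma invariant_measure_eq_density:
  "(invariant_measure :: (complex ^ 'n::finite) measure) =
     density lborel (\<lambda>z. ennreal (indicator (ball 0 1) z * invariant_density z))"
proof -
  let ?B = "ball (0 :: complex ^ 'n) 1"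
  have fin: "emeasure lborel ?B < \<infinity>"
    by (rule emeasure_bounded_finite) simp
  then have em: "emeasure lborel ?B = ennreal (measure lborel ?B)"
    by (simp add: emeasure_eq_ennreal_measure)
  have pos: "measure lborel ?B > 0"
    using content_ball_pos[of 1 "0 :: complex ^ 'n"] by simp
  have eq: "indicator ?B z / emeasure lborel ?B
          * ennreal (1 / (1 - (norm z)\<^sup>2) ^ (CARD('n) + 1))
        = ennreal (indicator ?B z * invariant_density z)" for z :: "complex ^ 'n"
  proof (cases "z \<in> ?B")
    case True
    then have "(norm z)\<^sup>2 < 1"
      by (simp add: power_less_one_iff abs_square_less_1)
    then show ?thesis
      using True pos by (simp add: em invariant_density_def divide_ennreal ennreal_mult[symmetric]
          flip: ennreal_1)
  next
    case False
    then show ?thesis by simp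
  qed
  have m1: "(\<lambda>z. indicator ?B z / emeasure lborel ?B :: ennreal) \<in> borel_measurable lborel"
    by (intro borel_measurable_divide_ennreal borel_measurable_indicator borel_measurable_const) simp
  have m2: "(\<lambda>z :: complex ^ 'n. ennreal (1 / (1 - (norm z)\<^sup>2) ^ (CARD('n) + 1)))
      \<in> borel_measurable lborel"
    by (intro measurable_compose[OF _ measurable_ennreal] borel_measurable_divide
        borel_measurable_power borel_measurable_diff borel_measurable_const
        borel_measurable_norm) simp_all
  show ?thesis
    unfolding invariant_measure_def ball_measure_def uniform_measure_def
    by (subst density_density_eq[OF m1 m2]) (simp only: eq)
qed


section \<open>Zero currents of hyperbolic Gaussian analytic functions\<close>

text \<open>
  The current \<open>(\<i>/2\<pi>) \<partial>\<partial>bar u\<close> on the unit ball, for \<open>u\<close> locally integrable, acting on test forms of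
  bidegree \<open>(n - 1, n - 1)\<close> by \<open>\<phi> \<mapsto> \<integral> u (\<i>/2\<pi>) \<partial>\<partial>bar \<phi>\<close>.
\<close>

definition i_del_delbar_current :: "(complex ^ 'n::finite \<Rightarrow> real) \<Rightarrow> 'n form \<Rightarrow> complex" where
  "i_del_delbar_current u \<phi> =
     form_integral (ball 0 1) (\<lambda>z vs. of_real (u z) * i_del_delbar \<phi> z vs)"

definition zero_current :: "(complex ^ 'n::finite \<Rightarrow> complex) \<Rightarrow> 'n form \<Rightarrow> complex" where
  "zero_current f = i_del_delbar_current (\<lambda>z. ln ((cmod (f z))\<^sup>2))"

definition hyperbolic_series ::
  "real \<Rightarrow> (('n::finite \<Rightarrow> nat) \<Rightarrow> complex) \<Rightarrow> complex ^ 'n \<Rightarrow> complex" where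
  "hyperbolic_series L a z =
     (\<Sum>\<^sub>\<infinity>\<alpha>. a \<alpha>
        * of_real (sqrt (Gamma (L + real (\<Sum>j\<in>UNIV. \<alpha> j))
                         / ((\<Prod>j\<in>UNIV. fact (\<alpha> j)) * Gamma L)))
        * (\<Prod>j\<in>UNIV. (z $ j) ^ \<alpha> j))"

text \<open>Mean 0, \<open>E \<bar>a\<bar>\<^sup>2 = 1\<close>, rotation invariant.\<close>

definition std_complex_gaussian :: "'w measure \<Rightarrow> ('w \<Rightarrow> complex) \<Rightarrow> bool" where
  "std_complex_gaussian M X \<longleftrightarrow> distributed M lborel X (\<lambda>w. ennreal (exp (- (cmod w)\<^sup>2) / pi))"

definition linear_statistic ::
  "(('n::finite \<Rightarrow> nat) \<Rightarrow> 'w \<Rightarrow> complex) \<Rightarrow> real \<Rightarrow> 'n form \<Rightarrow> 'w \<Rightarrow> complex" where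
  "linear_statistic a L \<phi> \<omega> = zero_current (hyperbolic_series L (\<lambda>\<alpha>. a \<alpha> \<omega>)) \<phi>"

definition complex_variance :: "'w measure \<Rightarrow> ('w \<Rightarrow> complex) \<Rightarrow> real" where
  "complex_variance M X = (LINT \<omega>|M. (cmod (X \<omega> - (LINT \<omega>'|M. X \<omega>')))\<^sup>2)"

text \<open>The Riemann zeta function on the half-line \<open>s > 1\<close>.\<close>

definition zeta :: "real \<Rightarrow> real" where
  "zeta s = (\<Sum>k. 1 / real (Suc k) powr s)"

end

theory Submission
  imports Defs
begin

text \<open>
  Write \<open>P(z, w) = (1 - \<bar>z\<bar>\<^sup>2) (1 - \<bar>w\<bar>\<^sup>2) / \<bar>1 - z \<cdot> w\<bar>\<^sup>2\<close> (\<open>\<cdot>\<close> being the Hermitian product). For jointly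
  Gaussian \<open>X\<close>, \<open>Y\<close> with correlation \<open>\<theta>\<close>, the joint Laplace transform of \<open>\<bar>X\<bar>\<^sup>2\<close>, \<open>\<bar>Y\<bar>\<^sup>2\<close> and Frullani's
  formula for the logarithm give \<open>Cov(ln \<bar>X\<bar>\<^sup>2, ln \<bar>Y\<bar>\<^sup>2) = \<Sum>\<^sub>k \<bar>\<theta>\<bar>\<^sup>2\<^sup>k / k\<^sup>2\<close>; for \<open>f\<^sub>L\<close> one has
  \<open>\<bar>\<theta>\<bar>\<^sup>2 = P\<^sup>L\<close>, so by Fubini the variance is \<open>\<Sum>\<^sub>k k\<^sup>-\<^sup>2 \<integral>\<integral> D(z) D(w) P(z, w)\<^sup>k\<^sup>L d\<mu> d\<mu>\<close>.

  The integral \<open>J(s) = \<integral> P(z, w)\<^sup>s d\<mu>(z) = n! \<Gamma>(s - n) / \<Gamma>(s)\<close> does not depend on \<open>w\<close>, and \<open>(D(z) - D(w))\<^sup>2\<close> is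
  dominated by \<open>1 - P(z, w)\<close> because \<open>D\<close> is Lipschitz with compact support. Hence the double integral with
  exponent \<open>s\<close> is \<open>J(s) \<integral> D\<^sup>2 d\<mu>\<close> up to a multiple of \<open>J(s) - J(s + 1) = J(s) n / s\<close>. Since
  \<open>J(s) = n! s\<^sup>-\<^sup>n (1 + O(1/s))\<close>, taking \<open>s = k L\<close> and summing over \<open>k\<close> yields \<open>n! \<zeta>(n + 2) L\<^sup>-\<^sup>n \<integral> D\<^sup>2 d\<mu>\<close>.
\<close>

section \<open>The kernel integral over the ball\<close>

text \<open>The first obstacle is J(s). Its value is found without polar coordinates or
  automorphisms of the ball: (1 - <z,w>)^(-s) is expanded in powers of <z,w>, which rotations of z
  make orthogonal, so only the moments of |<z,w>|^2 on the ball enter. They are never evaluated one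
  by one. A layer-cake argument shows that each radial weight multiplies the same moment by an
  explicit constant; comparison with the Gaussian weight, whose generating function comes from
  completing the square, then sums the whole series. The second obstacle is Fubini near the zeros of
  f_L, where the logarithm is unbounded. Only Laplace transforms of X = |f_L|^2 (normalised) are
  available, and they must supply the integrability too: bounds on E[X] and E[X^(-1/2)] control
  E[(ln X)^2]. In the covariance all terms of the Frullani integrands cancel except the Laplace
  transforms, and their difference is a geometric series whose terms separate the two variables.
  Finally, 1 - P vanishes on the diagonal to second order, as the square of a Lipschitz difference
  does; hence the gain of a factor 1/s in the error.\<close>

lemma distr_lborel_linear_isometry:
  fixes T :: "'a::euclidean_space \<Rightarrow> 'a"
  assumes lin: "linear T" and iso: "\<And>x. norm (T x) = norm x"
  shows "distr lborel borel T = lborel"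
proof (rule measure_eqI)
  show "sets (distr lborel borel T) = sets (lborel :: 'a measure)" by simp
  fix A assume "A \<in> sets (distr lborel borel T)"
  then have [measurable]: "A \<in> sets borel" by simp
  have [measurable]: "T \<in> borel_measurable borel"
    using lin by (intro borel_measurable_continuous_onI linear_continuous_on linear_conv_bounded_linear[THEN iffD1])
  have "inj T"
    using lin iso by (metis linear_injective_0 norm_eq_zero)
  then have surj: "surj T"
    using lin by (simp add: linear_injective_imp_surjective)
  have shift: "(\<integral>\<^sup>+x. f (c + x) \<partial>lborel) = (\<integral>\<^sup>+x. f x \<partial>lborel)" if [measurable]: "f \<in> borel_measurable borel"
    for f :: "'a \<Rightarrow> ennreal" and c :: 'a
  proof -
    have "(\<integral>\<^sup>+x. f x \<partial>lborel) = (\<integral>\<^sup>+x. f x \<partial>distr lborel borel ((+) c))"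
      by (simp only: lborel_distr_plus)
    also have "\<dots> = (\<integral>\<^sup>+x. f (c + x) \<partial>lborel)"
      by (subst nn_integral_distr) auto
    finally show ?thesis by simp
  qed
  \<comment> \<open>The unit ball is the test set: \<open>T\<close> preserves it, and its measure,
    being positive and finite, can be cancelled at the end.\<close>
  let ?U = "ball (0 :: 'a) 1"
  have U0: "emeasure lborel ?U \<noteq> 0"
    using emeasure_lborel_ball_finite[of "0::'a" 1] content_ball_pos[of 1 "0 :: 'a"]
    by (auto simp: measure_def)
  have [measurable]: "?U \<in> sets borel" by simp
  have Ut: "emeasure lborel ?U \<noteq> \<infinity>"
    using emeasure_lborel_ball_finite[of "0::'a" 1] by simp
  have [measurable]: "T -` A \<in> sets borel"
    using measurable_sets[of T borel borel A] by simp
  let ?I = "\<lambda>x y. indicator A (T x) * indicator ?U (y - T x) :: ennreal"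
  have "emeasure lborel (T -` A) * emeasure lborel ?U
      = (\<integral>\<^sup>+x. indicator (T -` A) x \<partial>lborel) * emeasure lborel ?U"
    by simp
  also have "\<dots> = (\<integral>\<^sup>+x. indicator A (T x) * emeasure lborel ?U \<partial>lborel)"
    by (subst nn_integral_multc[symmetric]) (auto simp: indicator_def intro!: nn_integral_cong)
  also have "\<dots> = (\<integral>\<^sup>+x. indicator A (T x) * (\<integral>\<^sup>+y. indicator ?U (y - T x) \<partial>lborel) \<partial>lborel)"
  proof (intro nn_integral_cong arg_cong2[where f="(*)"] refl)
    fix x :: 'a
    have "(\<integral>\<^sup>+y. indicator ?U (- T x + y) \<partial>lborel) = (\<integral>\<^sup>+y. indicator ?U y \<partial>lborel :: ennreal)"
      by (rule shift, rule borel_measurable_indicator) simp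
    then show "emeasure lborel ?U = (\<integral>\<^sup>+y. indicator ?U (y - T x) \<partial>lborel)"
      by simp
  qed
  also have "\<dots> = (\<integral>\<^sup>+x. \<integral>\<^sup>+y. ?I x y \<partial>lborel \<partial>lborel)"
    by (intro nn_integral_cong nn_integral_cmult[symmetric]) measurable
  also have "\<dots> = (\<integral>\<^sup>+y. \<integral>\<^sup>+x. ?I x y \<partial>lborel \<partial>lborel)"
    by (rule lborel_pair.Fubini') measurable
  also have "\<dots> = (\<integral>\<^sup>+y. \<integral>\<^sup>+x. indicator A (y + T x) * indicator ?U x \<partial>lborel \<partial>lborel)"
  proof (rule nn_integral_cong)
    fix y :: 'a
    \<comment> \<open>With \<open>T u = y\<close> one has \<open>y - T (u + x) = - T x\<close>,
      which by isometry lies in \<open>?U\<close> exactly when \<open>x\<close> does.\<close>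
    obtain u where u: "T u = y" using surj by (metis surjD)
    have "(\<integral>\<^sup>+x. ?I x y \<partial>lborel) = (\<integral>\<^sup>+x. ?I (u + x) y \<partial>lborel)"
      by (rule shift[symmetric]) measurable
    also have "\<dots> = (\<integral>\<^sup>+x. indicator A (y + T x) * indicator ?U x \<partial>lborel)"
      using lin u iso by (intro nn_integral_cong) (auto simp: linear_add indicator_def)
    finally show "(\<integral>\<^sup>+x. ?I x y \<partial>lborel) = (\<integral>\<^sup>+x. indicator A (y + T x) * indicator ?U x \<partial>lborel)" .
  qed
  also have "\<dots> = (\<integral>\<^sup>+x. \<integral>\<^sup>+y. indicator A (y + T x) * indicator ?U x \<partial>lborel \<partial>lborel)"
    by (rule lborel_pair.Fubini') measurable
  also have "\<dots> = (\<integral>\<^sup>+x. emeasure lborel A * indicator ?U x \<partial>lborel)"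
  proof (rule nn_integral_cong)
    fix x :: 'a
    have "(\<integral>\<^sup>+y. indicator A (T x + y) \<partial>lborel) = (\<integral>\<^sup>+y. indicator A y \<partial>lborel :: ennreal)"
      by (rule shift, rule borel_measurable_indicator) simp
    then have "(\<integral>\<^sup>+y. indicator A (y + T x) \<partial>lborel) = emeasure lborel A"
      by (simp add: add.commute)
    then show "(\<integral>\<^sup>+y. indicator A (y + T x) * indicator ?U x \<partial>lborel) = emeasure lborel A * indicator ?U x"
      by (subst nn_integral_multc) auto
  qed
  also have "\<dots> = emeasure lborel A * emeasure lborel ?U"
    by (simp add: nn_integral_cmult)
  finally have "emeasure lborel (T -` A) = emeasure lborel A"
    using U0 Ut by (auto simp: ennreal_mult_cancel_left mult.commute[of _ "emeasure lborel ?U"])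
  then show "emeasure (distr lborel borel T) A = emeasure lborel A"
    by (subst emeasure_distr) auto
qed

section \<open>The Hermitian product and the orthogonality of its powers\<close>

definition herm :: "complex ^ 'n::finite \<Rightarrow> complex ^ 'n \<Rightarrow> complex" where
  "herm z w = (\<Sum>j\<in>UNIV. z $ j * cnj (w $ j))"

lemma herm_smult_left: "herm (c *s z) w = c * herm z w"
  by (simp add: herm_def sum_distrib_left mult_ac)

lemma herm_scaleR_left: "herm (r *\<^sub>R z) w = of_real r * herm z w"
  unfolding herm_def vector_scaleR_component
  by (simp add: sum_distrib_left scaleR_conv_of_real[where 'a=complex] mult.assoc)

lemma cnj_herm: "cnj (herm z w) = herm w z"
  by (simp add: herm_def mult_ac)

lemma norm_smult: "norm (c *s (z :: complex ^ 'n::finite)) = cmod c * norm z"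
  by (simp add: norm_vec_def L2_set_def norm_mult power_mult_distrib real_sqrt_mult
      flip: sum_distrib_left)

lemma herm_self: "herm z z = of_real ((norm z)\<^sup>2)"
  by (simp add: herm_def norm_vec_def L2_set_def sum_nonneg complex_norm_square del: of_real_power)

lemma Re_herm: "Re (herm z w) = inner z w"
  by (simp add: herm_def inner_vec_def inner_complex_def)

lemma Cauchy_Schwarz_herm: "cmod (herm z w) \<le> norm z * norm w"
proof -
  have "cmod (herm z w) \<le> (\<Sum>j\<in>UNIV. norm (z $ j) * norm (w $ j))"
    unfolding herm_def by (intro order_trans[OF norm_sum]) (simp add: norm_mult)
  also have "\<dots> \<le> norm z * norm w"
    unfolding norm_vec_def using L2_set_mult_ineq[of "\<lambda>j. norm (z $ j)" "\<lambda>j. norm (w $ j)" UNIV]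
    by simp
  finally show ?thesis .
qed

lemma measurable_herm [measurable (raw)]:
  assumes "f \<in> borel_measurable M" "g \<in> borel_measurable M"
  shows "(\<lambda>x. herm (f x) (g x)) \<in> borel_measurable M"
proof -
  have "continuous_on UNIV (\<lambda>p. herm (fst p) (snd p))"
    unfolding herm_def by (intro continuous_intros)
  from borel_measurable_continuous_on[OF this, of "\<lambda>x. (f x, g x)"] show ?thesis
    using assms by simp
qed

lemma measurable_cnj [measurable (raw)]:
  "f \<in> borel_measurable M \<Longrightarrow> (\<lambda>x. cnj (f x)) \<in> borel_measurable M"
  by (rule borel_measurable_continuous_on[where f=cnj]) (intro continuous_intros)

lemma linear_smult: "linear (\<lambda>z :: complex ^ 'n::finite. c *s z)"
  by (auto intro!: linearI simp: vec_eq_iff algebra_simps scaleR_conv_of_real)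

lemma lborel_integral_rotate:
  fixes f :: "complex ^ 'n::finite \<Rightarrow> 'b::{banach, second_countable_topology}"
  assumes "cmod c = 1" and [measurable]: "f \<in> borel_measurable borel"
  shows "(\<integral>z. f (c *s z) \<partial>lborel) = (\<integral>z. f z \<partial>lborel)"
proof -
  let ?T = "\<lambda>z :: complex ^ 'n. c *s z"
  have [measurable]: "?T \<in> borel_measurable borel"
    using linear_smult by (intro borel_measurable_continuous_onI linear_continuous_on linear_conv_bounded_linear[THEN iffD1])
  have "distr lborel borel ?T = lborel"
    using assms(1) by (intro distr_lborel_linear_isometry linear_smult) (simp add: norm_smult)
  then have "(\<integral>z. f z \<partial>lborel) = (\<integral>z. f z \<partial>distr lborel borel ?T)" by simp
  also have "\<dots> = (\<integral>z. f (c *s z) \<partial>lborel)" by (rule integral_distr) auto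
  finally show ?thesis by simp
qed

text \<open>Replacing \<open>z\<close> by \<open>c *s z\<close> multiplies the integrand by
  \<open>c ^ j * cnj c ^ k\<close>. The angle pi / (j - k) makes this factor -1, so the integral
  equals its own negative.\<close>

lemma integral_herm_powers_orthogonal:
  fixes q :: "complex ^ 'n::finite \<Rightarrow> real"
  assumes [measurable]: "q \<in> borel_measurable borel"
    and rot: "\<And>c z. cmod c = 1 \<Longrightarrow> q (c *s z) = q z" and "j \<noteq> k"
  shows "(\<integral>z. of_real (q z) * (herm z w ^ j * cnj (herm z w) ^ k) \<partial>lborel) = 0"
proof -
  define \<theta> where "\<theta> = pi / (real j - real k)"
  define c where "c = cis \<theta>"
  have c1: "cmod c = 1" by (simp add: c_def)
  have "c ^ j * cnj c ^ k = cis (real j * \<theta>) * cis (- (real k * \<theta>))"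
    by (simp only: c_def cis_cnj Complex.DeMoivre) (simp add: mult_ac)
  also have "\<dots> = cis ((real j - real k) * \<theta>)"
    by (simp add: cis_mult algebra_simps)
  also have "(real j - real k) * \<theta> = pi"
    using \<open>j \<noteq> k\<close> by (simp add: \<theta>_def)
  finally have cc: "c ^ j * cnj c ^ k = -1" by simp
  let ?f = "\<lambda>z. of_real (q z) * (herm z w ^ j * cnj (herm z w) ^ k)"
  have m: "?f \<in> borel_measurable borel"
    by measurable
  have "?f (c *s z) = (c ^ j * cnj c ^ k) * ?f z" for z
    using rot[OF c1, of z] by (simp add: herm_smult_left power_mult_distrib mult_ac)
  then have "?f (c *s z) = - ?f z" for z
    by (simp add: cc)
  then have "(\<integral>z. ?f z \<partial>lborel) = - (\<integral>z. ?f z \<partial>lborel)"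
    using lborel_integral_rotate[OF c1 m] by simp
  then show ?thesis by (simp add: eq_neg_iff_add_eq_0 flip: mult_2)
qed

text \<open>Orthogonality gives the identity for partial sums, and the squared series of absolute
  values dominates them in the limit. It is applied twice: to the exponential series with a Gaussian
  weight and to the binomial series with a power weight on the ball.\<close>

lemma herm_Parseval:
  fixes q :: "complex ^ 'n::finite \<Rightarrow> real" and b :: "nat \<Rightarrow> real"
  assumes [measurable]: "q \<in> borel_measurable borel"
    and rot: "\<And>c z. cmod c = 1 \<Longrightarrow> q (c *s z) = q z"
    and q0: "\<And>z. 0 \<le> q z"
    and sm: "\<And>z. q z \<noteq> 0 \<Longrightarrow> summable (\<lambda>k. \<bar>b k\<bar> * cmod (herm z w) ^ k)"
    and int: "integrable lborel (\<lambda>z. q z * (\<Sum>k. \<bar>b k\<bar> * cmod (herm z w) ^ k)\<^sup>2)"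
  shows "(\<lambda>k. (b k)\<^sup>2 * (\<integral>z. q z * cmod (herm z w) ^ (2 * k) \<partial>lborel)) sums
         (\<integral>z. q z * (cmod (\<Sum>k. of_real (b k) * herm z w ^ k))\<^sup>2 \<partial>lborel)"
proof -
  let ?G = "\<lambda>z. \<Sum>k. \<bar>b k\<bar> * cmod (herm z w) ^ k"
  let ?F = "\<lambda>z. \<Sum>k. of_real (b k) * herm z w ^ k"
  let ?S = "\<lambda>N z. \<Sum>k<N. of_real (b k) * herm z w ^ k"
  have G0: "0 \<le> ?G z" if "q z \<noteq> 0" for z
    using sm[OF that] by (intro suminf_nonneg) auto
  have term_le: "\<bar>b k\<bar> * cmod (herm z w) ^ k \<le> ?G z" if "q z \<noteq> 0" for z k
    using sum_le_suminf[OF sm[OF that], of "{k}"] by simp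
  have S_le: "cmod (?S N z) \<le> ?G z" if "q z \<noteq> 0" for z N
  proof -
    have "cmod (?S N z) \<le> (\<Sum>k<N. \<bar>b k\<bar> * cmod (herm z w) ^ k)"
      by (intro order_trans[OF norm_sum]) (simp add: norm_mult norm_power)
    also have "\<dots> \<le> ?G z"
      by (intro sum_le_suminf sm that) auto
    finally show ?thesis .
  qed
  have int2: "integrable lborel (\<lambda>z. of_real (q z) * (of_real (b j) * herm z w ^ j * cnj (of_real (b k) * herm z w ^ k)))" for j k
  proof (rule Bochner_Integration.integrable_bound[OF int])
    show "AE z in lborel. norm (of_real (q z) * (of_real (b j) * herm z w ^ j * cnj (of_real (b k) * herm z w ^ k)))
        \<le> norm (q z * (?G z)\<^sup>2)"
    proof (rule AE_I2)
      fix z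
      show "norm (of_real (q z) * (of_real (b j) * herm z w ^ j * cnj (of_real (b k) * herm z w ^ k))) \<le> norm (q z * (?G z)\<^sup>2)"
      proof (cases "q z = 0")
        case False
        have "(\<bar>b j\<bar> * cmod (herm z w) ^ j) * (\<bar>b k\<bar> * cmod (herm z w) ^ k) \<le> ?G z * ?G z"
          by (intro mult_mono term_le False G0) auto
        then show ?thesis
          using q0[of z] by (simp add: norm_mult norm_power power2_eq_square mult_left_mono)
      qed simp
    qed
  qed measurable
  have offdiag: "(\<integral>z. of_real (q z) * (of_real (b j) * herm z w ^ j * cnj (of_real (b k) * herm z w ^ k)) \<partial>lborel)
       = of_real (b j * b k) * (\<integral>z. of_real (q z) * (herm z w ^ j * cnj (herm z w) ^ k) \<partial>lborel)" for j k
    by (subst integral_mult_right_zero[symmetric]) (simp add: mult_ac)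
  have offdiag': "(\<integral>z. of_real (q z) * (of_real (b j) * herm z w ^ j * cnj (of_real (b k) * herm z w ^ k)) \<partial>lborel)
       = (if j = k then of_real (b j * b k) * (\<integral>z. of_real (q z) * (herm z w ^ j * cnj (herm z w) ^ k) \<partial>lborel) else 0)" for j k
    using integral_herm_powers_orthogonal[OF assms(1) rot, where j=j and k=k and w=w]
    unfolding offdiag by (cases "j = k") (simp_all del: complex_cnj_power)
  have part: "(\<integral>z. q z * (cmod (?S N z))\<^sup>2 \<partial>lborel)
      = (\<Sum>k<N. (b k)\<^sup>2 * (\<integral>z. q z * cmod (herm z w) ^ (2 * k) \<partial>lborel))" for N
  proof -
    have "complex_of_real (\<integral>z. q z * (cmod (?S N z))\<^sup>2 \<partial>lborel)
       = (\<integral>z. of_real (q z) * (?S N z * cnj (?S N z)) \<partial>lborel)"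
      by (subst integral_complex_of_real[symmetric]) (simp only: of_real_mult complex_norm_square)
    also have "\<dots> = (\<integral>z. (\<Sum>j<N. \<Sum>k<N. of_real (q z) * (of_real (b j) * herm z w ^ j * cnj (of_real (b k) * herm z w ^ k))) \<partial>lborel)"
      by (intro Bochner_Integration.integral_cong refl) (subst cnj_sum, subst sum_product, simp only: sum_distrib_left)
    also have "\<dots> = (\<Sum>j<N. \<Sum>k<N. \<integral>z. of_real (q z) * (of_real (b j) * herm z w ^ j * cnj (of_real (b k) * herm z w ^ k)) \<partial>lborel)"
      by (subst Bochner_Integration.integral_sum; (intro Bochner_Integration.integrable_sum int2 sum.cong refl Bochner_Integration.integral_sum)?)
    also have "\<dots> = (\<Sum>j<N. \<Sum>k<N. if j = k then of_real (b j * b k) * (\<integral>z. of_real (q z) * (herm z w ^ j * cnj (herm z w) ^ k) \<partial>lborel) else 0)"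
      by (simp only: offdiag')
    also have "\<dots> = (\<Sum>k<N. of_real (b k * b k) * (\<integral>z. of_real (q z) * (herm z w ^ k * cnj (herm z w) ^ k) \<partial>lborel))"
      by (simp add: sum.delta)
    also have "\<dots> = (\<Sum>k<N. of_real ((b k)\<^sup>2) * of_real (\<integral>z. q z * cmod (herm z w) ^ (2 * k) \<partial>lborel))"
    proof (intro sum.cong refl arg_cong2[where f="(*)"])
      fix k
      have "of_real (q z) * (herm z w ^ k * cnj (herm z w) ^ k) = of_real (q z * cmod (herm z w) ^ (2 * k))" for z
        by (simp add: power_mult complex_norm_square[symmetric] power_mult_distrib[symmetric])
      then show "(\<integral>z. of_real (q z) * (herm z w ^ k * cnj (herm z w) ^ k) \<partial>lborel)
         = of_real (\<integral>z. q z * cmod (herm z w) ^ (2 * k) \<partial>lborel)"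
        by (simp only: integral_complex_of_real)
    qed (simp add: power2_eq_square)
    also have "\<dots> = of_real (\<Sum>k<N. (b k)\<^sup>2 * (\<integral>z. q z * cmod (herm z w) ^ (2 * k) \<partial>lborel))"
      by simp
    finally show ?thesis
      by (simp only: of_real_eq_iff)
  qed
  have "(\<lambda>N. \<integral>z. q z * (cmod (?S N z))\<^sup>2 \<partial>lborel) \<longlonglongrightarrow> (\<integral>z. q z * (cmod (?F z))\<^sup>2 \<partial>lborel)"
  proof (rule integral_dominated_convergence[OF _ _ int])
    show "AE z in lborel. (\<lambda>N. q z * (cmod (?S N z))\<^sup>2) \<longlonglongrightarrow> q z * (cmod (?F z))\<^sup>2"
    proof (rule AE_I2)
      fix z
      show "(\<lambda>N. q z * (cmod (?S N z))\<^sup>2) \<longlonglongrightarrow> q z * (cmod (?F z))\<^sup>2"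
      proof (cases "q z = 0")
        case False
        have "summable (\<lambda>k. norm (of_real (b k) * herm z w ^ k))"
          using sm[OF False] by (simp add: norm_mult norm_power)
        from summable_LIMSEQ[OF summable_norm_cancel[OF this]]
        show ?thesis by (intro tendsto_intros)
      qed simp
    qed
    show "AE z in lborel. norm (q z * (cmod (?S N z))\<^sup>2) \<le> q z * (?G z)\<^sup>2" for N
    proof (rule AE_I2)
      fix z
      show "norm (q z * (cmod (?S N z))\<^sup>2) \<le> q z * (?G z)\<^sup>2"
        using S_le[of z N] q0[of z] by (cases "q z = 0") (auto intro!: mult_left_mono power_mono)
    qed
  qed measurable
  then show ?thesis
    unfolding sums_def part .
qed

lemma DIM_complex_vec: "DIM(complex ^ 'n::finite) = 2 * CARD('n)"
  by simp

section \<open>Radial weights: moments of the ball and Gaussian moments\<close>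

lemma nn_integral_lborel_scaleR:
  fixes f :: "'a::euclidean_space \<Rightarrow> ennreal"
  assumes [measurable]: "f \<in> borel_measurable borel" and r: "0 < r"
  shows "(\<integral>\<^sup>+x. f x \<partial>lborel) = ennreal (r ^ DIM('a)) * (\<integral>\<^sup>+x. f (r *\<^sub>R x) \<partial>lborel)"
proof -
  have "(\<integral>\<^sup>+x. f x \<partial>lborel)
      = (\<integral>\<^sup>+x. f x \<partial>density (distr lborel borel (\<lambda>x. 0 + r *\<^sub>R x)) (\<lambda>_. ennreal (\<bar>r\<bar>^DIM('a))))"
    using r by (subst lborel_affine[of r 0]) auto
  also have "\<dots> = ennreal (r ^ DIM('a)) * (\<integral>\<^sup>+x. f (r *\<^sub>R x) \<partial>lborel)"
    using r by (simp add: nn_integral_density nn_integral_distr nn_integral_cmult)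
  finally show ?thesis .
qed

text \<open>The common unknown of all radially weighted moments. It is never computed: it is
  eliminated between the Gaussian weight and the power weight.\<close>

definition ball_moment :: "nat \<Rightarrow> complex ^ 'n::finite \<Rightarrow> ennreal" where
  "ball_moment k w = (\<integral>\<^sup>+z. indicator (ball 0 1) z * ennreal (cmod (herm z w) ^ (2 * k)) \<partial>lborel)"

text \<open>Scaling by \<open>sqrt y\<close> contributes \<open>y ^ CARD('n)\<close> from the real
  dimension 2n and \<open>y ^ k\<close> from the homogeneity of the integrand.\<close>

lemma nn_integral_ball_scaled:
  fixes w :: "complex ^ 'n::finite"
  assumes "0 < y"
  shows "(\<integral>\<^sup>+z. indicator {z. (norm z)\<^sup>2 < y} z * ennreal (cmod (herm z w) ^ (2 * k)) \<partial>lborel)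
       = ennreal (y ^ (CARD('n) + k)) * ball_moment k w"
proof -
  have [measurable]: "{z :: complex ^ 'n. (norm z)\<^sup>2 < y} \<in> sets borel"
    by measurable
  have [measurable]: "ball (0 :: complex ^ 'n) 1 \<in> sets borel" by simp
  have "(\<integral>\<^sup>+z. indicator {z. (norm z)\<^sup>2 < y} z * ennreal (cmod (herm z w) ^ (2 * k)) \<partial>lborel)
      = ennreal (sqrt y ^ DIM(complex ^ 'n)) *
        (\<integral>\<^sup>+z. indicator {z. (norm z)\<^sup>2 < y} (sqrt y *\<^sub>R z) * ennreal (cmod (herm (sqrt y *\<^sub>R z) w) ^ (2 * k)) \<partial>lborel)"
    using assms by (subst nn_integral_lborel_scaleR[of _ "sqrt y"]) auto
  also have "sqrt y ^ DIM(complex ^ 'n) = y ^ CARD('n)"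
    using assms by (simp only: DIM_complex_vec power_mult) simp
  also have "(\<lambda>z. indicator {z. (norm z)\<^sup>2 < y} (sqrt y *\<^sub>R z) * ennreal (cmod (herm (sqrt y *\<^sub>R z) w) ^ (2 * k)))
     = (\<lambda>z. ennreal (y ^ k) * (indicator (ball 0 1) z * ennreal (cmod (herm z w) ^ (2 * k))))"
  proof
    fix z :: "complex ^ 'n"
    have "(norm (sqrt y *\<^sub>R z))\<^sup>2 < y \<longleftrightarrow> norm z < 1"
      using assms by (simp add: power_mult_distrib abs_square_less_1)
    moreover have "cmod (herm (sqrt y *\<^sub>R z) w) ^ (2 * k) = y ^ k * cmod (herm z w) ^ (2 * k)"
      using assms by (simp add: herm_scaleR_left norm_mult power_mult_distrib) (simp add: power_mult)
    ultimately show "indicator {z. (norm z)\<^sup>2 < y} (sqrt y *\<^sub>R z) * ennreal (cmod (herm (sqrt y *\<^sub>R z) w) ^ (2 * k))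
       = ennreal (y ^ k) * (indicator (ball 0 1) z * ennreal (cmod (herm z w) ^ (2 * k)))"
      using assms by (auto simp: indicator_def ennreal_mult)
  qed
  also have "(\<integral>\<^sup>+z. ennreal (y ^ k) * (indicator (ball 0 1) z * ennreal (cmod (herm z w) ^ (2 * k))) \<partial>lborel)
     = ennreal (y ^ k) * ball_moment k w"
    unfolding ball_moment_def by (rule nn_integral_cmult) measurable
  finally show ?thesis
    using assms by (simp add: power_add ennreal_mult mult.assoc)
qed

text \<open>A radial weight written as a tail integral of \<open>h\<close> is a superposition of
  indicators of balls. By scaling each ball contributes a multiple of
  \<open>ball_moment k w\<close>, so the direction of \<open>w\<close> and the radial profile
  \<open>h\<close> decouple.\<close>

lemma nn_integral_layer_cake:
  fixes w :: "complex ^ 'n::finite" and h :: "real \<Rightarrow> ennreal"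
  assumes [measurable]: "h \<in> borel_measurable borel"
  shows "(\<integral>\<^sup>+z. ennreal (cmod (herm z w) ^ (2 * k)) * (\<integral>\<^sup>+y. indicator {(norm z)\<^sup>2<..} y * h y \<partial>lborel) \<partial>lborel)
       = ball_moment k w * (\<integral>\<^sup>+y. indicator {0<..} y * ennreal (y ^ (CARD('n) + k)) * h y \<partial>lborel)"
proof -
  have [measurable]: "{z :: complex ^ 'n. (norm z)\<^sup>2 < y} \<in> sets borel" for y
    by measurable
  let ?c = "\<lambda>z. ennreal (cmod (herm z w) ^ (2 * k))"
  have "(\<integral>\<^sup>+z. ?c z * (\<integral>\<^sup>+y. indicator {(norm z)\<^sup>2<..} y * h y \<partial>lborel) \<partial>lborel)
      = (\<integral>\<^sup>+z. (\<integral>\<^sup>+y. ?c z * (if (norm z)\<^sup>2 < y then h y else 0) \<partial>lborel) \<partial>lborel)"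
    by (intro nn_integral_cong, subst nn_integral_cmult[symmetric]) (auto intro!: nn_integral_cong)
  also have "\<dots> = (\<integral>\<^sup>+y. (\<integral>\<^sup>+z. ?c z * (if (norm z)\<^sup>2 < y then h y else 0) \<partial>lborel) \<partial>lborel)"
    by (rule lborel_pair.Fubini') measurable
  also have "\<dots> = (\<integral>\<^sup>+y. ball_moment k w * (indicator {0<..} y * ennreal (y ^ (CARD('n) + k)) * h y) \<partial>lborel)"
  proof (intro nn_integral_cong)
    fix y :: real
    have "(\<integral>\<^sup>+z. ?c z * (if (norm z)\<^sup>2 < y then h y else 0) \<partial>lborel)
        = (\<integral>\<^sup>+z. (indicator {z. (norm z)\<^sup>2 < y} z * ?c z) * h y \<partial>lborel)"
      by (intro nn_integral_cong) (auto simp: indicator_def)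
    also have "\<dots> = (\<integral>\<^sup>+z. indicator {z. (norm z)\<^sup>2 < y} z * ?c z \<partial>lborel) * h y"
      by (rule nn_integral_multc) measurable
    also have "\<dots> = ball_moment k w * (indicator {0<..} y * ennreal (y ^ (CARD('n) + k)) * h y)"
    proof (cases "0 < y")
      case False
      then have "{z :: complex ^ 'n. (norm z)\<^sup>2 < y} = {}"
        by (auto simp: not_less intro: order_trans)
      then show ?thesis using False by simp
    qed (use nn_integral_ball_scaled[where y=y and k=k and w=w] in \<open>simp add: mult_ac\<close>)
    finally show "(\<integral>\<^sup>+z. ?c z * (if (norm z)\<^sup>2 < y then h y else 0) \<partial>lborel)
      = ball_moment k w * (indicator {0<..} y * ennreal (y ^ (CARD('n) + k)) * h y)" .
  qed
  also have "\<dots> = ball_moment k w * (\<integral>\<^sup>+y. indicator {0<..} y * ennreal (y ^ (CARD('n) + k)) * h y \<partial>lborel)"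
    by (rule nn_integral_cmult) measurable
  finally show ?thesis .
qed

lemma nn_integral_Gamma_open:
  assumes "s > (0::real)" "c > 0"
  shows "(\<integral>\<^sup>+t. indicator {0<..} t * ennreal (t powr (s - 1) * exp (- (c * t))) \<partial>lborel) = ennreal (Gamma s / c powr s)"
proof -
  have "(\<integral>\<^sup>+t. indicator {0<..} t * ennreal (t powr (s - 1) * exp (- t)) \<partial>lborel) = ennreal (Gamma s)"
    unfolding Gamma_conv_nn_integral_real[OF assms(1)]
    by (intro nn_integral_cong) (auto simp: indicator_def exp_minus divide_inverse)
  then have "ennreal (Gamma s) = ennreal \<bar>c\<bar> * (\<integral>\<^sup>+t. indicator {0<..} (0 + c * t) * ennreal ((0 + c * t) powr (s - 1) * exp (- (0 + c * t))) \<partial>lborel)"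
    using assms by (subst nn_integral_real_affine[symmetric]) auto
  also have "\<dots> = ennreal c * (\<integral>\<^sup>+t. ennreal (c powr (s - 1)) * (indicator {0<..} t * ennreal (t powr (s - 1) * exp (- (c * t)))) \<partial>lborel)"
    unfolding abs_of_pos[OF assms(2)]
  proof (rule arg_cong2[where f="(*)", OF refl nn_integral_cong])
    fix t :: real
    show "indicator {0<..} (0 + c * t) * ennreal ((0 + c * t) powr (s - 1) * exp (- (0 + c * t)))
      = ennreal (c powr (s - 1)) * (indicator {0<..} t * ennreal (t powr (s - 1) * exp (- (c * t))))"
      using assms by (cases "0 < t") (simp_all add: zero_less_mult_iff powr_mult ennreal_mult[symmetric] mult_ac)
  qed
  also have "\<dots> = ennreal c * (ennreal (c powr (s - 1)) * (\<integral>\<^sup>+t. (indicator {0<..} t * ennreal (t powr (s - 1) * exp (- (c * t)))) \<partial>lborel))"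
    by (subst nn_integral_cmult) auto
  also have "\<dots> = ennreal (c powr s) * (\<integral>\<^sup>+t. (indicator {0<..} t * ennreal (t powr (s - 1) * exp (- (c * t)))) \<partial>lborel)"
    using assms by (simp add: mult.assoc[symmetric] ennreal_mult[symmetric] powr_diff)
  finally have *: "ennreal (c powr s) * (\<integral>\<^sup>+t. (indicator {0<..} t * ennreal (t powr (s - 1) * exp (- (c * t)))) \<partial>lborel) = ennreal (Gamma s)" ..
  have "ennreal (1 / c powr s) * (ennreal (c powr s) * (\<integral>\<^sup>+t. (indicator {0<..} t * ennreal (t powr (s - 1) * exp (- (c * t)))) \<partial>lborel))
     = (\<integral>\<^sup>+t. (indicator {0<..} t * ennreal (t powr (s - 1) * exp (- (c * t)))) \<partial>lborel)"
    using assms by (simp add: mult.assoc[symmetric] ennreal_mult[symmetric])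
  then show ?thesis
    unfolding * using assms by (simp add: ennreal_mult[symmetric] Gamma_real_pos less_imp_le)
qed

text \<open>The exponential is its own tail integral, so the layer-cake formula applies with
  \<open>h y = exp (- y)\<close> and produces \<open>Gamma (n + k + 1)\<close>.\<close>

lemma nn_integral_gaussian_moment:
  fixes w :: "complex ^ 'n::finite"
  shows "(\<integral>\<^sup>+z. ennreal (exp (- (norm z)\<^sup>2) * cmod (herm z w) ^ (2 * k)) \<partial>lborel)
       = ball_moment k w * ennreal (fact (CARD('n) + k))"
proof -
  have tail: "(\<integral>\<^sup>+y. indicator {t<..} y * ennreal (exp (- y)) \<partial>lborel) = ennreal (exp (- t))" for t :: real
  proof -
    have "(\<integral>\<^sup>+y. indicator {t<..} y * ennreal (exp (- y)) \<partial>lborel)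
        = (\<integral>\<^sup>+y. indicator {0<..} (y - t) * ennreal (exp (-t) * exp (- (y - t))) \<partial>lborel)"
      by (intro nn_integral_cong) (auto simp: indicator_def mult_exp_exp)
    also have "\<dots> = (\<integral>\<^sup>+y. indicator {0<..} y * ennreal (exp (-t) * exp (- y)) \<partial>lborel)"
      by (subst nn_integral_real_affine[of _ 1 t]) auto
    also have "\<dots> = (\<integral>\<^sup>+y. ennreal (exp (-t)) * (indicator {0<..} y * ennreal (y powr (1 - 1) * exp (- (1 * y)))) \<partial>lborel)"
      by (intro nn_integral_cong) (auto simp: indicator_def ennreal_mult)
    also have "\<dots> = ennreal (exp (-t)) * (\<integral>\<^sup>+y. indicator {0<..} y * ennreal (y powr (1 - 1) * exp (- (1 * y))) \<partial>lborel)"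
      by (rule nn_integral_cmult) measurable
    also have "\<dots> = ennreal (exp (-t))"
      by (subst nn_integral_Gamma_open) auto
    finally show ?thesis .
  qed
  have "(\<integral>\<^sup>+z. ennreal (exp (- (norm z)\<^sup>2) * cmod (herm z w) ^ (2 * k)) \<partial>lborel)
     = (\<integral>\<^sup>+z. ennreal (cmod (herm z w) ^ (2 * k)) * (\<integral>\<^sup>+y. indicator {(norm z)\<^sup>2<..} y * ennreal (exp (- y)) \<partial>lborel) \<partial>lborel)"
    by (simp only: tail) (simp add: ennreal_mult mult.commute)
  also have "\<dots> = ball_moment k w * (\<integral>\<^sup>+y. indicator {0<..} y * ennreal (y ^ (CARD('n) + k)) * ennreal (exp (- y)) \<partial>lborel)"
    by (rule nn_integral_layer_cake) measurable
  also have "(\<integral>\<^sup>+y. indicator {0<..} y * ennreal (y ^ (CARD('n) + k)) * ennreal (exp (- y)) \<partial>lborel)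
     = (\<integral>\<^sup>+y. indicator {0<..} y * ennreal (y powr (real (CARD('n) + k + 1) - 1) * exp (- (1 * y))) \<partial>lborel)"
    by (intro nn_integral_cong) (auto simp: indicator_def ennreal_mult powr_add powr_realpow power_add)
  also have "\<dots> = ennreal (Gamma (real (CARD('n) + k + 1)) / 1 powr real (CARD('n) + k + 1))"
    by (rule nn_integral_Gamma_open) auto
  also have "Gamma (real (CARD('n) + k + 1)) / 1 powr real (CARD('n) + k + 1) = fact (CARD('n) + k)"
    using Gamma_fact[of "CARD('n) + k", where 'a=real] by (simp add: add_ac)
  finally show ?thesis .
qed

lemma nn_integral_ball_weighted_moment:
  fixes w :: "complex ^ 'n::finite"
  assumes m: "0 < m"
  shows "(\<integral>\<^sup>+z. ennreal (indicator (ball 0 1) z * (1 - (norm z)\<^sup>2) powr m * cmod (herm z w) ^ (2 * k)) \<partial>lborel)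
       = ball_moment k w * ennreal (fact (CARD('n) + k) * Gamma (m + 1) / Gamma (real (CARD('n) + k) + 1 + m))"
proof -
  \<comment> \<open>The density whose tail integral is \<open>(1 - t) powr m\<close>; the layer-cake
    formula then turns the radial part into the Beta integral with parameters n + k + 1 and
    \<open>m\<close>.\<close>
  define h where "h y = (if 0 \<le> y \<and> y \<le> 1 then m * (1 - y) powr (m - 1) else 0)" for y :: real
  have [measurable]: "h \<in> borel_measurable borel" unfolding h_def by measurable
  have tail: "(\<integral>\<^sup>+y. indicator {t<..} y * ennreal (h y) \<partial>lborel) = ennreal (if t < 1 then (1 - t) powr m else 0)"
    if "0 \<le> t" for t :: real
  proof (cases "t < 1")
    case True
    have cont: "continuous_on {t..1} (\<lambda>y. - ((1 - y) powr m))"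
      by (intro continuous_on_minus continuous_on_powr' continuous_intros) (use m in auto)
    have "((\<lambda>y. m * (1 - y) powr (m - 1)) has_integral (- ((1 - 1) powr m) - (- ((1 - t) powr m)))) {t..1}"
      using True m that cont
      by (intro fundamental_theorem_of_calculus_interior)
         (auto intro!: derivative_eq_intros simp flip: has_real_derivative_iff_has_vector_derivative)
    then have "((\<lambda>y. m * (1 - y) powr (m - 1)) has_integral ((1 - t) powr m)) {t..1}"
      using m by simp
    then have "(\<integral>\<^sup>+y. ennreal (indicator {t..1} y * (m * (1 - y) powr (m - 1))) \<partial>lborel) = ennreal ((1 - t) powr m)"
      using m by (intro nn_integral_has_integral_lebesgue) auto
    also have "(\<integral>\<^sup>+y. ennreal (indicator {t..1} y * (m * (1 - y) powr (m - 1))) \<partial>lborel)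
       = (\<integral>\<^sup>+y. indicator {t<..} y * ennreal (h y) \<partial>lborel)"
      using AE_lborel_singleton[of t] that
      by (intro nn_integral_cong_AE) (auto simp: indicator_def h_def elim!: eventually_mono)
    finally show ?thesis using True by simp
  next
    case False
    have "(\<integral>\<^sup>+y. indicator {t<..} y * ennreal (h y) \<partial>lborel) = (\<integral>\<^sup>+(y::real). 0 \<partial>lborel)"
      using False by (intro nn_integral_cong) (auto simp: indicator_def h_def)
    then show ?thesis using False by simp
  qed
  have "(\<integral>\<^sup>+z. ennreal (indicator (ball 0 1) z * (1 - (norm z)\<^sup>2) powr m * cmod (herm z w) ^ (2 * k)) \<partial>lborel)
     = (\<integral>\<^sup>+z. ennreal (cmod (herm z w) ^ (2 * k)) * (\<integral>\<^sup>+y. indicator {(norm z)\<^sup>2<..} y * ennreal (h y) \<partial>lborel) \<partial>lborel)"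
    by (intro nn_integral_cong, simp only: tail zero_le_power2)
      (auto simp: indicator_def ennreal_mult abs_square_less_1 mult.commute)
  also have "\<dots> = ball_moment k w * (\<integral>\<^sup>+y. indicator {0<..} y * ennreal (y ^ (CARD('n) + k)) * ennreal (h y) \<partial>lborel)"
    by (rule nn_integral_layer_cake) measurable
  also have "(\<integral>\<^sup>+y. indicator {0<..} y * ennreal (y ^ (CARD('n) + k)) * ennreal (h y) \<partial>lborel)
     = (\<integral>\<^sup>+y. ennreal m * ennreal (indicator {0..1} y * (y powr (real (CARD('n) + k + 1) - 1) * (1 - y) powr (m - 1))) \<partial>lborel)"
    using m by (intro nn_integral_cong)
      (auto simp: indicator_def ennreal_mult[symmetric] powr_add powr_realpow power_add h_def)
  also have "\<dots> = ennreal m * (\<integral>\<^sup>+y. ennreal (indicator {0..1} y * (y powr (real (CARD('n) + k + 1) - 1) * (1 - y) powr (m - 1))) \<partial>lborel)"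
    by (rule nn_integral_cmult) measurable
  also have "(\<integral>\<^sup>+y. ennreal (indicator {0..1} y * (y powr (real (CARD('n) + k + 1) - 1) * (1 - y) powr (m - 1))) \<partial>lborel)
     = ennreal (Beta (real (CARD('n) + k + 1)) m)"
    using m by (intro nn_integral_has_integral_lebesgue has_integral_Beta_real) auto
  also have "ennreal m * ennreal (Beta (real (CARD('n) + k + 1)) m)
     = ennreal (fact (CARD('n) + k) * Gamma (m + 1) / Gamma (real (CARD('n) + k) + 1 + m))"
  proof -
    have "Gamma (real (CARD('n) + k + 1)) = fact (CARD('n) + k)"
      using Gamma_fact[of "CARD('n) + k", where 'a=real] by (simp add: add_ac)
    moreover have "Gamma (m + 1) = m * Gamma m"
      using m by (intro Gamma_plus1) (auto elim!: nonpos_Ints_cases)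
    ultimately have "m * Beta (real (CARD('n) + k + 1)) m = fact (CARD('n) + k) * Gamma (m + 1) / Gamma (real (CARD('n) + k) + 1 + m)"
      unfolding Beta_def by (simp add: add_ac)
    then show ?thesis using m by (simp add: ennreal_mult'[symmetric])
  qed
  finally show ?thesis .
qed

text \<open>The Gaussian moment for \<open>k = 0\<close>, where the integrand has the factor
  \<open>0 ^ 0 = 1\<close>.\<close>

lemma emeasure_unit_ball_gaussian:
  "(\<integral>\<^sup>+(z :: complex ^ 'n). ennreal (exp (- (norm z)\<^sup>2)) \<partial>lborel)
     = emeasure lborel (ball (0 :: complex ^ 'n::finite) 1) * ennreal (fact CARD('n))"
  using nn_integral_gaussian_moment[of "0 :: complex ^ 'n" 0] by (simp add: ball_moment_def)

lemma integrable_gaussian: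
  assumes "0 < c"
  shows "integrable lborel (\<lambda>z :: complex ^ 'n::finite. exp (- (c * (norm z)\<^sup>2)))"
proof (rule integrableI_bounded)
  have "(\<integral>\<^sup>+(z :: complex ^ 'n). ennreal (exp (- (c * (norm z)\<^sup>2))) \<partial>lborel)
     = ennreal ((1 / sqrt c) ^ DIM(complex ^ 'n)) * (\<integral>\<^sup>+(z :: complex ^ 'n). ennreal (exp (- (c * (norm ((1 / sqrt c) *\<^sub>R z))\<^sup>2))) \<partial>lborel)"
    using assms by (subst nn_integral_lborel_scaleR[of _ "1 / sqrt c"]) auto
  also have "\<dots> = ennreal ((1 / sqrt c) ^ DIM(complex ^ 'n)) * (\<integral>\<^sup>+(z :: complex ^ 'n). ennreal (exp (- (norm z)\<^sup>2)) \<partial>lborel)"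
    using assms by (simp add: power_mult_distrib power_divide)
  also have "\<dots> < \<infinity>"
    unfolding emeasure_unit_ball_gaussian using emeasure_lborel_ball_finite[of "0 :: complex ^ 'n" 1]
    by (auto simp: ennreal_mult_less_top)
  finally show "(\<integral>\<^sup>+(z :: complex ^ 'n). ennreal (norm (exp (- (c * (norm z)\<^sup>2)))) \<partial>lborel) < \<infinity>" by simp
qed measurable

text \<open>Completing the square: the integrand is a Gaussian centred at
  \<open>r *\<^sub>R w\<close>, up to a constant, and translation invariance removes the
  centre.\<close>

lemma nn_integral_shifted_gaussian:
  fixes w :: "complex ^ 'n::finite"
  shows "(\<integral>\<^sup>+z. ennreal (exp (- (norm z)\<^sup>2) * (cmod (exp (of_real r * herm z w)))\<^sup>2) \<partial>lborel)
     = ennreal (exp (r\<^sup>2 * (norm w)\<^sup>2)) * (\<integral>\<^sup>+z. ennreal (exp (- (norm (z :: complex ^ 'n))\<^sup>2)) \<partial>lborel)"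
proof -
  have eq: "exp (- (norm z)\<^sup>2) * (cmod (exp (of_real r * herm z w)))\<^sup>2
      = exp (r\<^sup>2 * (norm w)\<^sup>2) * exp (- (norm (- (r *\<^sub>R w) + z))\<^sup>2)" for z :: "complex ^ 'n"
  proof -
    have "(norm (- (r *\<^sub>R w) + z))\<^sup>2 = (norm z)\<^sup>2 - 2 * r * inner z w + r\<^sup>2 * (norm w)\<^sup>2"
      unfolding power2_norm_eq_inner
      by (simp add: inner_add_left inner_add_right inner_commute algebra_simps power2_eq_square)
    then have "r\<^sup>2 * (norm w)\<^sup>2 + - (norm (- (r *\<^sub>R w) + z))\<^sup>2 = - (norm z)\<^sup>2 + 2 * (r * inner z w)"
      by simp
    then show ?thesis
      by (simp add: norm_exp_eq_Re Re_herm exp_double[symmetric] flip: exp_add)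
  qed
  have "(\<integral>\<^sup>+(z :: complex ^ 'n). ennreal (exp (- (norm (- (r *\<^sub>R w) + z))\<^sup>2)) \<partial>lborel)
     = (\<integral>\<^sup>+z. ennreal (exp (- (norm z)\<^sup>2)) \<partial>distr lborel borel ((+) (- (r *\<^sub>R w))))"
    by (subst nn_integral_distr) auto
  then show ?thesis
    unfolding eq by (simp add: ennreal_mult nn_integral_cmult lborel_distr_plus)
qed

text \<open>Parseval's identity for the exponential of \<open>sqrt t\<close> times
  \<open>herm z w\<close>, combined with the shifted Gaussian integral. All Gaussian moments are
  thereby known through one generating function.\<close>

lemma gaussian_moment_generating:
  fixes w :: "complex ^ 'n::finite"
  assumes "0 \<le> t"
  shows "(\<Sum>k. ennreal (t ^ k / (fact k)\<^sup>2) * (\<integral>\<^sup>+z. ennreal (exp (- (norm z)\<^sup>2) * cmod (herm z w) ^ (2 * k)) \<partial>lborel))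
     = ennreal (exp (t * (norm w)\<^sup>2)) * (\<integral>\<^sup>+z. ennreal (exp (- (norm (z :: complex ^ 'n))\<^sup>2)) \<partial>lborel)"
proof -
  define r where "r = sqrt t"
  have r: "0 \<le> r" "r\<^sup>2 = t" using assms by (auto simp: r_def)
  let ?q = "\<lambda>z :: complex ^ 'n. exp (- (norm z)\<^sup>2)"
  let ?b = "\<lambda>k. r ^ k / fact k :: real"
  have e1: "(\<Sum>k. \<bar>?b k\<bar> * cmod (herm z w) ^ k) = exp (r * cmod (herm z w))" for z
    using r by (simp add: exp_def power_mult_distrib divide_inverse mult_ac)
  have e2: "(\<Sum>k. of_real (?b k) * herm z w ^ k) = exp (of_real r * herm z w)" for z
    by (simp add: exp_def power_mult_distrib scaleR_conv_of_real divide_inverse mult_ac)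
  have sm: "summable (\<lambda>k. \<bar>?b k\<bar> * cmod (herm z w) ^ k)" for z
    using summable_exp_generic[of "r * cmod (herm z w)"] r
    by (simp add: power_mult_distrib divide_inverse mult_ac)
  \<comment> \<open>The arithmetic-geometric mean inequality spends only half of the Gaussian
    exponent on the cross term; the other half secures integrability.\<close>
  have bound: "?q z * (exp (r * cmod (herm z w)))\<^sup>2 \<le> exp (2 * r\<^sup>2 * (norm w)\<^sup>2) * exp (- (1/2 * (norm z)\<^sup>2))" for z
  proof -
    have "r * cmod (herm z w) \<le> r * (norm z * norm w)"
      by (intro mult_left_mono Cauchy_Schwarz_herm r)
    moreover have "0 \<le> (norm z / sqrt 2 - sqrt 2 * (r * norm w))\<^sup>2" by simp
    then have "2 * (r * (norm z * norm w)) \<le> 1/2 * (norm z)\<^sup>2 + 2 * r\<^sup>2 * (norm w)\<^sup>2"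
      by (simp add: power2_diff power_mult_distrib power_divide mult_ac)
    ultimately show ?thesis
      by (simp add: exp_double[symmetric] flip: exp_add)
  qed
  have int: "integrable lborel (\<lambda>z. ?q z * (exp (r * cmod (herm z w)))\<^sup>2)"
  proof (rule Bochner_Integration.integrable_bound)
    show "integrable lborel (\<lambda>z :: complex ^ 'n. exp (2 * r\<^sup>2 * (norm w)\<^sup>2) * exp (- (1/2 * (norm z)\<^sup>2)))"
      by (intro integrable_mult_right integrable_gaussian) simp
    show "AE z in lborel. norm (?q z * (exp (r * cmod (herm z w)))\<^sup>2)
        \<le> norm (exp (2 * r\<^sup>2 * (norm w)\<^sup>2) * exp (- (1/2 * (norm z)\<^sup>2)))"
      using bound by (intro AE_I2) simp
  qed measurable
  have sums: "(\<lambda>k. (?b k)\<^sup>2 * (\<integral>z. ?q z * cmod (herm z w) ^ (2 * k) \<partial>lborel)) sums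
         (\<integral>z. ?q z * (cmod (exp (of_real r * herm z w)))\<^sup>2 \<partial>lborel)"
    using herm_Parseval[of ?q ?b w] int sm unfolding e1 e2 by (simp add: norm_smult)
  have int_k: "integrable lborel (\<lambda>z. ?q z * cmod (herm z w) ^ (2 * k))" for k
  proof -
    have "(\<integral>\<^sup>+z. ennreal (norm (exp (- (norm z)\<^sup>2) * cmod (herm z w) ^ (2 * k))) \<partial>lborel) < \<infinity>"
    proof -
      have "ball_moment k w \<le> (\<integral>\<^sup>+z. ennreal (norm w ^ (2 * k)) * indicator (ball 0 1) z \<partial>(lborel :: (complex ^ 'n) measure))"
        unfolding ball_moment_def
      proof (intro nn_integral_mono)
        fix z :: "complex ^ 'n"
        have "cmod (herm z w) ^ (2 * k) \<le> norm w ^ (2 * k)" if "norm z < 1"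
          using Cauchy_Schwarz_herm[of z w] that
          by (intro power_mono) (auto intro: order_trans[OF _ mult_left_le_one_le])
        then show "indicator (ball 0 1) z * ennreal (cmod (herm z w) ^ (2 * k)) \<le> ennreal (norm w ^ (2 * k)) * indicator (ball 0 1) z"
          by (auto simp: indicator_def intro: ennreal_leI)
      qed
      also have "\<dots> < \<infinity>"
        using emeasure_lborel_ball_finite[of "0 :: complex ^ 'n" 1]
        by (subst nn_integral_cmult_indicator) (auto simp: ennreal_mult_less_top)
      finally show ?thesis
        by (simp add: nn_integral_gaussian_moment ennreal_mult_less_top)
    qed
    then show ?thesis by (intro integrableI_bounded) auto
  qed
  have int_e: "integrable lborel (\<lambda>z. ?q z * (cmod (exp (of_real r * herm z w)))\<^sup>2)"
  proof (rule Bochner_Integration.integrable_bound[OF int])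
    have "Re (of_real r * herm z w) \<le> r * cmod (herm z w)" for z
      using r by (auto intro!: mult_left_mono complex_Re_le_cmod)
    then show "AE z in lborel. norm (?q z * (cmod (exp (of_real r * herm z w)))\<^sup>2)
        \<le> norm (?q z * (exp (r * cmod (herm z w)))\<^sup>2)"
      by (intro AE_I2) (simp add: norm_exp_eq_Re)
  qed measurable
  have "(\<Sum>k. ennreal (t ^ k / (fact k)\<^sup>2) * (\<integral>\<^sup>+z. ennreal (exp (- (norm z)\<^sup>2) * cmod (herm z w) ^ (2 * k)) \<partial>lborel))
     = (\<Sum>k. ennreal ((?b k)\<^sup>2 * (\<integral>z. ?q z * cmod (herm z w) ^ (2 * k) \<partial>lborel)))"
  proof (intro suminf_cong)
    fix k
    have "(?b k)\<^sup>2 = t ^ k / (fact k)\<^sup>2"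
      by (simp add: power_divide r(2)[symmetric] power_mult[symmetric] mult.commute)
    then show "ennreal (t ^ k / (fact k)\<^sup>2) * (\<integral>\<^sup>+z. ennreal (exp (- (norm z)\<^sup>2) * cmod (herm z w) ^ (2 * k)) \<partial>lborel)
      = ennreal ((?b k)\<^sup>2 * (\<integral>z. ?q z * cmod (herm z w) ^ (2 * k) \<partial>lborel))"
      using assms by (subst nn_integral_eq_integral[OF int_k]) (auto simp: ennreal_mult'[symmetric])
  qed
  also have "\<dots> = ennreal (\<integral>z. ?q z * (cmod (exp (of_real r * herm z w)))\<^sup>2 \<partial>lborel)"
    using sums by (intro suminf_ennreal_eq) auto
  also have "\<dots> = (\<integral>\<^sup>+z. ennreal (?q z * (cmod (exp (of_real r * herm z w)))\<^sup>2) \<partial>lborel)"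
    by (subst nn_integral_eq_integral[OF int_e]) auto
  also have "\<dots> = ennreal (exp (t * (norm w)\<^sup>2)) * (\<integral>\<^sup>+z. ennreal (exp (- (norm (z :: complex ^ 'n))\<^sup>2)) \<partial>lborel)"
    unfolding nn_integral_shifted_gaussian r ..
  finally show ?thesis .
qed

section \<open>The kernel integral by binomial expansion\<close>

lemma binomial_series_complex:
  fixes x :: complex
  assumes "cmod x < 1"
  shows "(\<lambda>k. of_real (pochhammer s k / fact k) * x ^ k) sums (1 - x) powr (- of_real s)"
proof -
  have "(\<lambda>k. (- of_real s gchoose k) * (- x) ^ k) sums (1 + - x) powr (- of_real s)"
    using assms by (intro gen_binomial_complex) simp
  also have "(\<lambda>k. (- of_real s gchoose k) * (- x) ^ k) = (\<lambda>k. of_real (pochhammer s k / fact k) * x ^ k)"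
  proof
    fix k
    have "(-1) ^ k * (-1) ^ k * x ^ k = x ^ k" by (simp flip: power_mult_distrib)
    then show "(- of_real s gchoose k) * (- x) ^ k = of_real (pochhammer s k / fact k) * x ^ k"
      unfolding gbinomial_pochhammer power_minus[of x]
      by (simp add: pochhammer_of_real mult_ac)
  qed
  finally show ?thesis by simp
qed

text \<open>Parseval's identity for the binomial series of (1 - <z,w>)^(-s) reduces the integral to
  weighted ball moments. Each is replaced by the corresponding Gaussian moment, and the remaining
  series over \<open>k\<close> is summed by the Gaussian generating function inside an Euler
  integral.\<close>

lemma nn_integral_ball_kernel:
  fixes w :: "complex ^ 'n::finite"
  assumes w: "norm w < 1" and s: "real CARD('n) + 1 < s"
  shows "(\<integral>\<^sup>+z. ennreal (indicator (ball 0 1) z * (1 - (norm z)\<^sup>2) powr (s - real CARD('n) - 1)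
              * cmod (1 - herm z w) powr (- (2 * s))) \<partial>lborel)
       = emeasure lborel (ball (0 :: complex ^ 'n) 1)
         * ennreal (fact CARD('n) * Gamma (s - real CARD('n)) / Gamma s * (1 - (norm w)\<^sup>2) powr (- s))"
proof -
  define m where "m = s - real CARD('n) - 1"
  have m: "0 < m" and s0: "0 < s" using s by (auto simp: m_def)
  have w2: "(norm w)\<^sup>2 < 1" using w by (simp add: abs_square_less_1)
  let ?q = "\<lambda>z :: complex ^ 'n. indicator (ball 0 1) z * (1 - (norm z)\<^sup>2) powr m"
  define b where "b k = pochhammer s k / fact k" for k
  have b0: "0 \<le> b k" for k using s0 by (simp add: b_def pochhammer_nonneg)
  have s_npos: "s \<notin> \<int>\<^sub>\<le>\<^sub>0" using s0 by (auto elim!: nonpos_Ints_cases)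
  have bG: "b k = Gamma (s + real k) / Gamma s / fact k" for k
    using pochhammer_Gamma[OF s_npos, of k] by (simp add: b_def)
  define G where "G k = (\<integral>\<^sup>+z. ennreal (exp (- (norm z)\<^sup>2) * cmod (herm z w) ^ (2 * k)) \<partial>lborel)" for k
  let ?G0 = "\<integral>\<^sup>+z. ennreal (exp (- (norm (z :: complex ^ 'n))\<^sup>2)) \<partial>lborel"
  have herm_le: "cmod (herm z w) \<le> norm w" if "norm z < 1" for z
    using Cauchy_Schwarz_herm[of z w] that
    by (auto intro: order_trans[OF _ mult_left_le_one_le])
  have sm: "summable (\<lambda>k. b k * r ^ k)" if "0 \<le> r" "r < 1" for r
  proof -
    have "summable (\<lambda>k. complex_of_real (b k * r ^ k))"
      using sums_summable[OF binomial_series_complex[of "of_real r" s]] that by (simp add: b_def)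
    from summable_Re[OF this] show ?thesis by simp
  qed
  have [measurable]: "ball (0 :: complex ^ 'n) 1 \<in> sets borel" by simp
  have int_ball: "integrable lborel (\<lambda>z :: complex ^ 'n. indicator (ball 0 1) z * B)" for B :: real
    using emeasure_lborel_ball_finite[of "0 :: complex ^ 'n" 1] by (intro integrable_mult_left) simp
  have q1: "0 \<le> ?q z" "?q z \<le> indicator (ball 0 1) z" for z
  proof -
    show "0 \<le> ?q z" by (simp add: indicator_def)
    have "(1 - (norm z)\<^sup>2) powr m \<le> 1 powr m" if "norm z < 1"
      using that m by (intro powr_mono2) (auto simp: abs_square_le_1)
    then show "?q z \<le> indicator (ball 0 1) z" by (auto simp: indicator_def)
  qed
  have bound: "integrable lborel (\<lambda>z. ?q z * g z)"
    if [measurable]: "g \<in> borel_measurable borel" and B: "\<And>z. norm z < 1 \<Longrightarrow> \<bar>g z\<bar> \<le> B" for g B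
  proof (rule Bochner_Integration.integrable_bound[OF int_ball[of B]])
    show "AE z in lborel. norm (?q z * g z) \<le> norm (indicator (ball 0 1) z * B)"
    proof (rule AE_I2)
      fix z :: "complex ^ 'n"
      show "norm (?q z * g z) \<le> norm (indicator (ball 0 1) z * B)"
      proof (cases "norm z < 1")
        case True
        have "?q z * \<bar>g z\<bar> \<le> 1 * B"
          using q1[of z] B[OF True] True by (intro mult_mono) (auto simp: indicator_def)
        moreover have "0 \<le> B" using B[OF True] by linarith
        ultimately show ?thesis
          using q1(1)[of z] True by (auto simp: abs_mult indicator_def)
      qed simp
    qed
  qed measurable
  have powr_eq: "(\<Sum>k. of_real (b k) * herm z w ^ k) = (1 - herm z w) powr (- of_real s)" if "norm z < 1" for z
    using binomial_series_complex[of "herm z w" s] herm_le[OF that] w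
    unfolding b_def by (intro sums_unique[symmetric]) auto
  have norm_eq: "(cmod (\<Sum>k. of_real (b k) * herm z w ^ k))\<^sup>2 = cmod (1 - herm z w) powr (- (2 * s))" if "norm z < 1" for z
  proof -
    have ne: "1 - herm z w \<noteq> 0" using herm_le[OF that] w by auto
    then have "cmod ((1 - herm z w) powr (- of_real s)) = exp (- s * ln (cmod (1 - herm z w)))"
      by (simp add: powr_def norm_exp_eq_Re)
    then show ?thesis
      using ne by (simp add: powr_eq[OF that] powr_def exp_double[symmetric])
  qed
  have S_le: "(\<Sum>k. \<bar>b k\<bar> * cmod (herm z w) ^ k) \<le> (\<Sum>k. b k * norm w ^ k)"
    "0 \<le> (\<Sum>k. \<bar>b k\<bar> * cmod (herm z w) ^ k)" if "norm z < 1" for z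
    using sm[of "cmod (herm z w)"] sm[of "norm w"] herm_le[OF that] w b0
    by (auto intro!: suminf_le mult_left_mono power_mono suminf_nonneg)
  have sums: "(\<lambda>k. (b k)\<^sup>2 * (\<integral>z. ?q z * cmod (herm z w) ^ (2 * k) \<partial>lborel)) sums
     (\<integral>z. ?q z * (cmod (\<Sum>k. of_real (b k) * herm z w ^ k))\<^sup>2 \<partial>lborel)"
  proof (rule herm_Parseval)
    show "summable (\<lambda>k. \<bar>b k\<bar> * cmod (herm z w) ^ k)" if "?q z \<noteq> 0" for z
      using that sm[of "cmod (herm z w)"] herm_le[of z] w b0 by (auto simp: indicator_def split: if_splits)
    show "integrable lborel (\<lambda>z. ?q z * (\<Sum>k. \<bar>b k\<bar> * cmod (herm z w) ^ k)\<^sup>2)"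
      using S_le by (intro bound[where B="(\<Sum>k. b k * norm w ^ k)\<^sup>2"]) (auto intro!: power_mono)
  qed (auto simp: norm_smult indicator_def)
  have cF: "cmod (\<Sum>k. of_real (b k) * herm z w ^ k) \<le> (\<Sum>k. b k * norm w ^ k)" if "norm z < 1" for z
  proof -
    have "summable (\<lambda>k. cmod (of_real (b k) * herm z w ^ k))"
      using sm[of "cmod (herm z w)"] herm_le[OF that] w b0 by (simp add: norm_mult norm_power)
    from summable_norm[OF this] have "cmod (\<Sum>k. of_real (b k) * herm z w ^ k) \<le> (\<Sum>k. \<bar>b k\<bar> * cmod (herm z w) ^ k)"
      by (simp add: norm_mult norm_power)
    with S_le[OF that] show ?thesis by linarith
  qed
  have intF: "integrable lborel (\<lambda>z. ?q z * (cmod (\<Sum>k. of_real (b k) * herm z w ^ k))\<^sup>2)"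
    using cF by (intro bound[where B="(\<Sum>k. b k * norm w ^ k)\<^sup>2"]) (auto intro!: power_mono)
  have intk: "integrable lborel (\<lambda>z. ?q z * cmod (herm z w) ^ (2 * k))" for k
    using herm_le by (intro bound[where B="norm w ^ (2 * k)"]) (auto intro!: power_mono)
  have "(\<integral>\<^sup>+z. ennreal (indicator (ball 0 1) z * (1 - (norm z)\<^sup>2) powr m * cmod (1 - herm z w) powr (- (2 * s))) \<partial>lborel)
      = (\<integral>\<^sup>+z. ennreal (?q z * (cmod (\<Sum>k. of_real (b k) * herm z w ^ k))\<^sup>2) \<partial>lborel)"
    by (intro nn_integral_cong) (auto simp: indicator_def norm_eq)
  also have "\<dots> = ennreal (\<integral>z. ?q z * (cmod (\<Sum>k. of_real (b k) * herm z w ^ k))\<^sup>2 \<partial>lborel)"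
    using q1 by (intro nn_integral_eq_integral intF) auto
  also have "\<dots> = (\<Sum>k. ennreal ((b k)\<^sup>2 * (\<integral>z. ?q z * cmod (herm z w) ^ (2 * k) \<partial>lborel)))"
    using sums q1 by (intro suminf_ennreal_eq[symmetric]) (auto intro!: mult_nonneg_nonneg integral_nonneg)
  also have "\<dots> = (\<Sum>k. ennreal (Gamma (s - real CARD('n)) / (Gamma s)\<^sup>2) * (ennreal (Gamma (s + real k) / (fact k)\<^sup>2) * G k))"
  proof (intro suminf_cong)
    fix k
    have "ennreal ((b k)\<^sup>2 * (\<integral>z. ?q z * cmod (herm z w) ^ (2 * k) \<partial>lborel))
        = ennreal ((b k)\<^sup>2) * (\<integral>\<^sup>+z. ennreal (?q z * cmod (herm z w) ^ (2 * k)) \<partial>lborel)"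
      using q1 by (subst nn_integral_eq_integral[OF intk]) (auto simp: ennreal_mult')
    also have "\<dots> = ennreal ((b k)\<^sup>2) * (ball_moment k w * ennreal (fact (CARD('n) + k) * Gamma (m + 1) / Gamma (real (CARD('n) + k) + 1 + m)))"
      by (simp only: nn_integral_ball_weighted_moment[OF m])
    also have "\<dots> = ball_moment k w * (ennreal ((b k)\<^sup>2) * ennreal (fact (CARD('n) + k) * Gamma (m + 1) / Gamma (real (CARD('n) + k) + 1 + m)))"
      by (simp add: mult_ac)
    also have "ennreal ((b k)\<^sup>2) * ennreal (fact (CARD('n) + k) * Gamma (m + 1) / Gamma (real (CARD('n) + k) + 1 + m))
       = ennreal ((b k)\<^sup>2 * (fact (CARD('n) + k) * Gamma (m + 1) / Gamma (real (CARD('n) + k) + 1 + m)))"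
      by (rule ennreal_mult'[symmetric]) simp
    also have "(b k)\<^sup>2 * (fact (CARD('n) + k) * Gamma (m + 1) / Gamma (real (CARD('n) + k) + 1 + m))
       = (Gamma (s - real CARD('n)) / (Gamma s)\<^sup>2) * ((Gamma (s + real k) / (fact k)\<^sup>2) * fact (CARD('n) + k))"
    proof -
      \<comment> \<open>The exponent \<open>m\<close> turns the Gamma factor in the denominator into
        \<open>Gamma (s + k)\<close>, which cancels one of the two copies in
        \<open>(b k)\<^sup>2\<close>; \<open>fact (n + k)\<close> is then absorbed into the Gaussian
        moment \<open>G k\<close>.\<close>
      have e: "m + 1 = s - real CARD('n)" "real (CARD('n) + k) + 1 + m = s + real k" by (auto simp: m_def)
      have "Gamma (s + real k) > 0" "Gamma s > 0" using s0 by (auto intro!: Gamma_real_pos)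
      then show ?thesis unfolding e by (simp add: bG field_simps power2_eq_square)
    qed
    also have "ennreal \<dots> = ennreal (Gamma (s - real CARD('n)) / (Gamma s)\<^sup>2) * (ennreal (Gamma (s + real k) / (fact k)\<^sup>2) * ennreal (fact (CARD('n) + k)))"
      using s s0 by (simp add: ennreal_mult'[symmetric] Gamma_real_pos less_imp_le)
    finally show "ennreal ((b k)\<^sup>2 * (\<integral>z. ?q z * cmod (herm z w) ^ (2 * k) \<partial>lborel))
       = ennreal (Gamma (s - real CARD('n)) / (Gamma s)\<^sup>2) * (ennreal (Gamma (s + real k) / (fact k)\<^sup>2) * G k)"
      unfolding G_def nn_integral_gaussian_moment by (simp only: mult_ac)
  qed
  also have "\<dots> = ennreal (Gamma (s - real CARD('n)) / (Gamma s)\<^sup>2) * (\<Sum>k. ennreal (Gamma (s + real k) / (fact k)\<^sup>2) * G k)"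
    by (rule ennreal_suminf_cmult)
  \<comment> \<open>Writing \<open>Gamma (s + k)\<close> as an Euler integral moves the sum under
    the integral, where it becomes exp (t |w|^2). The rate of the exponential drops from 1 to 1 -
    |w|^2, and this is the source of the power \<open>- s\<close> of 1 - |w|^2.\<close>
  also have "(\<Sum>k. ennreal (Gamma (s + real k) / (fact k)\<^sup>2) * G k)
     = (\<Sum>k. \<integral>\<^sup>+t. indicator {0<..} t * ennreal (t powr (s - 1) * exp (- t)) * (ennreal (t ^ k / (fact k)\<^sup>2) * G k) \<partial>lborel)"
  proof (intro suminf_cong)
    fix k
    have "ennreal (Gamma (s + real k) / (fact k)\<^sup>2) = ennreal (1 / (fact k)\<^sup>2) * ennreal (Gamma (s + real k) / 1 powr (s + real k))"
      by (simp add: ennreal_mult'[symmetric])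
    also have "\<dots> = ennreal (1 / (fact k)\<^sup>2) * (\<integral>\<^sup>+t. indicator {0<..} t * ennreal (t powr (s + real k - 1) * exp (- (1 * t))) \<partial>lborel)"
      using s0 by (subst nn_integral_Gamma_open) auto
    also have "\<dots> = (\<integral>\<^sup>+t. ennreal (1 / (fact k)\<^sup>2) * (indicator {0<..} t * ennreal (t powr (s + real k - 1) * exp (- (1 * t)))) \<partial>lborel)"
      by (rule nn_integral_cmult[symmetric]) measurable
    also have "\<dots> = (\<integral>\<^sup>+t. indicator {0<..} t * ennreal (t powr (s - 1) * exp (- t)) * ennreal (t ^ k / (fact k)\<^sup>2) \<partial>lborel)"
    proof (rule nn_integral_cong)
      fix t :: real
      have "t powr (s + real k - 1) = t powr (s - 1) * t ^ k" if "0 < t"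
        using that powr_add[of t "s - 1" "real k"] by (simp add: powr_realpow algebra_simps)
      then show "ennreal (1 / (fact k)\<^sup>2) * (indicator {0<..} t * ennreal (t powr (s + real k - 1) * exp (- (1 * t))))
        = indicator {0<..} t * ennreal (t powr (s - 1) * exp (- t)) * ennreal (t ^ k / (fact k)\<^sup>2)"
        by (cases "0 < t") (auto simp: ennreal_mult'[symmetric] mult_ac)
    qed
    finally have *: "ennreal (Gamma (s + real k) / (fact k)\<^sup>2) = (\<integral>\<^sup>+t. indicator {0<..} t * ennreal (t powr (s - 1) * exp (- t)) * ennreal (t ^ k / (fact k)\<^sup>2) \<partial>lborel)" .
    show "ennreal (Gamma (s + real k) / (fact k)\<^sup>2) * G k
      = (\<integral>\<^sup>+t. indicator {0<..} t * ennreal (t powr (s - 1) * exp (- t)) * (ennreal (t ^ k / (fact k)\<^sup>2) * G k) \<partial>lborel)"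
      unfolding * by (subst nn_integral_multc[symmetric]) (auto simp: mult.assoc)
  qed
  also have "\<dots> = (\<integral>\<^sup>+t. (\<Sum>k. indicator {0<..} t * ennreal (t powr (s - 1) * exp (- t)) * (ennreal (t ^ k / (fact k)\<^sup>2) * G k)) \<partial>lborel)"
    by (rule nn_integral_suminf[symmetric]) measurable
  also have "\<dots> = (\<integral>\<^sup>+t. indicator {0<..} t * ennreal (t powr (s - 1) * exp (- ((1 - (norm w)\<^sup>2) * t))) * ?G0 \<partial>lborel)"
  proof (rule nn_integral_cong)
    fix t :: real
    show "(\<Sum>k. indicator {0<..} t * ennreal (t powr (s - 1) * exp (- t)) * (ennreal (t ^ k / (fact k)\<^sup>2) * G k))
       = indicator {0<..} t * ennreal (t powr (s - 1) * exp (- ((1 - (norm w)\<^sup>2) * t))) * ?G0"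
    proof (cases "0 < t")
      case True
      have "(\<Sum>k. indicator {0<..} t * ennreal (t powr (s - 1) * exp (- t)) * (ennreal (t ^ k / (fact k)\<^sup>2) * G k))
        = indicator {0<..} t * ennreal (t powr (s - 1) * exp (- t)) * (ennreal (exp (t * (norm w)\<^sup>2)) * ?G0)"
        unfolding ennreal_suminf_cmult G_def using True by (subst gaussian_moment_generating) auto
      also have "\<dots> = indicator {0<..} t * (ennreal (t powr (s - 1) * exp (- t)) * ennreal (exp (t * (norm w)\<^sup>2))) * ?G0"
        by (simp only: mult_ac)
      also have "ennreal (t powr (s - 1) * exp (- t)) * ennreal (exp (t * (norm w)\<^sup>2))
         = ennreal (t powr (s - 1) * exp (- ((1 - (norm w)\<^sup>2) * t)))"
        by (simp add: ennreal_mult'[symmetric] mult.assoc mult_exp_exp algebra_simps)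
      finally show ?thesis .
    qed simp
  qed
  also have "\<dots> = ennreal (Gamma s / (1 - (norm w)\<^sup>2) powr s) * ?G0"
    using s0 w2 by (subst nn_integral_multc) (auto simp: nn_integral_Gamma_open)
  also have "ennreal (Gamma (s - real CARD('n)) / (Gamma s)\<^sup>2) * (ennreal (Gamma s / (1 - (norm w)\<^sup>2) powr s) * ?G0)
    = emeasure lborel (ball (0 :: complex ^ 'n) 1) * (ennreal (Gamma (s - real CARD('n)) / (Gamma s)\<^sup>2) * (ennreal (Gamma s / (1 - (norm w)\<^sup>2) powr s) * ennreal (fact CARD('n))))"
    unfolding emeasure_unit_ball_gaussian by (simp only: mult_ac)
  also have "ennreal (Gamma (s - real CARD('n)) / (Gamma s)\<^sup>2) * (ennreal (Gamma s / (1 - (norm w)\<^sup>2) powr s) * ennreal (fact CARD('n)))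
    = ennreal (fact CARD('n) * Gamma (s - real CARD('n)) / Gamma s * (1 - (norm w)\<^sup>2) powr (- s))"
  proof -
    have pos: "Gamma s > 0" "Gamma (s - real CARD('n)) > 0" using s s0 by (auto intro!: Gamma_real_pos)
    then have "fact CARD('n) * Gamma (s - real CARD('n)) / Gamma s * (1 - (norm w)\<^sup>2) powr (- s)
       = (Gamma (s - real CARD('n)) / (Gamma s)\<^sup>2) * ((Gamma s / (1 - (norm w)\<^sup>2) powr s) * fact CARD('n))"
      by (simp add: powr_minus field_simps power2_eq_square)
    then show ?thesis using pos by (simp add: ennreal_mult'[symmetric])
  qed
  finally show ?thesis unfolding m_def .
qed

section \<open>The covariance kernel\<close>

lemma finite_multi_indices:
  fixes k :: nat assumes "finite S"
  shows "finite {\<alpha> :: 'a \<Rightarrow> nat. (\<forall>j. j \<notin> S \<longrightarrow> \<alpha> j = 0) \<and> sum \<alpha> S = k}"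
proof (rule finite_subset)
  show "{\<alpha>. (\<forall>j. j \<notin> S \<longrightarrow> \<alpha> j = 0) \<and> sum \<alpha> S = k}
      \<subseteq> {\<alpha>. \<forall>j. (j \<in> S \<longrightarrow> \<alpha> j \<in> {..k}) \<and> (j \<notin> S \<longrightarrow> \<alpha> j = 0)}"
    using assms member_le_sum[of _ S] by (auto intro: member_le_sum)
  show "finite {\<alpha>. \<forall>j. (j \<in> S \<longrightarrow> \<alpha> j \<in> {..k}) \<and> (j \<notin> S \<longrightarrow> \<alpha> j = 0)}"
    by (rule finite_set_of_finite_funs[OF assms]) simp
qed

text \<open>In this divided form, splitting off one index \<open>i\<close> makes the induction step
  the binomial theorem. Requiring \<open>\<alpha>\<close> to vanish outside \<open>S\<close> makes
  the index set finite and the splitting a bijection.\<close>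

lemma multinomial_exp:
  fixes x :: "'a \<Rightarrow> 'b::{field_char_0}"
  assumes "finite S"
  shows "(\<Sum>\<alpha> | (\<forall>j. j \<notin> S \<longrightarrow> \<alpha> j = 0) \<and> sum \<alpha> S = k. \<Prod>j\<in>S. x j ^ \<alpha> j / fact (\<alpha> j)) = (\<Sum>j\<in>S. x j) ^ k / fact k"
  using assms
proof (induction S arbitrary: k rule: finite_induct)
  case empty
  have "{\<alpha> :: 'a \<Rightarrow> nat. (\<forall>j. \<alpha> j = 0) \<and> (0 :: nat) = k} = (if k = 0 then {\<lambda>_. 0} else {})" by auto
  then show ?case by (auto simp: power_0_left)
next
  case (insert i S)
  let ?A = "\<lambda>S k. {\<alpha> :: 'a \<Rightarrow> nat. (\<forall>j. j \<notin> S \<longrightarrow> \<alpha> j = 0) \<and> sum \<alpha> S = k}"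
  let ?p = "\<lambda>S \<alpha>. \<Prod>j\<in>S. x j ^ \<alpha> j / fact (\<alpha> j)"
  have "(\<Sum>\<alpha>\<in>?A (insert i S) k. ?p (insert i S) \<alpha>)
      = (\<Sum>(m, \<beta>)\<in>(SIGMA m:{..k}. ?A S (k - m)). x i ^ m / fact m * ?p S \<beta>)"
  proof (rule sum.reindex_bij_witness[where i="\<lambda>(m, \<beta>). \<beta>(i := m)" and j="\<lambda>\<alpha>. (\<alpha> i, \<alpha>(i := 0))"])
    fix \<alpha> assume \<alpha>: "\<alpha> \<in> ?A (insert i S) k"
    have s: "sum (\<alpha>(i := 0)) S = sum \<alpha> S"
      using insert.hyps by (intro sum.cong) auto
    show "(case (\<alpha> i, \<alpha>(i := 0)) of (m, \<beta>) \<Rightarrow> \<beta>(i := m)) = \<alpha>" by simp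
    show "(\<alpha> i, \<alpha>(i := 0)) \<in> (SIGMA m:{..k}. ?A S (k - m))"
      using \<alpha> insert.hyps s by auto
    have "?p S (\<alpha>(i := 0)) = ?p S \<alpha>"
      using insert.hyps by (intro prod.cong) auto
    then show "(case (\<alpha> i, \<alpha>(i := 0)) of (m, \<beta>) \<Rightarrow> x i ^ m / fact m * ?p S \<beta>) = ?p (insert i S) \<alpha>"
      using insert.hyps by simp
  next
    fix b assume b: "b \<in> (SIGMA m:{..k}. ?A S (k - m))"
    obtain m \<beta> where mb: "b = (m, \<beta>)" by (cases b)
    have s: "sum (\<beta>(i := m)) S = sum \<beta> S"
      using insert.hyps by (intro sum.cong) auto
    have z: "\<beta> i = 0" using b mb insert.hyps by auto
    then show "((case b of (m, \<beta>) \<Rightarrow> \<beta>(i := m)) i, (case b of (m, \<beta>) \<Rightarrow> \<beta>(i := m))(i := 0)) = b"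
      using mb by (auto simp: fun_eq_iff)
    show "(case b of (m, \<beta>) \<Rightarrow> \<beta>(i := m)) \<in> ?A (insert i S) k"
      using b mb insert.hyps s by auto
  qed
  also have "\<dots> = (\<Sum>m\<le>k. \<Sum>\<beta>\<in>?A S (k - m). x i ^ m / fact m * ?p S \<beta>)"
    by (subst sum.Sigma) (auto simp: finite_multi_indices insert.hyps)
  also have "\<dots> = (\<Sum>m\<le>k. x i ^ m / fact m * ((\<Sum>j\<in>S. x j) ^ (k - m) / fact (k - m)))"
    by (simp only: sum_distrib_left[symmetric] insert.IH)
  also have "\<dots> = (\<Sum>m\<le>k. of_nat (k choose m) * x i ^ m * (\<Sum>j\<in>S. x j) ^ (k - m)) / fact k"
    unfolding sum_divide_distrib
    by (intro sum.cong refl) (simp add: binomial_fact)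
  also have "\<dots> = (x i + (\<Sum>j\<in>S. x j)) ^ k / fact k"
    by (simp only: binomial_ring)
  finally show ?case using insert.hyps by simp
qed

text \<open>The variance of the coefficient of the monomial with exponent \<open>\<alpha>\<close> in
  \<open>hyperbolic_series\<close>.\<close>

definition gaf_coeff :: "real \<Rightarrow> ('n::finite \<Rightarrow> nat) \<Rightarrow> real" where
  "gaf_coeff L \<alpha> = Gamma (L + real (\<Sum>j\<in>UNIV. \<alpha> j)) / ((\<Prod>j\<in>UNIV. fact (\<alpha> j)) * Gamma L)"

lemma gaf_coeff_nonneg: "0 < L \<Longrightarrow> 0 \<le> gaf_coeff L \<alpha>"
  unfolding gaf_coeff_def
  by (intro divide_nonneg_nonneg mult_nonneg_nonneg prod_nonneg less_imp_le[OF Gamma_real_pos] add_pos_nonneg) (auto intro!: sum_nonneg)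

text \<open>Within one total degree the Gamma quotient is constant, so the multinomial theorem
  collapses the sum to a single term of the binomial series.\<close>

lemma sum_gaf_coeff_degree:
  fixes x :: "'n::finite \<Rightarrow> complex"
  assumes "0 < L"
  shows "(\<Sum>\<alpha> | (\<Sum>j\<in>UNIV. \<alpha> j) = k. of_real (gaf_coeff L \<alpha>) * (\<Prod>j\<in>UNIV. x j ^ \<alpha> j))
     = of_real (pochhammer L k / fact k) * (\<Sum>j\<in>UNIV. x j) ^ k"
proof -
  have "L \<notin> \<int>\<^sub>\<le>\<^sub>0" using assms by (auto elim!: nonpos_Ints_cases)
  from pochhammer_Gamma[OF this, of k] have p: "pochhammer L k = Gamma (L + real k) / Gamma L" .
  have "of_real (gaf_coeff L \<alpha>) * (\<Prod>j\<in>UNIV. x j ^ \<alpha> j) = of_real (pochhammer L k) * (\<Prod>j\<in>UNIV. x j ^ \<alpha> j / fact (\<alpha> j))"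
    if "(\<Sum>j\<in>UNIV. \<alpha> j) = k" for \<alpha>
  proof -
    have "gaf_coeff L \<alpha> = pochhammer L k / (\<Prod>j\<in>UNIV. fact (\<alpha> j))"
      unfolding gaf_coeff_def that p by simp
    then show ?thesis by (simp add: prod_dividef)
  qed
  then have "(\<Sum>\<alpha> | (\<Sum>j\<in>UNIV. \<alpha> j) = k. of_real (gaf_coeff L \<alpha>) * (\<Prod>j\<in>UNIV. x j ^ \<alpha> j))
     = (\<Sum>\<alpha> | (\<Sum>j\<in>UNIV. \<alpha> j) = k. of_real (pochhammer L k) * (\<Prod>j\<in>UNIV. x j ^ \<alpha> j / fact (\<alpha> j)))"
    by (intro sum.cong refl) blast
  also have "\<dots> = of_real (pochhammer L k) * ((\<Sum>j\<in>UNIV. x j) ^ k / fact k)"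
    unfolding sum_distrib_left[symmetric] multinomial_exp[OF finite_class.finite_UNIV, of x k, symmetric] by simp
  finally show ?thesis by simp
qed

text \<open>Grouping by total degree gives the binomial series. The same grouping applied to the
  moduli \<open>cmod (x j)\<close> bounds all finite sums, and absolute summability then allows the
  limit to be taken along the degree truncations \<open>A K\<close>.\<close>

lemma kernel_has_sum:
  fixes x :: "'n::finite \<Rightarrow> complex"
  assumes L: "0 < L" and x: "(\<Sum>j\<in>UNIV. cmod (x j)) < 1"
  shows "(\<lambda>\<alpha>. norm (of_real (gaf_coeff L \<alpha>) * (\<Prod>j\<in>UNIV. x j ^ \<alpha> j))) summable_on UNIV"
    and "((\<lambda>\<alpha>. of_real (gaf_coeff L \<alpha>) * (\<Prod>j\<in>UNIV. x j ^ \<alpha> j)) has_sum (1 - (\<Sum>j\<in>UNIV. x j)) powr (- of_real L)) UNIV"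
proof -
  let ?f = "\<lambda>(x :: 'n \<Rightarrow> complex) \<alpha>. of_real (gaf_coeff L \<alpha>) * (\<Prod>j\<in>UNIV. x j ^ \<alpha> j)"
  define A where "A K = {\<alpha> :: 'n \<Rightarrow> nat. (\<Sum>j\<in>UNIV. \<alpha> j) < K}" for K :: nat
  have fin1: "finite {\<alpha> :: 'n \<Rightarrow> nat. (\<Sum>j\<in>UNIV. \<alpha> j) = k}" for k
    using finite_multi_indices[of "UNIV :: 'n set" k] by simp
  have A_UN: "A K = (\<Union>k<K. {\<alpha>. (\<Sum>j\<in>UNIV. \<alpha> j) = k})" for K
    by (auto simp: A_def)
  have finA: "finite (A K)" for K
    unfolding A_UN using fin1 by auto
  have sumA: "sum (?f y) (A K) = (\<Sum>k<K. of_real (pochhammer L k / fact k) * (\<Sum>j\<in>UNIV. y j) ^ k)" for y K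
    unfolding A_UN sum_gaf_coeff_degree[OF L, symmetric]
    by (rule sum.UNION_disjoint) (auto simp: fin1)
  have ev: "\<exists>K. F \<subseteq> A K" if "finite F" for F
    using that
  proof (induction F rule: finite_induct)
    case (insert \<alpha> F)
    then obtain K where "F \<subseteq> A K" by auto
    then have "insert \<alpha> F \<subseteq> A (max K (Suc (\<Sum>j\<in>UNIV. \<alpha> j)))" by (auto simp: A_def)
    then show ?case by blast
  qed auto
  have Amono: "A K \<subseteq> A K'" if "K \<le> K'" for K K'
    using that by (auto simp: A_def)
  let ?y = "\<lambda>j. complex_of_real (cmod (x j))"
  let ?s = "\<Sum>j\<in>UNIV. cmod (x j)"
  have s0: "0 \<le> ?s" by (intro sum_nonneg) auto
  have norm_f: "norm (?f x \<alpha>) = Re (?f ?y \<alpha>)" "0 \<le> Re (?f ?y \<alpha>)" for \<alpha>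
  proof -
    have "?f ?y \<alpha> = of_real (gaf_coeff L \<alpha> * (\<Prod>j\<in>UNIV. cmod (x j) ^ \<alpha> j))"
      by simp
    then have *: "Re (?f ?y \<alpha>) = gaf_coeff L \<alpha> * (\<Prod>j\<in>UNIV. cmod (x j) ^ \<alpha> j)"
      by (simp only: Re_complex_of_real)
    show "0 \<le> Re (?f ?y \<alpha>)"
      unfolding * by (intro mult_nonneg_nonneg gaf_coeff_nonneg L prod_nonneg) auto
    show "norm (?f x \<alpha>) = Re (?f ?y \<alpha>)"
      unfolding * by (simp add: norm_mult gaf_coeff_nonneg[OF L] norm_power flip: prod_norm)
  qed
  have smr: "summable (\<lambda>k. pochhammer L k / fact k * ?s ^ k)"
  proof -
    have "cmod (complex_of_real ?s) < 1" using x s0 by (simp only: norm_of_real)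
    from sums_summable[OF binomial_series_complex[OF this]]
    have "summable (\<lambda>k. complex_of_real (pochhammer L k / fact k) * of_real ?s ^ k)" .
    from summable_Re[OF this] show ?thesis
      unfolding of_real_power[symmetric] of_real_mult[symmetric] Re_complex_of_real .
  qed
  show abs: "(\<lambda>\<alpha>. norm (?f x \<alpha>)) summable_on UNIV"
  proof (rule nonneg_bdd_above_summable_on)
    have "sum (\<lambda>\<alpha>. norm (?f x \<alpha>)) F \<le> (\<Sum>k. pochhammer L k / fact k * ?s ^ k)" if F: "finite F" for F
    proof -
      obtain K where K: "F \<subseteq> A K" using ev[OF F] by auto
      have "sum (\<lambda>\<alpha>. norm (?f x \<alpha>)) F \<le> sum (\<lambda>\<alpha>. norm (?f x \<alpha>)) (A K)"
        by (intro sum_mono2 finA K) auto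
      also have "\<dots> = Re (sum (?f ?y) (A K))"
        by (simp only: norm_f Re_sum)
      also have "\<dots> = (\<Sum>k<K. pochhammer L k / fact k * ?s ^ k)"
        unfolding sumA unfolding of_real_sum[symmetric] of_real_power[symmetric] of_real_mult[symmetric] Re_complex_of_real ..
      also have "\<dots> \<le> (\<Sum>k. pochhammer L k / fact k * ?s ^ k)"
        using L s0 by (intro sum_le_suminf smr) (auto intro!: mult_nonneg_nonneg divide_nonneg_nonneg pochhammer_nonneg)
      finally show ?thesis .
    qed
    then show "bdd_above (sum (\<lambda>\<alpha>. norm (?f x \<alpha>)) ` {F. F \<subseteq> UNIV \<and> finite F})"
      by (intro bdd_aboveI2) auto
  qed simp
  have "filterlim A (finite_subsets_at_top UNIV) sequentially"
    unfolding filterlim_finite_subsets_at_top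
  proof (intro allI impI)
    fix F :: "('n \<Rightarrow> nat) set" assume "finite F \<and> F \<subseteq> UNIV"
    then obtain K where "F \<subseteq> A K" using ev by auto
    then show "\<forall>\<^sub>F y in sequentially. finite (A y) \<and> F \<subseteq> A y \<and> A y \<subseteq> UNIV"
      using Amono finA by (intro eventually_sequentiallyI[of K]) blast
  qed
  note A_lim = this
  have sm: "?f x summable_on UNIV"
    using abs by (rule abs_summable_summable)
  have "(\<lambda>K. sum (?f x) (A K)) \<longlonglongrightarrow> infsum (?f x) UNIV"
    using filterlim_compose[OF has_sum_infsum[OF sm, unfolded has_sum_def] A_lim] .
  moreover have "(\<lambda>K. sum (?f x) (A K)) \<longlonglongrightarrow> (1 - (\<Sum>j\<in>UNIV. x j)) powr (- of_real L)"
  proof -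
    have "cmod (\<Sum>j\<in>UNIV. x j) < 1" using x norm_sum[of x UNIV] by linarith
    from binomial_series_complex[OF this, of L] show ?thesis
      unfolding sumA sums_def .
  qed
  ultimately have "infsum (?f x) UNIV = (1 - (\<Sum>j\<in>UNIV. x j)) powr (- of_real L)"
    by (rule LIMSEQ_unique)
  with has_sum_infsum[OF sm] show "(?f x has_sum (1 - (\<Sum>j\<in>UNIV. x j)) powr (- of_real L)) UNIV" by simp
qed

text \<open>The deterministic factor of the random coefficient \<open>a \<alpha>\<close> in
  \<open>hyperbolic_series\<close>.\<close>

definition gaf_basis :: "real \<Rightarrow> complex ^ 'n::finite \<Rightarrow> ('n \<Rightarrow> nat) \<Rightarrow> complex" where
  "gaf_basis L z \<alpha> = of_real (sqrt (gaf_coeff L \<alpha>)) * (\<Prod>j\<in>UNIV. (z $ j) ^ \<alpha> j)"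

lemma gaf_basis_kernel:
  fixes z w :: "complex ^ 'n::finite"
  assumes L: "0 < L" and zw: "norm z < 1" "norm w < 1"
  shows "(\<lambda>\<alpha>. norm (gaf_basis L z \<alpha> * cnj (gaf_basis L w \<alpha>))) summable_on UNIV"
    and "((\<lambda>\<alpha>. gaf_basis L z \<alpha> * cnj (gaf_basis L w \<alpha>)) has_sum (1 - herm z w) powr (- of_real L)) UNIV"
proof -
  have "(\<Sum>j\<in>UNIV. cmod (z $ j * cnj (w $ j))) \<le> norm z * norm w"
    unfolding norm_vec_def using L2_set_mult_ineq[of "\<lambda>j. norm (z $ j)" "\<lambda>j. norm (w $ j)" UNIV]
    by (simp add: norm_mult)
  also have "norm z * norm w < 1 * 1"
    using zw by (intro mult_strict_mono') auto
  finally have x: "(\<Sum>j\<in>UNIV. cmod (z $ j * cnj (w $ j))) < 1" by simp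
  have eq: "gaf_basis L z \<alpha> * cnj (gaf_basis L w \<alpha>) = of_real (gaf_coeff L \<alpha>) * (\<Prod>j\<in>UNIV. (z $ j * cnj (w $ j)) ^ \<alpha> j)" for \<alpha>
  proof -
    have "complex_of_real (sqrt (gaf_coeff L \<alpha>)) * of_real (sqrt (gaf_coeff L \<alpha>)) = of_real (gaf_coeff L \<alpha>)"
      using gaf_coeff_nonneg[OF L, of \<alpha>] by (simp flip: of_real_mult)
    then show ?thesis
      by (simp add: gaf_basis_def power_mult_distrib prod.distrib mult_ac)
  qed
  show "(\<lambda>\<alpha>. norm (gaf_basis L z \<alpha> * cnj (gaf_basis L w \<alpha>))) summable_on UNIV"
    "((\<lambda>\<alpha>. gaf_basis L z \<alpha> * cnj (gaf_basis L w \<alpha>)) has_sum (1 - herm z w) powr (- of_real L)) UNIV"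
    using kernel_has_sum[OF L x] unfolding eq herm_def by auto
qed

lemma geometric_multi_summable:
  assumes "0 \<le> t" "t < (1::real)"
  shows "(\<lambda>\<alpha> :: 'n::finite \<Rightarrow> nat. \<Prod>j\<in>UNIV. t ^ \<alpha> j) summable_on UNIV"
proof (rule nonneg_bdd_above_summable_on)
  have "sum (\<lambda>\<alpha> :: 'n \<Rightarrow> nat. \<Prod>j\<in>UNIV. t ^ \<alpha> j) F \<le> (1 / (1 - t)) ^ CARD('n)" if "finite F" for F
  proof -
    define N where "N = Max ((\<lambda>(\<alpha>, j). \<alpha> j) ` (F \<times> (UNIV :: 'n set)))"
    have "\<alpha> j \<le> N" if "\<alpha> \<in> F" for \<alpha> j
      unfolding N_def using that \<open>finite F\<close> by (intro Max_ge) (auto intro!: rev_image_eqI[of "(\<alpha>, j)"])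
    then have "F \<subseteq> PiE UNIV (\<lambda>_. {..N})" by auto
    then have "sum (\<lambda>\<alpha> :: 'n \<Rightarrow> nat. \<Prod>j\<in>UNIV. t ^ \<alpha> j) F \<le> (\<Sum>\<alpha>\<in>PiE (UNIV :: 'n set) (\<lambda>_. {..N}). \<Prod>j\<in>UNIV. t ^ \<alpha> j)"
      using assms by (auto intro!: sum_mono2 finite_PiE prod_nonneg)
    also have "\<dots> = (\<Prod>j\<in>(UNIV :: 'n set). \<Sum>m\<le>N. t ^ m)"
      by (subst prod_sum_PiE) auto
    also have "\<dots> \<le> (1 / (1 - t)) ^ CARD('n)"
    proof -
      have "(\<Sum>m\<le>N. t ^ m) \<le> (\<Sum>m. t ^ m)"
        using assms by (intro sum_le_suminf summable_geometric) auto
      also have "\<dots> = 1 / (1 - t)" using assms by (intro suminf_geometric) auto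
      finally show ?thesis using assms by (auto intro!: power_mono sum_nonneg)
    qed
    finally show ?thesis .
  qed
  then show "bdd_above (sum (\<lambda>\<alpha> :: 'n \<Rightarrow> nat. \<Prod>j\<in>UNIV. t ^ \<alpha> j) ` {F. F \<subseteq> UNIV \<and> finite F})"
    by (intro bdd_aboveI2) auto
qed (use assms in \<open>auto intro!: prod_nonneg\<close>)

text \<open>The kernel yields only square summability, while almost sure convergence of the random
  series is derived from absolute summability. With \<open>z / \<rho>\<close> still in the ball,
  each term is the product of a square-summable term at \<open>z / \<rho>\<close> and the geometric
  factor \<open>p\<close>; then \<open>g * p \<le> g\<^sup>2 + p\<^sup>2\<close> finishes.\<close>

lemma gaf_basis_abs_summable:
  fixes z :: "complex ^ 'n::finite"
  assumes L: "0 < L" and z: "norm z < 1"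
  shows "(\<lambda>\<alpha>. norm (gaf_basis L z \<alpha>)) summable_on UNIV"
proof -
  obtain \<rho> where \<rho>: "norm z < \<rho>" "\<rho> < 1" using dense[OF z] by auto
  then have \<rho>0: "0 < \<rho>" using norm_ge_zero[of z] by linarith
  have "norm ((1 / \<rho>) *\<^sub>R z) < 1" using \<rho> \<rho>0 by simp
  from gaf_basis_kernel(1)[OF L this this]
  have s1: "(\<lambda>\<alpha>. norm (gaf_basis L ((1 / \<rho>) *\<^sub>R z) \<alpha> * cnj (gaf_basis L ((1 / \<rho>) *\<^sub>R z) \<alpha>))) summable_on UNIV" .
  have s2: "(\<lambda>\<alpha> :: 'n \<Rightarrow> nat. \<Prod>j\<in>UNIV. (\<rho>\<^sup>2) ^ \<alpha> j) summable_on UNIV"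
    using \<rho> \<rho>0 by (intro geometric_multi_summable) (auto simp: abs_square_less_1)
  show ?thesis
  proof (rule summable_on_comparison_test[OF summable_on_add[OF s1 s2]])
    fix \<alpha> :: "'n \<Rightarrow> nat"
    define p where "p = (\<Prod>j\<in>UNIV. \<rho> ^ \<alpha> j)"
    have p0: "0 < p" using \<rho>0 by (auto simp: p_def intro!: prod_pos)
    define g where "g = cmod (gaf_basis L ((1 / \<rho>) *\<^sub>R z) \<alpha>)"
    have "(\<Prod>j\<in>UNIV. (((1 / \<rho>) *\<^sub>R z) $ j) ^ \<alpha> j) = (\<Prod>j\<in>UNIV. (z $ j) ^ \<alpha> j) / of_real p"
      by (simp add: p_def prod_dividef scaleR_conv_of_real[where 'a=complex] power_divide)
    then have "gaf_basis L ((1 / \<rho>) *\<^sub>R z) \<alpha> = gaf_basis L z \<alpha> / of_real p"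
      by (simp add: gaf_basis_def)
    then have g: "norm (gaf_basis L z \<alpha>) = g * p"
      using p0 by (simp add: g_def norm_divide)
    have "p\<^sup>2 = (\<Prod>j\<in>UNIV. (\<rho>\<^sup>2) ^ \<alpha> j)"
      by (simp add: p_def prod_power_distrib power_mult[symmetric] mult.commute)
    moreover have "g * p \<le> g\<^sup>2 + p\<^sup>2"
    proof -
      have "0 \<le> (g - p)\<^sup>2" "0 \<le> g * p" using p0 by (auto simp: g_def)
      then show ?thesis by (simp add: power2_diff)
    qed
    ultimately show "norm (gaf_basis L z \<alpha>) \<le> norm (gaf_basis L ((1 / \<rho>) *\<^sub>R z) \<alpha> * cnj (gaf_basis L ((1 / \<rho>) *\<^sub>R z) \<alpha>)) + (\<Prod>j\<in>UNIV. (\<rho>\<^sup>2) ^ \<alpha> j)"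
      unfolding g by (simp add: norm_mult power2_eq_square g_def)
  qed simp
qed

section \<open>Laplace transforms of complex Gaussian series\<close>

lemma lborel_complex_integral_prod:
  fixes f g :: "real \<Rightarrow> complex"
  assumes "integrable lborel f" "integrable lborel g"
  shows "(\<integral>z. f (Re z) * g (Im z) \<partial>lborel) = (\<integral>x. f x \<partial>lborel) * (\<integral>x. g x \<partial>lborel)"
proof -
  interpret product_sigma_finite "\<lambda>_::complex. lborel :: real measure"
    by (simp add: product_sigma_finite_def lborel.sigma_finite_measure_axioms)
  let ?F = "\<lambda>b::complex. if b = 1 then f else g"
  have [measurable]: "f \<in> borel_measurable borel" "g \<in> borel_measurable borel"
    using assms by (auto dest: borel_measurable_integrable)
  have ne: "(1::complex) \<noteq> \<i>" by (simp add: complex_eq_iff)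
  have "(\<integral>z. f (Re z) * g (Im z) \<partial>lborel)
     = (\<integral>p. f (Re (\<Sum>b\<in>Basis. p b *\<^sub>R b)) * g (Im (\<Sum>b\<in>Basis. p b *\<^sub>R b)) \<partial>(\<Pi>\<^sub>M b\<in>Basis. lborel))"
    by (subst lborel_eq, subst integral_distr) auto
  also have "\<dots> = (\<integral>p. (\<Prod>b\<in>Basis. ?F b (p b)) \<partial>(\<Pi>\<^sub>M b\<in>(Basis :: complex set). lborel))"
    using ne by (simp add: Basis_complex_def)
  also have "\<dots> = (\<Prod>b\<in>(Basis :: complex set). \<integral>x. ?F b x \<partial>lborel)"
    using assms by (subst product_integral_prod) auto
  finally show ?thesis using ne by (simp add: Basis_complex_def)
qed

text \<open>The characteristic function of the standard normal law after the substitution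
  \<open>x = sqrt 2 * y\<close>, which turns variance 1 into the density proportional to exp (-
  y^2).\<close>

lemma gaussian_fourier_real:
  shows "integrable lborel (\<lambda>x. of_real (exp (- x\<^sup>2)) * exp (2 * \<i> * of_real (x * c)))" (is "integrable _ ?f")
    and "(\<integral>x. of_real (exp (- x\<^sup>2)) * exp (2 * \<i> * of_real (x * c)) \<partial>lborel) = of_real (sqrt pi * exp (- c\<^sup>2))"
proof -
  let ?h = "\<lambda>x. of_real (std_normal_density x) * iexp (sqrt 2 * c * x) :: complex"
  have hi: "integrable lborel ?h"
  proof (rule Bochner_Integration.integrable_bound[OF integrable_normal_density])
    show "AE x in lborel. norm (?h x) \<le> norm (std_normal_density x)"
      by (simp add: norm_mult)
  qed measurable
  have eq: "?h (0 + sqrt 2 * x) = of_real (1 / sqrt (2 * pi)) * ?f x" for x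
    by (simp add: std_normal_density_def power_mult_distrib mult_ac)
  have "integrable lborel (\<lambda>x. ?h (0 + sqrt 2 * x))"
    using hi by (intro lborel_integrable_real_affine) auto
  then have i2: "integrable lborel (\<lambda>x. of_real (1 / sqrt (2 * pi)) * ?f x)"
    unfolding eq .
  have cancel: "of_real (sqrt (2 * pi)) * (of_real (1 / sqrt (2 * pi)) * z) = z" for z :: complex
    by (simp add: mult.assoc[symmetric])
  have "integrable lborel (\<lambda>x. of_real (sqrt (2 * pi)) * (of_real (1 / sqrt (2 * pi)) * ?f x))"
    using i2 by (rule integrable_mult_right)
  then show "integrable lborel ?f"
    unfolding cancel .
  have "(\<integral>x. ?h x \<partial>lborel) = char std_normal_distribution (sqrt 2 * c)"
    unfolding char_def by (subst integral_density) (auto simp: normal_density_nonneg scaleR_conv_of_real)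
  also have "\<dots> = of_real (exp (- c\<^sup>2))"
    by (simp add: char_std_normal_distribution power_mult_distrib)
  finally have "of_real (exp (- c\<^sup>2)) = (\<integral>x. ?h x \<partial>lborel)" ..
  also have "\<dots> = \<bar>sqrt 2\<bar> *\<^sub>R (\<integral>x. ?h (0 + sqrt 2 * x) \<partial>lborel)"
    by (rule lborel_integral_real_affine) simp
  also have "\<dots> = of_real (sqrt 2) * (of_real (1 / sqrt (2 * pi)) * (\<integral>x. ?f x \<partial>lborel))"
    unfolding eq by (simp add: scaleR_conv_of_real)
  also have "\<dots> = of_real (1 / sqrt pi) * (\<integral>x. ?f x \<partial>lborel)"
    by (simp add: real_sqrt_mult)
  finally show "(\<integral>x. ?f x \<partial>lborel) = of_real (sqrt pi * exp (- c\<^sup>2))"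
    by (simp add: field_simps)
qed

definition complex_gaussian_density :: "complex \<Rightarrow> real" where
  "complex_gaussian_density z = exp (- (cmod z)\<^sup>2) / pi"

lemma complex_gaussian_density_nonneg [simp]: "0 \<le> complex_gaussian_density z"
  by (simp add: complex_gaussian_density_def)

lemma complex_gaussian_density_measurable [measurable]: "complex_gaussian_density \<in> borel_measurable borel"
  unfolding complex_gaussian_density_def by measurable

text \<open>The factor 2 in the phase is chosen so that the transform is exactly exp (- |u|^2); read
  backwards, this represents the Laplace factor of a squared modulus.\<close>

lemma gaussian_fourier_complex:
  "(\<integral>z. of_real (complex_gaussian_density z) * exp (2 * \<i> * of_real (Re (z * u))) \<partial>lborel) = of_real (exp (- (cmod u)\<^sup>2))"
proof -
  let ?f = "\<lambda>c x. of_real (exp (- x\<^sup>2)) * exp (2 * \<i> * of_real (x * c)) :: complex"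
  have eq: "of_real (complex_gaussian_density z) * exp (2 * \<i> * of_real (Re (z * u)))
      = of_real (1 / pi) * (?f (Re u) (Re z) * ?f (- Im u) (Im z))" for z
  proof -
    have e1: "exp (- (cmod z)\<^sup>2) = exp (- (Re z)\<^sup>2) * exp (- (Im z)\<^sup>2)"
      by (simp add: cmod_power2 flip: exp_add)
    have e2: "exp (2 * \<i> * of_real (Re (z * u))) = exp (2 * \<i> * of_real (Re z * Re u)) * exp (2 * \<i> * of_real (Im z * - Im u))"
      by (simp add: algebra_simps flip: exp_add)
    show ?thesis
      unfolding complex_gaussian_density_def e2 of_real_divide e1 by simp
  qed
  have "(\<integral>z. of_real (complex_gaussian_density z) * exp (2 * \<i> * of_real (Re (z * u))) \<partial>lborel)
     = of_real (1 / pi) * ((\<integral>x. ?f (Re u) x \<partial>lborel) * (\<integral>x. ?f (- Im u) x \<partial>lborel))"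
    unfolding eq integral_mult_right_zero
    by (subst lborel_complex_integral_prod) (rule gaussian_fourier_real(1) refl)+
  also have "\<dots> = of_real (1 / pi * ((sqrt pi * exp (- (Re u)\<^sup>2)) * (sqrt pi * exp (- (- Im u)\<^sup>2))))"
    by (simp only: gaussian_fourier_real(2)) (simp only: of_real_mult)
  also have "1 / pi * ((sqrt pi * exp (- (Re u)\<^sup>2)) * (sqrt pi * exp (- (- Im u)\<^sup>2))) = exp (- (cmod u)\<^sup>2)"
  proof -
    have g: "1 / p * ((s * E) * (s * F)) = (s * s) / p * (E * F)" for p s E F :: real by simp
    have "1 / pi * ((sqrt pi * exp (- (Re u)\<^sup>2)) * (sqrt pi * exp (- (- Im u)\<^sup>2)))
        = (sqrt pi * sqrt pi) / pi * (exp (- (Re u)\<^sup>2) * exp (- (Im u)\<^sup>2))" unfolding power2_minus g ..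
    also have "\<dots> = exp (- (cmod u)\<^sup>2)"
      by (simp add: cmod_power2 flip: exp_add)
    finally show ?thesis .
  qed
  finally show ?thesis .
qed

lemma nn_integral_gaussian_real:
  assumes a: "0 < a"
  shows "(\<integral>\<^sup>+x. ennreal (exp (- (a * x\<^sup>2) - 2 * x * c)) \<partial>lborel) = ennreal (sqrt (pi / a) * exp (c\<^sup>2 / a))"
proof -
  define \<sigma> where "\<sigma> = sqrt (1 / (2 * a))"
  have \<sigma>: "0 < \<sigma>" "\<sigma>\<^sup>2 = 1 / (2 * a)" using a by (auto simp: \<sigma>_def)
  have eq: "exp (- (a * x\<^sup>2) - 2 * x * c) = (sqrt (pi / a) * exp (c\<^sup>2 / a)) * normal_density (- c / a) \<sigma> x" for x
  proof -
    have "- (a * x\<^sup>2) - 2 * x * c = c\<^sup>2 / a + - (x - (- c / a))\<^sup>2 / (2 * \<sigma>\<^sup>2)"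
      using a unfolding \<sigma> by (simp add: field_simps power2_eq_square)
    then have e: "exp (- (a * x\<^sup>2) - 2 * x * c) = exp (c\<^sup>2 / a) * exp (- (x - (- c / a))\<^sup>2 / (2 * \<sigma>\<^sup>2))"
      by (simp only: exp_add)
    have r: "sqrt (2 * pi * \<sigma>\<^sup>2) = sqrt (pi / a)" unfolding \<sigma> by simp
    have "R * E * (1 / R * F) = E * F" if "R \<noteq> 0" for R E F :: real using that by simp
    moreover have "sqrt (pi / a) \<noteq> 0" using a by simp
    ultimately show ?thesis
      unfolding normal_density_def r e by metis
  qed
  have "(\<integral>\<^sup>+x. ennreal (normal_density (- c / a) \<sigma> x) \<partial>lborel) = 1"
    using \<sigma> by (subst nn_integral_eq_integral) auto
  then show ?thesis
    unfolding eq using a by (simp add: ennreal_mult' nn_integral_cmult)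
qed

lemma nn_integral_gaussian_complex:
  assumes a: "0 < a"
  shows "(\<integral>\<^sup>+z. ennreal (exp (- (a * (cmod z)\<^sup>2) - 2 * Re (z * b)) / pi) \<partial>lborel) = ennreal (exp ((cmod b)\<^sup>2 / a) / a)"
proof -
  let ?f = "\<lambda>c x. ennreal (exp (- (a * x\<^sup>2) - 2 * x * c))"
  define F where "F e = (if e = 1 then ?f (Re b) else ?f (- Im b))" for e :: complex
  have [measurable]: "F e \<in> borel_measurable borel" for e
    by (simp add: F_def)
  have ne: "(1::complex) \<noteq> \<i>" by (simp add: complex_eq_iff)
  have eq: "ennreal (exp (- (a * (cmod z)\<^sup>2) - 2 * Re (z * b)) / pi) = ennreal (1 / pi) * (\<Prod>e\<in>Basis. F e (inner z e))" for z
  proof -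
    have "exp (- (a * (cmod z)\<^sup>2) - 2 * Re (z * b)) = exp (- (a * (Re z)\<^sup>2) - 2 * Re z * Re b) * exp (- (a * (Im z)\<^sup>2) - 2 * Im z * (- Im b))"
      by (simp add: cmod_power2 algebra_simps flip: exp_add)
    then show ?thesis
      using ne by (simp add: F_def Basis_complex_def ennreal_mult'[symmetric] divide_inverse mult.commute)
  qed
  have "(\<integral>\<^sup>+z. ennreal (exp (- (a * (cmod z)\<^sup>2) - 2 * Re (z * b)) / pi) \<partial>lborel)
      = ennreal (1 / pi) * (\<integral>\<^sup>+z. (\<Prod>e\<in>Basis. F e (inner z e)) \<partial>lborel)"
    unfolding eq by (rule nn_integral_cmult) measurable
  also have "(\<integral>\<^sup>+z. (\<Prod>e\<in>(Basis :: complex set). F e (inner z e)) \<partial>lborel) = (\<Prod>e\<in>(Basis :: complex set). \<integral>\<^sup>+x. F e x \<partial>lborel)"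
    by (rule nn_integral_lborel_prod) auto
  also have "\<dots> = ennreal (sqrt (pi / a) * exp ((Re b)\<^sup>2 / a)) * ennreal (sqrt (pi / a) * exp ((- Im b)\<^sup>2 / a))"
  proof -
    have F: "F 1 = ?f (Re b)" "F \<i> = ?f (- Im b)" using ne by (auto simp: F_def)
    have "(\<Prod>e\<in>(Basis :: complex set). \<integral>\<^sup>+x. F e x \<partial>lborel) = (\<integral>\<^sup>+x. F 1 x \<partial>lborel) * (\<integral>\<^sup>+x. F \<i> x \<partial>lborel)"
      using ne by (simp add: Basis_complex_def)
    then show ?thesis unfolding F nn_integral_gaussian_real[OF a] .
  qed
  also have "\<dots> = ennreal ((sqrt (pi / a) * exp ((Re b)\<^sup>2 / a)) * (sqrt (pi / a) * exp ((- Im b)\<^sup>2 / a)))"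
    using a by (intro ennreal_mult[symmetric]) auto
  also have "(sqrt (pi / a) * exp ((Re b)\<^sup>2 / a)) * (sqrt (pi / a) * exp ((- Im b)\<^sup>2 / a)) = pi / a * exp ((cmod b)\<^sup>2 / a)"
  proof -
    have g: "(s * E) * (s * F) = (s * s) * (E * F)" for s E F :: real by simp
    have "(sqrt (pi / a) * exp ((Re b)\<^sup>2 / a)) * (sqrt (pi / a) * exp ((- Im b)\<^sup>2 / a))
      = (sqrt (pi / a) * sqrt (pi / a)) * (exp ((Re b)\<^sup>2 / a) * exp ((Im b)\<^sup>2 / a))" unfolding power2_minus g ..
    also have "sqrt (pi / a) * sqrt (pi / a) = pi / a" using a by (intro real_sqrt_mult_self[THEN trans]) auto
    finally show ?thesis by (simp add: cmod_power2 add_divide_distrib flip: exp_add)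
  qed
  also have "ennreal (1 / pi) * ennreal (pi / a * exp ((cmod b)\<^sup>2 / a)) = ennreal (exp ((cmod b)\<^sup>2 / a) / a)"
    by (simp add: ennreal_mult'[symmetric])
  finally show ?thesis .
qed

text \<open>As a measure of its own it plays two roles: the law of each coefficient, and the
  auxiliary Gaussian integration used for the Laplace transform.\<close>

definition std_complex_normal :: "complex measure" where
  "std_complex_normal = density lborel (\<lambda>z. ennreal (complex_gaussian_density z))"

lemma sets_std_complex_normal [simp, measurable_cong]: "sets std_complex_normal = sets borel"
  by (simp add: std_complex_normal_def)

lemma space_std_complex_normal [simp]: "space std_complex_normal = UNIV"
  by (simp add: std_complex_normal_def)

lemma prob_space_std_complex_normal: "prob_space std_complex_normal"
proof
  have "emeasure std_complex_normal (space std_complex_normal) = (\<integral>\<^sup>+z. ennreal (complex_gaussian_density z) \<partial>lborel)"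
    unfolding std_complex_normal_def by (subst emeasure_density) auto
  also have "\<dots> = 1"
    using nn_integral_gaussian_complex[of 1 0] by (simp add: complex_gaussian_density_def)
  finally show "emeasure std_complex_normal (space std_complex_normal) = 1" .
qed

lemma integral_std_complex_normal_fourier:
  "(\<integral>z. exp (2 * \<i> * of_real (Re (z * u))) \<partial>std_complex_normal) = of_real (exp (- (cmod u)\<^sup>2))"
proof -
  have "(\<integral>z. exp (2 * \<i> * of_real (Re (z * u))) \<partial>std_complex_normal)
      = (\<integral>z. complex_gaussian_density z *\<^sub>R exp (2 * \<i> * of_real (Re (z * u))) \<partial>lborel)"
    unfolding std_complex_normal_def by (rule integral_density) auto
  then show ?thesis
    unfolding scaleR_conv_of_real gaussian_fourier_complex .
qed

lemma nn_integral_std_complex_normal: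
  assumes "0 < 1 + c"
  shows "(\<integral>\<^sup>+z. ennreal (exp (- (c * (cmod z)\<^sup>2) - 2 * Re (z * b))) \<partial>std_complex_normal)
     = ennreal (exp ((cmod b)\<^sup>2 / (1 + c)) / (1 + c))"
proof -
  have "complex_gaussian_density z * exp (- (c * (cmod z)\<^sup>2) - 2 * Re (z * b)) = exp (- ((1 + c) * (cmod z)\<^sup>2) - 2 * Re (z * b)) / pi" for z
    by (simp add: complex_gaussian_density_def algebra_simps flip: exp_add)
  then show ?thesis
    unfolding std_complex_normal_def nn_integral_gaussian_complex[OF assms, symmetric]
    by (subst nn_integral_density) (auto simp: ennreal_mult'[symmetric])
qed

section \<open>Random series with independent Gaussian coefficients\<close>

locale gaussian_sequence = prob_space M for M :: "'w measure" +
  fixes a :: "nat \<Rightarrow> 'w \<Rightarrow> complex"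
  assumes indep: "indep_vars (\<lambda>_. borel) a UNIV"
    and gaussian: "std_complex_gaussian M (a k)"
begin

lemma a_measurable [measurable]: "a k \<in> borel_measurable M"
  using gaussian[of k] unfolding std_complex_gaussian_def by (auto dest: distributed_measurable)

lemma distr_a: "distr M borel (a k) = std_complex_normal"
proof -
  have "distr M lborel (a k) = density lborel (\<lambda>z. ennreal (complex_gaussian_density z))"
    using gaussian[of k] unfolding std_complex_gaussian_def complex_gaussian_density_def
    by (auto dest: distributed_distr_eq_density)
  then show ?thesis
    unfolding std_complex_normal_def by (subst distr_cong[OF refl _ refl, of _ lborel]) simp_all
qed

text \<open>The constant comes from |z| <= 1 + |z|^2 / 2 <= exp (|z|^2 / 2), whose Gaussian integral
  is 1 / (1 - 1/2).\<close>

lemma nn_integral_norm_a: "(\<integral>\<^sup>+\<omega>. ennreal (cmod (a k \<omega>)) \<partial>M) \<le> 2"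
proof -
  have "(\<integral>\<^sup>+\<omega>. ennreal (cmod (a k \<omega>)) \<partial>M) = (\<integral>\<^sup>+z. ennreal (cmod z) \<partial>std_complex_normal)"
    unfolding distr_a[of k, symmetric] by (subst nn_integral_distr) auto
  also have "\<dots> \<le> (\<integral>\<^sup>+z. ennreal (exp (- ((- 1/2) * (cmod z)\<^sup>2) - 2 * Re (z * 0))) \<partial>std_complex_normal)"
  proof (intro nn_integral_mono ennreal_leI)
    fix z
    have "0 \<le> (cmod z - 1)\<^sup>2" by simp
    then have "cmod z \<le> 1 + (cmod z)\<^sup>2 / 2" by (simp add: power2_diff)
    also have "\<dots> \<le> exp ((cmod z)\<^sup>2 / 2)" by simp
    finally show "cmod z \<le> exp (- ((- 1/2) * (cmod z)\<^sup>2) - 2 * Re (z * 0))" by simp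
  qed
  also have "\<dots> = 2"
    by (subst nn_integral_std_complex_normal) auto
  finally show ?thesis .
qed

definition series :: "(nat \<Rightarrow> complex) \<Rightarrow> 'w \<Rightarrow> complex" where
  "series u \<omega> = (\<Sum>k. a k \<omega> * u k)"

lemma series_measurable [measurable]: "series u \<in> borel_measurable M"
  unfolding series_def by measurable

text \<open>The expected sum of moduli is at most twice the absolute sum of \<open>u\<close>, so the
  random sum is finite almost surely.\<close>

lemma AE_summable:
  assumes "summable (\<lambda>k. cmod (u k))"
  shows "AE \<omega> in M. summable (\<lambda>k. cmod (a k \<omega> * u k))"
proof -
  have "(\<integral>\<^sup>+\<omega>. (\<Sum>k. ennreal (cmod (a k \<omega> * u k))) \<partial>M) = (\<Sum>k. \<integral>\<^sup>+\<omega>. ennreal (cmod (a k \<omega> * u k)) \<partial>M)"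
    by (rule nn_integral_suminf) measurable
  also have "\<dots> \<le> (\<Sum>k. 2 * ennreal (cmod (u k)))"
  proof (intro suminf_le)
    fix k
    have "(\<integral>\<^sup>+\<omega>. ennreal (cmod (a k \<omega> * u k)) \<partial>M) = (\<integral>\<^sup>+\<omega>. ennreal (cmod (a k \<omega>)) \<partial>M) * ennreal (cmod (u k))"
      by (simp add: norm_mult ennreal_mult nn_integral_multc)
    also have "\<dots> \<le> 2 * ennreal (cmod (u k))"
      by (intro mult_right_mono nn_integral_norm_a) simp
    finally show "(\<integral>\<^sup>+\<omega>. ennreal (cmod (a k \<omega> * u k)) \<partial>M) \<le> 2 * ennreal (cmod (u k))" .
  qed auto
  also have "\<dots> = 2 * ennreal (\<Sum>k. cmod (u k))"
    unfolding ennreal_suminf_cmult using assms by (subst suminf_ennreal_eq[OF _ summable_sums]) auto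
  also have "\<dots> < \<infinity>" by (simp add: ennreal_mult_less_top)
  finally have "AE \<omega> in M. (\<Sum>k. ennreal (cmod (a k \<omega> * u k))) \<noteq> \<infinity>"
    by (intro nn_integral_PInf_AE) auto
  then show ?thesis
  proof eventually_elim
    case (elim \<omega>)
    then show ?case by (intro summable_suminf_not_top) auto
  qed
qed

lemma AE_series_sums:
  assumes "summable (\<lambda>k. cmod (u k))"
  shows "AE \<omega> in M. (\<lambda>k. a k \<omega> * u k) sums series u \<omega>"
  using AE_summable[OF assms] unfolding series_def
  by eventually_elim (auto intro: summable_sums summable_norm_cancel)

text \<open>Independence factorises the transform of each partial sum; the integrands have modulus
  1, so dominated convergence passes to the series.\<close>

lemma characteristic_series:
  assumes u: "summable (\<lambda>k. cmod (u k))" and A: "(\<lambda>k. (cmod (u k))\<^sup>2) sums A"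
  shows "expectation (\<lambda>\<omega>. exp (2 * \<i> * of_real (Re (series u \<omega>)))) = of_real (exp (- A))"
proof (rule LIMSEQ_unique)
  let ?E = "\<lambda>x. exp (2 * \<i> * of_real (Re x)) :: complex"
  show "(\<lambda>N. expectation (\<lambda>\<omega>. ?E (\<Sum>k<N. a k \<omega> * u k))) \<longlonglongrightarrow> expectation (\<lambda>\<omega>. ?E (series u \<omega>))"
  proof (rule integral_dominated_convergence[where w="\<lambda>_. 1"])
    show "AE \<omega> in M. (\<lambda>N. ?E (\<Sum>k<N. a k \<omega> * u k)) \<longlonglongrightarrow> ?E (series u \<omega>)"
      using AE_series_sums[OF u]
    proof eventually_elim
      case (elim \<omega>)
      then have "(\<lambda>N. (\<Sum>k<N. a k \<omega> * u k)) \<longlonglongrightarrow> series u \<omega>" by (simp add: sums_def)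
      then show ?case by (intro tendsto_intros)
    qed
  qed (auto simp: norm_exp_eq_Re)
  have "expectation (\<lambda>\<omega>. ?E (\<Sum>k<N. a k \<omega> * u k)) = of_real (exp (- (\<Sum>k<N. (cmod (u k))\<^sup>2)))" for N
  proof -
    have "?E (\<Sum>k<N. a k \<omega> * u k) = (\<Prod>k<N. ?E (a k \<omega> * u k))" for \<omega>
      by (simp add: exp_sum sum_distrib_left flip: exp_sum)
    then have "expectation (\<lambda>\<omega>. ?E (\<Sum>k<N. a k \<omega> * u k)) = expectation (\<lambda>\<omega>. \<Prod>k<N. ?E (a k \<omega> * u k))"
      by simp
    also have "\<dots> = (\<Prod>k<N. expectation (\<lambda>\<omega>. ?E (a k \<omega> * u k)))"
    proof (rule indep_vars_lebesgue_integral)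
      show "indep_vars (\<lambda>_. borel) (\<lambda>k \<omega>. ?E (a k \<omega> * u k)) {..<N}"
        by (rule indep_vars_compose2[OF indep_vars_subset[OF indep]]) auto
      show "integrable M (\<lambda>\<omega>. ?E (a k \<omega> * u k))" for k
        by (rule integrable_const_bound[where B=1]) (auto simp: norm_exp_eq_Re)
    qed auto
    also have "\<dots> = (\<Prod>k<N. of_real (exp (- (cmod (u k))\<^sup>2)))"
    proof (intro prod.cong refl)
      fix k
      have "expectation (\<lambda>\<omega>. ?E (a k \<omega> * u k)) = (\<integral>z. ?E (z * u k) \<partial>distr M borel (a k))"
        by (subst integral_distr) auto
      then show "expectation (\<lambda>\<omega>. ?E (a k \<omega> * u k)) = of_real (exp (- (cmod (u k))\<^sup>2))"
        by (simp only: distr_a integral_std_complex_normal_fourier)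
    qed
    also have "\<dots> = of_real (exp (- (\<Sum>k<N. (cmod (u k))\<^sup>2)))"
      by (simp add: exp_sum flip: sum_negf)
    finally show ?thesis .
  qed
  then show "(\<lambda>N. expectation (\<lambda>\<omega>. ?E (\<Sum>k<N. a k \<omega> * u k))) \<longlonglongrightarrow> of_real (exp (- A))"
    using A unfolding sums_def by (auto intro!: tendsto_intros)
qed

end

lemma quadratic_form_sums:
  fixes u v :: "nat \<Rightarrow> complex"
  assumes "(\<lambda>k. (cmod (u k))\<^sup>2) sums A" "(\<lambda>k. (cmod (v k))\<^sup>2) sums B" "(\<lambda>k. u k * cnj (v k)) sums \<kappa>"
  shows "(\<lambda>k. (cmod (x * u k + y * v k))\<^sup>2) sums ((cmod x)\<^sup>2 * A + (cmod y)\<^sup>2 * B + 2 * Re (x * cnj y * \<kappa>))"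
proof -
  have pq: "(cmod (p + q))\<^sup>2 = (cmod p)\<^sup>2 + (cmod q)\<^sup>2 + 2 * Re (p * cnj q)" for p q
    by (simp only: cmod_power2) (simp add: power2_eq_square algebra_simps)
  have re: "(x * u k) * cnj (y * v k) = x * cnj y * (u k * cnj (v k))" for k
    by (simp only: complex_cnj_mult mult_ac)
  have eq: "(cmod (x * u k + y * v k))\<^sup>2 = (cmod x)\<^sup>2 * (cmod (u k))\<^sup>2 + (cmod y)\<^sup>2 * (cmod (v k))\<^sup>2 + 2 * Re (x * cnj y * (u k * cnj (v k)))" for k
    unfolding pq re norm_mult power_mult_distrib ..
  show ?thesis
    unfolding eq by (intro sums_add sums_mult sums_Re assms)
qed

text \<open>The Hermitian form with entries \<open>A\<close>, \<open>B\<close>,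
  \<open>\<kappa>\<close> is a sum of squares, hence nonnegative; suitable values of its arguments
  give the determinant inequality.\<close>

lemma kernel_Cauchy_Schwarz:
  fixes u v :: "nat \<Rightarrow> complex"
  assumes "(\<lambda>k. (cmod (u k))\<^sup>2) sums A" "(\<lambda>k. (cmod (v k))\<^sup>2) sums B" "(\<lambda>k. u k * cnj (v k)) sums \<kappa>"
  shows "0 \<le> A" "0 \<le> B" "(cmod \<kappa>)\<^sup>2 \<le> A * B"
proof -
  show A0: "0 \<le> A" and B0: "0 \<le> B"
    using assms(1,2) by (auto simp: sums_iff intro!: suminf_nonneg)
  have Q: "0 \<le> (cmod x)\<^sup>2 * A + (cmod y)\<^sup>2 * B + 2 * Re (x * cnj y * \<kappa>)" for x y
  proof -
    note sums = quadratic_form_sums[OF assms, of x y]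
    have "0 \<le> (\<Sum>k. (cmod (x * u k + y * v k))\<^sup>2)"
      by (rule suminf_nonneg[OF sums_summable[OF sums]]) simp
    then show ?thesis unfolding sums_unique[OF sums, symmetric] .
  qed
  have R: "Re (- \<kappa> * cnj \<kappa>) = - (cmod \<kappa>)\<^sup>2" "Re (cnj \<kappa> * \<kappa>) = (cmod \<kappa>)\<^sup>2"
    by (simp_all only: cmod_power2) (simp_all add: power2_eq_square)
  have n: "Re \<kappa> * Re \<kappa> + Im \<kappa> * Im \<kappa> = (cmod \<kappa>)\<^sup>2"
    using R(2) by simp
  show "(cmod \<kappa>)\<^sup>2 \<le> A * B"
  proof (cases "B = 0")
    case True
    have "0 \<le> A - 2 * r * (cmod \<kappa>)\<^sup>2" for r
    proof -
      have "Re (- (of_real r * cnj \<kappa> * \<kappa>)) = - (r * (cmod \<kappa>)\<^sup>2)"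
        by (simp add: mult.assoc n flip: distrib_left)
      then show ?thesis
        using Q[of 1 "- of_real r * \<kappa>"] True by (simp add: mult.assoc n)
    qed
    \<comment> \<open>For nonzero \<open>\<kappa>\<close> this value would give 0 <= -1, so
      \<open>B = 0\<close> forces \<open>\<kappa> = 0\<close>.\<close>
    from this[of "(A + 1) / (2 * (cmod \<kappa>)\<^sup>2)"] show ?thesis
      using True by (cases "\<kappa> = 0") auto
  next
    case False
    \<comment> \<open>The form is evaluated at \<open>x = 1\<close>,
      \<open>y = - \<kappa> / B\<close>, its minimum in \<open>y\<close>.\<close>
    have "0 \<le> A + (cmod \<kappa>)\<^sup>2 / B\<^sup>2 * B - 2 * ((cmod \<kappa>)\<^sup>2 / B)"
    proof -
      have "1 * cnj (- \<kappa> / of_real B) * \<kappa> = (- (1 / B)) *\<^sub>R (cnj \<kappa> * \<kappa>)"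
        by (simp add: scaleR_conv_of_real)
      then have "Re (1 * cnj (- \<kappa> / of_real B) * \<kappa>) = - (1 / B) * (cmod \<kappa>)\<^sup>2"
        by (simp only: scaleR_complex.sel R(2))
      with Q[of 1 "- \<kappa> / of_real B"] False show ?thesis
        by (simp add: norm_divide power_divide del: times_complex.sel mult_1_left mult_1)
    qed
    then have "(cmod \<kappa>)\<^sup>2 / B \<le> A"
      using False by (simp add: power2_eq_square)
    then show ?thesis using False B0 by (simp add: divide_le_eq)
  qed
qed

context gaussian_sequence
begin

lemma characteristic_pair:
  assumes u: "summable (\<lambda>k. cmod (u k))" and v: "summable (\<lambda>k. cmod (v k))"
    and *: "(\<lambda>k. (cmod (u k))\<^sup>2) sums A" "(\<lambda>k. (cmod (v k))\<^sup>2) sums B" "(\<lambda>k. u k * cnj (v k)) sums \<kappa>"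
  shows "expectation (\<lambda>\<omega>. exp (2 * \<i> * of_real (Re (x * series u \<omega> + y * series v \<omega>))))
     = of_real (exp (- ((cmod x)\<^sup>2 * A + (cmod y)\<^sup>2 * B + 2 * Re (x * cnj y * \<kappa>))))"
proof -
  let ?c = "\<lambda>k. x * u k + y * v k"
  have sm: "summable (\<lambda>k. cmod (?c k))"
  proof (rule summable_comparison_test'[where N=0])
    show "summable (\<lambda>k. cmod x * cmod (u k) + cmod y * cmod (v k))"
      by (intro summable_add summable_mult u v)
    show "norm (cmod (?c k)) \<le> cmod x * cmod (u k) + cmod y * cmod (v k)" for k
      using norm_triangle_ineq[of "x * u k" "y * v k"] by (simp add: norm_mult)
  qed
  have "AE \<omega> in M. x * series u \<omega> + y * series v \<omega> = series ?c \<omega>"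
    using AE_series_sums[OF u] AE_series_sums[OF v]
  proof eventually_elim
    case (elim \<omega>)
    have "(\<lambda>k. x * (a k \<omega> * u k) + y * (a k \<omega> * v k)) sums (x * series u \<omega> + y * series v \<omega>)"
      by (intro sums_add sums_mult elim)
    then show ?case
      unfolding series_def by (simp add: sums_iff algebra_simps)
  qed
  note series_eq = this
  have "expectation (\<lambda>\<omega>. exp (2 * \<i> * of_real (Re (x * series u \<omega> + y * series v \<omega>))))
     = expectation (\<lambda>\<omega>. exp (2 * \<i> * of_real (Re (series ?c \<omega>))))"
  proof (rule integral_cong_AE)
    show "AE \<omega> in M. exp (2 * \<i> * of_real (Re (x * series u \<omega> + y * series v \<omega>)))
       = (exp (2 * \<i> * of_real (Re (series ?c \<omega>))) :: complex)"
      using series_eq by eventually_elim (simp only:)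
  qed measurable
  also have "\<dots> = of_real (exp (- ((cmod x)\<^sup>2 * A + (cmod y)\<^sup>2 * B + 2 * Re (x * cnj y * \<kappa>))))"
    by (rule characteristic_series[OF sm quadratic_form_sums[OF *]])
  finally show ?thesis .
qed

text \<open>Writing \<open>exp (- \<bar>x\<bar>\<^sup>2)\<close> as the Fourier transform of an auxiliary Gaussian reduces the joint
  Laplace transform of the two squared moduli to the characteristic function of a linear combination.\<close>

lemma laplace_pair:
  assumes u: "summable (\<lambda>k. cmod (u k))" and v: "summable (\<lambda>k. cmod (v k))"
    and *: "(\<lambda>k. (cmod (u k))\<^sup>2) sums A" "(\<lambda>k. (cmod (v k))\<^sup>2) sums B" "(\<lambda>k. u k * cnj (v k)) sums \<kappa>"
    and t: "0 \<le> t" and s: "0 \<le> s"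
  shows "expectation (\<lambda>\<omega>. exp (- (t * (cmod (series u \<omega>))\<^sup>2)) * exp (- (s * (cmod (series v \<omega>))\<^sup>2)))
     = 1 / ((1 + t * A) * (1 + s * B) - t * s * (cmod \<kappa>)\<^sup>2)"
proof -
  note CS = kernel_Cauchy_Schwarz[OF *]
  let ?N = "std_complex_normal"
  interpret N: prob_space ?N by (rule prob_space_std_complex_normal)
  have N1: "N.prob UNIV = 1" using N.prob_space by simp
  interpret MN: pair_prob_space M ?N ..
  let ?X = "\<lambda>\<omega>. of_real (sqrt t) * series u \<omega>" and ?Y = "\<lambda>\<omega>. of_real (sqrt s) * series v \<omega>"
  define e where "e z = exp (2 * \<i> * complex_of_real (Re z))" for z
  have [measurable]: "e \<in> borel_measurable borel" unfolding e_def by measurable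
  have int_e: "(\<integral>g. e (g * z) \<partial>?N) = of_real (exp (- (cmod z)\<^sup>2))" for z
    unfolding e_def by (rule integral_std_complex_normal_fourier)
  let ?F = "\<lambda>\<omega> g h. e (g * ?X \<omega>) * e (h * ?Y \<omega>)"
  have F1: "norm (?F \<omega> g h) = 1" for \<omega> g h
    by (simp add: e_def norm_mult norm_exp_eq_Re)
  have rep: "of_real (exp (- (t * (cmod (series u \<omega>))\<^sup>2)) * exp (- (s * (cmod (series v \<omega>))\<^sup>2)))
     = (\<integral>g. (\<integral>h. ?F \<omega> g h \<partial>?N) \<partial>?N)" for \<omega>
  proof -
    have "(\<integral>g. (\<integral>h. ?F \<omega> g h \<partial>?N) \<partial>?N) = of_real (exp (- (cmod (?X \<omega>))\<^sup>2)) * of_real (exp (- (cmod (?Y \<omega>))\<^sup>2))"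
      by (simp only: integral_mult_right_zero integral_mult_left_zero int_e)
    then show ?thesis
      using t s by (simp add: norm_mult power_mult_distrib)
  qed
  \<comment> \<open>The exponent produced by \<open>characteristic_pair\<close>, with the cross term
    arranged as \<open>h\<close> times a factor free of \<open>h\<close> so that \<open>h\<close>
    can be integrated out first.\<close>
  define Q where "Q g h = (cmod g)\<^sup>2 * (t * A) + (cmod h)\<^sup>2 * (s * B) + 2 * Re (h * (of_real (sqrt t * sqrt s) * cnj (g * \<kappa>)))" for g h
  have [measurable]: "(\<lambda>(g, h). Q g h) \<in> borel_measurable (borel \<Otimes>\<^sub>M borel)"
    unfolding Q_def by measurable
  have E_F: "expectation (\<lambda>\<omega>. ?F \<omega> g h) = of_real (exp (- Q g h))" for g h
  proof -
    have "?F \<omega> g h = e ((g * of_real (sqrt t)) * series u \<omega> + (h * of_real (sqrt s)) * series v \<omega>)" for \<omega>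
      unfolding e_def exp_add[symmetric] by (simp add: algebra_simps)
    then have "expectation (\<lambda>\<omega>. ?F \<omega> g h) = expectation (\<lambda>\<omega>. e ((g * of_real (sqrt t)) * series u \<omega> + (h * of_real (sqrt s)) * series v \<omega>))"
      by simp
    also have "\<dots> = of_real (exp (- ((cmod (g * of_real (sqrt t)))\<^sup>2 * A + (cmod (h * of_real (sqrt s)))\<^sup>2 * B
        + 2 * Re ((g * of_real (sqrt t)) * cnj (h * of_real (sqrt s)) * \<kappa>))))"
      unfolding e_def by (rule characteristic_pair[OF u v *])
    also have "(cmod (g * of_real (sqrt t)))\<^sup>2 * A + (cmod (h * of_real (sqrt s)))\<^sup>2 * B
        + 2 * Re ((g * of_real (sqrt t)) * cnj (h * of_real (sqrt s)) * \<kappa>) = Q g h"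
    proof -
      have "cnj ((g * of_real (sqrt t)) * cnj (h * of_real (sqrt s)) * \<kappa>) = h * (of_real (sqrt t * sqrt s) * cnj (g * \<kappa>))"
        by (simp add: mult_ac)
      then have "Re ((g * of_real (sqrt t)) * cnj (h * of_real (sqrt s)) * \<kappa>) = Re (h * (of_real (sqrt t * sqrt s) * cnj (g * \<kappa>)))"
        by (metis complex_cnj(1) complex_cnj_cnj complex_surj cnj.simps(1))
      then show ?thesis
        using t s by (simp add: Q_def norm_mult power_mult_distrib mult_ac)
    qed
    finally show ?thesis .
  qed
  have "of_real (expectation (\<lambda>\<omega>. exp (- (t * (cmod (series u \<omega>))\<^sup>2)) * exp (- (s * (cmod (series v \<omega>))\<^sup>2))))
     = expectation (\<lambda>\<omega>. \<integral>g. (\<integral>h. ?F \<omega> g h \<partial>?N) \<partial>?N)"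
    unfolding rep[symmetric] by (rule integral_complex_of_real[symmetric])
  also have "\<dots> = (\<integral>g. expectation (\<lambda>\<omega>. \<integral>h. ?F \<omega> g h \<partial>?N) \<partial>?N)"
  proof (rule MN.Fubini_integral[symmetric])
    show "integrable (M \<Otimes>\<^sub>M ?N) (\<lambda>(\<omega>, g). \<integral>h. ?F \<omega> g h \<partial>?N)"
    proof (rule MN.integrable_const_bound[where B=1])
      have "norm (\<integral>h. ?F \<omega> g h \<partial>?N) \<le> 1" for \<omega> g
        using integral_norm_bound[of ?N "\<lambda>h. ?F \<omega> g h"] F1 N1 by simp
      then show "AE x in M \<Otimes>\<^sub>M ?N. norm (case x of (\<omega>, g) \<Rightarrow> \<integral>h. ?F \<omega> g h \<partial>?N) \<le> 1"
        by (intro AE_I2) (simp add: split_beta)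
    qed measurable
  qed
  also have "\<dots> = (\<integral>g. (\<integral>h. expectation (\<lambda>\<omega>. ?F \<omega> g h) \<partial>?N) \<partial>?N)"
  proof (rule Bochner_Integration.integral_cong[OF refl], rule MN.Fubini_integral[symmetric])
    fix g
    show "integrable (M \<Otimes>\<^sub>M ?N) (\<lambda>(\<omega>, h). ?F \<omega> g h)"
      by (rule MN.integrable_const_bound[where B=1]) (auto simp: F1 split_beta)
  qed
  also have "\<dots> = of_real (\<integral>g. (\<integral>h. exp (- Q g h) \<partial>?N) \<partial>?N)"
    unfolding E_F by (simp add: integral_complex_of_real)
  finally have lhs: "expectation (\<lambda>\<omega>. exp (- (t * (cmod (series u \<omega>))\<^sup>2)) * exp (- (s * (cmod (series v \<omega>))\<^sup>2)))
      = (\<integral>g. (\<integral>h. exp (- Q g h) \<partial>?N) \<partial>?N)"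
    by (simp only: of_real_eq_iff)
  have sB: "0 < 1 + s * B" using s CS(2) by (simp add: add_pos_nonneg)
  \<comment> \<open>Integrating out \<open>h\<close> completes the square and leaves the Gaussian
    weight with coefficient \<open>c\<close> in \<open>g\<close>. The product of the two
    normalisations, \<open>(1 + c) * (1 + s * B)\<close>, is the determinant in the claim.\<close>
  define c where "c = t * A - t * s * (cmod \<kappa>)\<^sup>2 / (1 + s * B)"
  have c_eq: "(1 + c) * (1 + s * B) = (1 + t * A) * (1 + s * B) - t * s * (cmod \<kappa>)\<^sup>2"
    using sB by (simp add: c_def field_simps)
  \<comment> \<open>The Cauchy-Schwarz bound keeps the determinant at least 1 + t A + s B, so
    \<open>1 + c\<close> is positive and the outer Gaussian integral converges.\<close>
  have "t * s * (cmod \<kappa>)\<^sup>2 \<le> t * s * (A * B)"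
    using t s CS(3) by (intro mult_left_mono) auto
  moreover have "0 \<le> t * A" using t CS(1) by simp
  moreover have "(1 + t * A) * (1 + s * B) = 1 + t * A + s * B + t * s * (A * B)" by (simp add: algebra_simps)
  ultimately have "0 < (1 + c) * (1 + s * B)"
    unfolding c_eq using s CS(2) by (simp add: add_pos_nonneg) (smt (verit) mult_nonneg_nonneg)
  then have c: "0 < 1 + c" using sB by (simp add: zero_less_mult_iff)
  have inner: "(\<integral>h. exp (- Q g h) \<partial>?N) = exp (- (c * (cmod g)\<^sup>2)) / (1 + s * B)" for g
  proof -
    let ?b = "of_real (sqrt t * sqrt s) * cnj (g * \<kappa>)"
    have e: "exp (- Q g h) = exp (- ((cmod g)\<^sup>2 * (t * A))) * exp (- ((s * B) * (cmod h)\<^sup>2) - 2 * Re (h * ?b))" for h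
      by (simp add: Q_def algebra_simps flip: exp_add)
    have b: "(cmod ?b)\<^sup>2 = t * s * (cmod \<kappa>)\<^sup>2 * (cmod g)\<^sup>2"
      using t s by (simp add: norm_mult power_mult_distrib mult_ac)
    have "(\<integral>h. exp (- ((s * B) * (cmod h)\<^sup>2) - 2 * Re (h * ?b)) \<partial>?N) = exp ((cmod ?b)\<^sup>2 / (1 + s * B)) / (1 + s * B)"
    proof -
      have "(\<integral>h. exp (- ((s * B) * (cmod h)\<^sup>2) - 2 * Re (h * ?b)) \<partial>?N)
         = enn2real (\<integral>\<^sup>+h. ennreal (exp (- ((s * B) * (cmod h)\<^sup>2) - 2 * Re (h * ?b))) \<partial>?N)"
        by (rule integral_eq_nn_integral) auto
      then show ?thesis
        unfolding nn_integral_std_complex_normal[OF sB] using sB by simp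
    qed
    then have "(\<integral>h. exp (- Q g h) \<partial>?N) = exp (- ((cmod g)\<^sup>2 * (t * A))) * (exp ((cmod ?b)\<^sup>2 / (1 + s * B)) / (1 + s * B))"
      unfolding e integral_mult_right_zero by simp
    also have "\<dots> = exp (- (c * (cmod g)\<^sup>2)) / (1 + s * B)"
      unfolding b c_def by (simp add: algebra_simps flip: exp_add)
    finally show ?thesis .
  qed
  have outer: "(\<integral>g. exp (- (c * (cmod g)\<^sup>2)) \<partial>?N) = 1 / (1 + c)"
  proof -
    have "(\<integral>g. exp (- (c * (cmod g)\<^sup>2)) \<partial>?N) = enn2real (\<integral>\<^sup>+g. ennreal (exp (- (c * (cmod g)\<^sup>2))) \<partial>?N)"
      by (rule integral_eq_nn_integral) auto
    then show ?thesis
      using nn_integral_std_complex_normal[OF c, of 0] c by simp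
  qed
  show ?thesis
    unfolding lhs inner using outer sB c by (simp add: c_eq[symmetric])
qed

end

section \<open>Covariance of logarithms\<close>

lemma nn_integral_exp_interval:
  assumes "0 < t" "a \<le> b"
  shows "(\<integral>\<^sup>+y. indicator {a..b} y * ennreal (exp (- (t * y))) \<partial>lborel) = ennreal ((exp (- (t * a)) - exp (- (t * b))) / t)"
proof -
  have "((\<lambda>y. exp (- (t * y))) has_integral (- exp (- (t * b)) / t - (- exp (- (t * a)) / t))) {a..b}"
    using assms
    by (intro fundamental_theorem_of_calculus)
       (auto intro!: derivative_eq_intros simp flip: has_real_derivative_iff_has_vector_derivative)
  from nn_integral_has_integral_lebesgue[OF _ this]
  have "(\<integral>\<^sup>+y. ennreal (indicator {a..b} y * exp (- (t * y))) \<partial>lborel) = ennreal ((exp (- (t * a)) - exp (- (t * b))) / t)"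
    by (simp add: diff_divide_distrib)
  then show ?thesis by (simp add: ennreal_mult' ennreal_indicator)
qed

lemma nn_integral_inverse_interval:
  assumes "0 < a" "a \<le> b"
  shows "(\<integral>\<^sup>+y. indicator {a..b} y * ennreal (1 / y) \<partial>lborel) = ennreal (ln b - ln a)"
proof -
  have "((\<lambda>y. 1 / y) has_integral (ln b - ln a)) {a..b}"
    using assms
    by (intro fundamental_theorem_of_calculus)
       (auto intro!: derivative_eq_intros simp flip: has_real_derivative_iff_has_vector_derivative)
  then have "(\<integral>\<^sup>+y. ennreal (indicator {a..b} y * (1 / y)) \<partial>lborel) = ennreal (ln b - ln a)"
    using assms by (intro nn_integral_has_integral_lebesgue) auto
  moreover have "ennreal (indicator {a..b} y * (1 / y)) = indicator {a..b} y * ennreal (1 / y)" for y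
    by (simp add: indicator_def)
  ultimately show ?thesis by simp
qed

text \<open>The quotient is the integral of \<open>exp (- (t * y))\<close> over \<open>y\<close> in
  \<open>{a..b}\<close>. Tonelli's theorem integrates over \<open>t\<close> first, leaving
  \<open>1 / y\<close>.\<close>

lemma nn_integral_Frullani:
  assumes "0 < a" "a \<le> b"
  shows "(\<integral>\<^sup>+t. indicator {0<..} t * ennreal ((exp (- (t * a)) - exp (- (t * b))) / t) \<partial>lborel) = ennreal (ln b - ln a)"
proof -
  let ?I = "\<lambda>t y. indicator {0<..} t * (indicator {a..b} y * ennreal (exp (- (t * y))))"
  have "(\<integral>\<^sup>+t. indicator {0<..} t * ennreal ((exp (- (t * a)) - exp (- (t * b))) / t) \<partial>lborel)
      = (\<integral>\<^sup>+t. (\<integral>\<^sup>+y. ?I t y \<partial>lborel) \<partial>lborel)"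
  proof (rule nn_integral_cong)
    fix t :: real
    show "indicator {0<..} t * ennreal ((exp (- (t * a)) - exp (- (t * b))) / t) = (\<integral>\<^sup>+y. ?I t y \<partial>lborel)"
      using assms(2) by (cases "0 < t") (simp_all add: nn_integral_exp_interval)
  qed
  also have "\<dots> = (\<integral>\<^sup>+y. (\<integral>\<^sup>+t. ?I t y \<partial>lborel) \<partial>lborel)"
    by (rule lborel_pair.Fubini') measurable
  also have "\<dots> = (\<integral>\<^sup>+y. indicator {a..b} y * ennreal (1 / y) \<partial>lborel)"
  proof (rule nn_integral_cong)
    fix y :: real
    show "(\<integral>\<^sup>+t. ?I t y \<partial>lborel) = indicator {a..b} y * ennreal (1 / y)"
    proof (cases "y \<in> {a..b}")
      case True
      then have y: "0 < y" using assms by auto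
      have "(\<integral>\<^sup>+t. ?I t y \<partial>lborel) = (\<integral>\<^sup>+t. indicator {0<..} t * ennreal (t powr (1 - 1) * exp (- (y * t))) \<partial>lborel)"
        using True by (intro nn_integral_cong) (auto simp: indicator_def mult.commute)
      also have "\<dots> = ennreal (1 / y)"
        using y by (subst nn_integral_Gamma_open) auto
      finally show ?thesis using True by simp
    qed simp
  qed
  also have "\<dots> = ennreal (ln b - ln a)"
    by (rule nn_integral_inverse_interval[OF assms])
  finally show ?thesis .
qed

text \<open>The integrand that represents \<open>ln x\<close> through exponentials, to which Laplace
  transforms apply.\<close>

definition frullani :: "real \<Rightarrow> real \<Rightarrow> real" where
  "frullani x t = indicator {0<..} t * ((exp (- t) - exp (- (t * x))) / t)"

lemma frullani_measurable [measurable (raw)]: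
  assumes "f \<in> borel_measurable N" "g \<in> borel_measurable N"
  shows "(\<lambda>x. frullani (f x) (g x)) \<in> borel_measurable N"
  unfolding frullani_def using assms by measurable

text \<open>For fixed \<open>x\<close> the integrand has constant sign in \<open>t\<close>, so no
  mass is lost to cancellation. Integrability over the product with the probability space thus
  reduces to that of the logarithm itself.\<close>

lemma nn_integral_frullani:
  assumes "0 < x"
  shows "(\<integral>\<^sup>+t. ennreal \<bar>frullani x t\<bar> \<partial>lborel) = ennreal \<bar>ln x\<bar>"
proof (cases "1 \<le> x")
  case True
  have "ennreal \<bar>frullani x t\<bar> = indicator {0<..} t * ennreal ((exp (- (t * 1)) - exp (- (t * x))) / t)" for t
    using True by (auto simp: frullani_def indicator_def)
  then show ?thesis using nn_integral_Frullani[of 1 x] True by simp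
next
  case False
  have "ennreal \<bar>frullani x t\<bar> = indicator {0<..} t * ennreal ((exp (- (t * x)) - exp (- (t * 1))) / t)" for t
    using False by (auto simp: frullani_def indicator_def abs_if field_simps)
  then show ?thesis using nn_integral_Frullani[of x 1] False assms by simp
qed

lemma integral_frullani:
  assumes "0 < x"
  shows "integrable lborel (frullani x)" "(\<integral>t. frullani x t \<partial>lborel) = ln x"
proof -
  show int: "integrable lborel (frullani x)"
    by (rule integrableI_bounded) (auto simp: nn_integral_frullani[OF assms])
  have abs: "(\<integral>t. \<bar>frullani x t\<bar> \<partial>lborel) = \<bar>ln x\<bar>"
    by (subst integral_eq_nn_integral) (auto simp: nn_integral_frullani[OF assms])
  show "(\<integral>t. frullani x t \<partial>lborel) = ln x"
  proof (cases "1 \<le> x")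
    case True
    then have "\<bar>frullani x t\<bar> = frullani x t" for t
      by (auto simp: frullani_def indicator_def)
    with abs True show ?thesis by simp
  next
    case False
    then have "\<bar>frullani x t\<bar> = - frullani x t" for t
      using assms by (auto simp: frullani_def indicator_def abs_if field_simps)
    with abs False assms show ?thesis by simp
  qed
qed

section \<open>The dilogarithm as a double integral\<close>

definition dilog :: "real \<Rightarrow> real" where
  "dilog q = (\<Sum>k. q ^ Suc k / (real (Suc k))\<^sup>2)"

lemma summable_dilog:
  assumes "0 \<le> q" "q \<le> 1"
  shows "summable (\<lambda>k. q ^ Suc k / (real (Suc k))\<^sup>2)"
proof (rule summable_comparison_test'[where N=0])
  show "summable (\<lambda>k. 1 / (real (Suc k))\<^sup>2)"
    using inverse_power_summable[of 2, where 'a=real] by (subst summable_Suc_iff) (simp add: inverse_eq_divide)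
  show "norm (q ^ Suc k / (real (Suc k))\<^sup>2) \<le> 1 / (real (Suc k))\<^sup>2" for k
    using assms power_le_one[of q "Suc k"] by (simp add: divide_right_mono abs_mult del: of_nat_Suc)
qed

text \<open>An antiderivative is \<open>(t / (1 + t)) ^ Suc k / Suc k\<close>.\<close>

lemma nn_integral_beta_prime:
  "(\<integral>\<^sup>+t. indicator {0<..} t * ennreal (t ^ k / (1 + t) ^ (k + 2)) \<partial>lborel) = ennreal (1 / real (Suc k))"
proof -
  let ?F = "\<lambda>t::real. (t / (1 + t)) ^ Suc k / real (Suc k)"
  have "(\<integral>\<^sup>+t. ennreal (t ^ k / (1 + t) ^ (k + 2)) * indicator {0..} t \<partial>lborel) = ennreal (1 / real (Suc k) - ?F 0)"
  proof (rule nn_integral_FTC_atLeast)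
    show "DERIV ?F t :> t ^ k / (1 + t) ^ (k + 2)" if "0 \<le> t" for t
    proof -
      have "DERIV (\<lambda>t. t / (1 + t)) t :> (1 * (1 + t) - t * 1) / ((1 + t) * (1 + t))"
        using that by (auto intro!: derivative_eq_intros)
      from DERIV_cdivide[OF DERIV_power_Suc[OF this, of k], of "real (Suc k)"]
      have "DERIV ?F t :> (1 + real k) * ((1 * (1 + t) - t * 1) / ((1 + t) * (1 + t)) * (t / (1 + t)) ^ k) / real (Suc k)"
        by simp
      also have "(1 + real k) * ((1 * (1 + t) - t * 1) / ((1 + t) * (1 + t)) * (t / (1 + t)) ^ k) / real (Suc k) = t ^ k / (1 + t) ^ (k + 2)"
        by (simp add: power_divide power2_eq_square)
      finally show ?thesis .
    qed
    have "((\<lambda>t::real. t / (1 + t)) \<longlongrightarrow> 1) at_top"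
    proof -
      have "((\<lambda>t::real. 1 - inverse (1 + t)) \<longlongrightarrow> 1 - 0) at_top"
        by (intro tendsto_diff tendsto_const tendsto_inverse_0_at_top filterlim_tendsto_add_at_top[OF tendsto_const filterlim_ident])
      moreover have "\<forall>\<^sub>F t::real in at_top. 1 - inverse (1 + t) = t / (1 + t)"
        using eventually_gt_at_top[of 0] by eventually_elim (simp add: field_simps)
      ultimately show ?thesis by (simp add: tendsto_cong)
    qed
    then have "((\<lambda>t::real. ?F t) \<longlongrightarrow> 1 ^ Suc k / real (Suc k)) at_top"
      by (intro tendsto_divide tendsto_power tendsto_const) auto
    then show "(?F \<longlongrightarrow> 1 / real (Suc k)) at_top" by simp
  qed auto
  also have "(\<integral>\<^sup>+t. ennreal (t ^ k / (1 + t) ^ (k + 2)) * indicator {0..} t \<partial>lborel)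
     = (\<integral>\<^sup>+t. indicator {0<..} t * ennreal (t ^ k / (1 + t) ^ (k + 2)) \<partial>lborel)"
    using AE_lborel_singleton[of "0::real"]
    by (intro nn_integral_cong_AE) (auto simp: indicator_def elim!: eventually_mono)
  finally show ?thesis by simp
qed

text \<open>A geometric series with ratio t s q / ((1 + t) (1 + s)), which is below 1 even for
  \<open>q = 1\<close>. The subtracted product is its zeroth term, and division by t s leaves terms
  in which \<open>t\<close> and \<open>s\<close> separate.\<close>

lemma log_kernel_expansion:
  assumes q: "0 \<le> q" "q \<le> 1" and t: "0 < t" and s: "0 < (s::real)"
  shows "(\<lambda>k. q ^ Suc k * ((t ^ k / (1 + t) ^ (k + 2)) * (s ^ k / (1 + s) ^ (k + 2))))
     sums ((1 / ((1 + t) * (1 + s) - t * s * q) - 1 / (1 + t) * (1 / (1 + s))) / (t * s))"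
proof -
  define b where "b = (1 + t) * (1 + s)"
  define r where "r = t * s * q / b"
  have b: "0 < b" using t s by (simp add: b_def)
  have tsb: "t * s < b" using t s by (simp add: b_def algebra_simps)
  have "t * s * q \<le> t * s * 1" using t s q by (intro mult_left_mono) auto
  then have "t * s * q < b" using tsb by linarith
  then have r: "0 \<le> r" "r < 1" using t s q b tsb by (auto simp: r_def)
  have "(\<lambda>k. (r / (b * (t * s))) * r ^ k) sums ((r / (b * (t * s))) * (1 / (1 - r)))"
    using r by (intro sums_mult geometric_sums) auto
  also have "(\<lambda>k. (r / (b * (t * s))) * r ^ k) = (\<lambda>k. q ^ Suc k * ((t ^ k / (1 + t) ^ (k + 2)) * (s ^ k / (1 + s) ^ (k + 2))))"
  proof
    fix k
    have "(t ^ k / (1 + t) ^ (k + 2)) * (s ^ k / (1 + s) ^ (k + 2)) = (t * s) ^ k / b ^ (k + 2)"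
      by (simp only: b_def power_mult_distrib times_divide_times_eq)
    moreover have "(r / (b * (t * s))) * r ^ k = q ^ Suc k * ((t * s) ^ k / b ^ (k + 2))"
      using t s b by (simp add: r_def power_mult_distrib power_divide mult_ac)
    ultimately show "(r / (b * (t * s))) * r ^ k = q ^ Suc k * ((t ^ k / (1 + t) ^ (k + 2)) * (s ^ k / (1 + s) ^ (k + 2)))"
      by simp
  qed
  also have "(r / (b * (t * s))) * (1 / (1 - r)) = (1 / (b - t * s * q) - 1 / b) / (t * s)"
  proof -
    have "b * (1 - r) = b - t * s * q" using b by (simp add: r_def field_simps)
    moreover have "0 < b * (1 - r)" using b r by simp
    ultimately have ne: "b - t * s * q \<noteq> 0" "1 - r = (b - t * s * q) / b" using b by (auto simp: field_simps)
    show ?thesis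
      unfolding ne(2) using ne(1) b t s by (simp add: r_def field_simps)
  qed
  finally show ?thesis by (simp add: b_def)
qed

text \<open>After the expansion each term is a product of two integrals equal to
  \<open>1 / Suc k\<close>, and this is where the squares in \<open>dilog\<close> come from.\<close>

lemma nn_integral_log_kernel:
  assumes q: "0 \<le> q" "q \<le> 1"
  shows "(\<integral>\<^sup>+p. (case p of (t, s) \<Rightarrow> indicator {0<..} t * indicator {0<..} s *
       ennreal ((1 / ((1 + t) * (1 + s) - t * s * q) - 1 / (1 + t) * (1 / (1 + s))) / (t * s))) \<partial>(lborel \<Otimes>\<^sub>M lborel))
     = ennreal (dilog q)"
proof -
  let ?g = "\<lambda>k t. indicator {0<..} t * ennreal (t ^ k / (1 + t) ^ (k + 2)) :: ennreal"
  have "(\<integral>\<^sup>+p. (case p of (t, s) \<Rightarrow> indicator {0<..} t * indicator {0<..} s *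
       ennreal ((1 / ((1 + t) * (1 + s) - t * s * q) - 1 / (1 + t) * (1 / (1 + s))) / (t * s))) \<partial>(lborel \<Otimes>\<^sub>M lborel))
     = (\<integral>\<^sup>+p. (\<Sum>k. ennreal (q ^ Suc k) * (?g k (fst p) * ?g k (snd p))) \<partial>(lborel \<Otimes>\<^sub>M lborel))"
  proof (rule nn_integral_cong)
    fix p :: "real \<times> real"
    obtain t s where p: "p = (t, s)" by (cases p)
    show "(case p of (t, s) \<Rightarrow> indicator {0<..} t * indicator {0<..} s *
       ennreal ((1 / ((1 + t) * (1 + s) - t * s * q) - 1 / (1 + t) * (1 / (1 + s))) / (t * s)))
      = (\<Sum>k. ennreal (q ^ Suc k) * (?g k (fst p) * ?g k (snd p)))"
    proof (cases "0 < t \<and> 0 < s")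
      case True
      have "(\<Sum>k. ennreal (q ^ Suc k * ((t ^ k / (1 + t) ^ (k + 2)) * (s ^ k / (1 + s) ^ (k + 2)))))
         = ennreal ((1 / ((1 + t) * (1 + s) - t * s * q) - 1 / (1 + t) * (1 / (1 + s))) / (t * s))"
        using q True by (intro suminf_ennreal_eq log_kernel_expansion) auto
      moreover have "ennreal (q ^ Suc k * ((t ^ k / (1 + t) ^ (k + 2)) * (s ^ k / (1 + s) ^ (k + 2))))
        = ennreal (q ^ Suc k) * (ennreal (t ^ k / (1 + t) ^ (k + 2)) * ennreal (s ^ k / (1 + s) ^ (k + 2)))" for k
        using q True by (subst ennreal_mult, simp, simp, subst ennreal_mult) auto
      ultimately show ?thesis using True p by simp
    qed (auto simp: p)
  qed
  also have "\<dots> = (\<Sum>k. \<integral>\<^sup>+p. ennreal (q ^ Suc k) * (?g k (fst p) * ?g k (snd p)) \<partial>(lborel \<Otimes>\<^sub>M lborel))"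
    by (rule nn_integral_suminf) measurable
  also have "\<dots> = (\<Sum>k. ennreal (q ^ Suc k / (real (Suc k))\<^sup>2))"
  proof (intro suminf_cong)
    fix k
    have "(\<integral>\<^sup>+p. ennreal (q ^ Suc k) * (?g k (fst p) * ?g k (snd p)) \<partial>(lborel \<Otimes>\<^sub>M lborel))
       = ennreal (q ^ Suc k) * (\<integral>\<^sup>+p. ?g k (fst p) * ?g k (snd p) \<partial>(lborel \<Otimes>\<^sub>M lborel))"
      by (rule nn_integral_cmult) measurable
    also have "(\<integral>\<^sup>+p. ?g k (fst p) * ?g k (snd p) \<partial>(lborel \<Otimes>\<^sub>M lborel)) = (\<integral>\<^sup>+t. (\<integral>\<^sup>+s. ?g k t * ?g k s \<partial>lborel) \<partial>lborel)"
      by (subst lborel.nn_integral_fst[symmetric]) auto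
    also have "\<dots> = (\<integral>\<^sup>+t. ?g k t * ennreal (1 / real (Suc k)) \<partial>lborel)"
      by (subst nn_integral_cmult, measurable) (simp only: nn_integral_beta_prime)
    also have "\<dots> = ennreal (1 / real (Suc k)) * ennreal (1 / real (Suc k))"
      by (subst nn_integral_multc, measurable) (simp only: nn_integral_beta_prime)
    also have "ennreal (q ^ Suc k) * (ennreal (1 / real (Suc k)) * ennreal (1 / real (Suc k))) = ennreal (q ^ Suc k / (real (Suc k))\<^sup>2)"
      using q by (simp add: ennreal_mult'[symmetric] power2_eq_square del: of_nat_Suc)
    finally show "(\<integral>\<^sup>+p. ennreal (q ^ Suc k) * (?g k (fst p) * ?g k (snd p)) \<partial>(lborel \<Otimes>\<^sub>M lborel)) = ennreal (q ^ Suc k / (real (Suc k))\<^sup>2)" .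
  qed
  also have "\<dots> = ennreal (dilog q)"
    unfolding dilog_def using q by (intro suminf_ennreal_eq summable_sums summable_dilog) auto
  finally show ?thesis .
qed

lemma (in pair_sigma_finite) integrable_mult_prod:
  fixes f :: "'a \<Rightarrow> real" and g :: "'b \<Rightarrow> real"
  assumes f: "integrable M1 f" and g: "integrable M2 g"
  shows "integrable (M1 \<Otimes>\<^sub>M M2) (\<lambda>(x, y). f x * g y)"
proof (rule Fubini_integrable)
  have [measurable]: "f \<in> borel_measurable M1" "g \<in> borel_measurable M2"
    using f g by auto
  show "(\<lambda>(x, y). f x * g y) \<in> borel_measurable (M1 \<Otimes>\<^sub>M M2)" by measurable
  show "integrable M1 (\<lambda>x. \<integral>y. norm (case (x, y) of (x, y) \<Rightarrow> f x * g y) \<partial>M2)"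
    using f by (simp add: abs_mult)
  show "AE x in M1. integrable M2 (\<lambda>y. case (x, y) of (x, y) \<Rightarrow> f x * g y)"
    using g by simp
qed

text \<open>The exponential law of rate 1 is encoded by its Laplace transform, the form in which the
  computation for Gaussian series delivers it.\<close>

locale exponential_variable = prob_space M for M :: "'w measure" +
  fixes X :: "'w \<Rightarrow> real"
  assumes X_measurable [measurable]: "X \<in> borel_measurable M"
    and X_nonneg: "0 \<le> X \<omega>"
    and laplace: "0 \<le> t \<Longrightarrow> expectation (\<lambda>\<omega>. exp (- (t * X \<omega>))) = 1 / (1 + t)"
begin

lemma integrable_exp: "0 \<le> t \<Longrightarrow> integrable M (\<lambda>\<omega>. exp (- (t * X \<omega>)))"
  by (rule integrable_const_bound[where B=1]) (auto simp: X_nonneg)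

lemma nn_laplace: "0 \<le> t \<Longrightarrow> (\<integral>\<^sup>+\<omega>. ennreal (exp (- (t * X \<omega>))) \<partial>M) = ennreal (1 / (1 + t))"
  by (subst nn_integral_eq_integral[OF integrable_exp]) (auto simp: laplace)

text \<open>The probability of \<open>X = 0\<close> is at most the Laplace transform at every
  \<open>t\<close>, which tends to 0.\<close>

lemma AE_pos: "AE \<omega> in M. 0 < X \<omega>"
proof -
  let ?Z = "{\<omega> \<in> space M. X \<omega> = 0}"
  have "prob ?Z \<le> 1 / (1 + t)" if "0 \<le> t" for t
  proof -
    have "prob ?Z = expectation (indicator ?Z)" by simp
    also have "\<dots> \<le> expectation (\<lambda>\<omega>. exp (- (t * X \<omega>)))"
    proof (rule integral_mono)
      show "integrable M (indicat_real ?Z)"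
        by (rule integrable_real_indicator) (auto simp: emeasure_eq_measure)
    qed (use that in \<open>auto simp: indicator_def intro: integrable_exp\<close>)
    finally show ?thesis using laplace[OF that] by simp
  qed
  then have "\<forall>\<^sub>F t in at_top. prob ?Z \<le> 1 / (1 + t)"
    by (intro eventually_at_top_linorderI[of 0]) auto
  moreover have "((\<lambda>t::real. inverse (1 + t)) \<longlongrightarrow> 0) at_top"
    by (intro tendsto_inverse_0_at_top filterlim_tendsto_add_at_top[OF tendsto_const filterlim_ident])
  ultimately have "prob ?Z \<le> 0"
    by (intro tendsto_lowerbound[where f="\<lambda>t::real. inverse (1 + t)" and F=at_top]) (auto simp: inverse_eq_divide)
  then have "prob ?Z = 0" using measure_nonneg[of M ?Z] by linarith
  then have "AE \<omega> in M. \<omega> \<notin> ?Z"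
    by (intro AE_not_in) (simp add: null_sets_def emeasure_eq_measure)
  with AE_space show ?thesis
    by eventually_elim (use X_nonneg in \<open>auto simp: less_le\<close>)
qed

text \<open>Fatou's lemma for the difference quotients (1 - exp (- h X)) / h with
  \<open>h = 1 / Suc n\<close>, whose expectations 1 / (1 + h) do not exceed 1. It controls the
  logarithm for large \<open>X\<close>.\<close>

lemma nn_integral_X_le: "(\<integral>\<^sup>+\<omega>. ennreal (X \<omega>) \<partial>M) \<le> 1"
proof -
  let ?f = "\<lambda>n \<omega>. ennreal (real (Suc n) * (1 - exp (- (1 / real (Suc n) * X \<omega>))))"
  have "(\<lambda>n. ?f n \<omega>) \<longlonglongrightarrow> ennreal (X \<omega>)" for \<omega>
  proof -
    have "((\<lambda>h. (1 - exp (- (h * X \<omega>))) / h) \<longlongrightarrow> X \<omega>) (at_right 0)"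
    proof -
      have "((\<lambda>h. 1 - exp (- (h * X \<omega>))) has_real_derivative X \<omega>) (at 0)"
        by (auto intro!: derivative_eq_intros)
      then have "((\<lambda>h. (1 - exp (- (h * X \<omega>))) / h) \<longlongrightarrow> X \<omega>) (at 0)"
        by (simp add: has_field_derivative_iff)
      then show ?thesis by (rule filterlim_mono[OF _ order_refl at_le]) simp
    qed
    moreover have "filterlim (\<lambda>n. 1 / real (Suc n)) (at_right 0) sequentially"
      unfolding filterlim_at using LIMSEQ_Suc[OF lim_inverse_n'] by auto
    ultimately have "(\<lambda>n. (1 - exp (- (1 / real (Suc n) * X \<omega>))) / (1 / real (Suc n))) \<longlonglongrightarrow> X \<omega>"
      by (rule filterlim_compose)
    then show ?thesis
      by (intro tendsto_ennrealI) (simp add: mult.commute)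
  qed
  then have "(\<integral>\<^sup>+\<omega>. ennreal (X \<omega>) \<partial>M) = (\<integral>\<^sup>+\<omega>. liminf (\<lambda>n. ?f n \<omega>) \<partial>M)"
    by (intro nn_integral_cong lim_imp_Liminf[symmetric]) auto
  also have "\<dots> \<le> liminf (\<lambda>n. \<integral>\<^sup>+\<omega>. ?f n \<omega> \<partial>M)"
    by (rule nn_integral_liminf) measurable
  also have "\<dots> \<le> liminf (\<lambda>n::nat. 1 :: ennreal)"
  proof (intro Liminf_mono always_eventually allI)
    fix n
    let ?t = "1 / real (Suc n)"
    have int: "integrable M (\<lambda>\<omega>. real (Suc n) * (1 - exp (- (?t * X \<omega>))))"
      by (intro integrable_mult_right Bochner_Integration.integrable_diff integrable_exp) auto
    have "(\<integral>\<^sup>+\<omega>. ?f n \<omega> \<partial>M) = ennreal (real (Suc n) * (1 - 1 / (1 + ?t)))"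
    proof (subst nn_integral_eq_integral[OF int])
      show "AE \<omega> in M. 0 \<le> real (Suc n) * (1 - exp (- (?t * X \<omega>)))"
        by (intro AE_I2 mult_nonneg_nonneg) (auto simp: X_nonneg)
      have "expectation (\<lambda>\<omega>. real (Suc n) * (1 - exp (- (?t * X \<omega>)))) = real (Suc n) * (1 - expectation (\<lambda>\<omega>. exp (- (?t * X \<omega>))))"
        by (simp only: integral_mult_right_zero, subst Bochner_Integration.integral_diff) (auto intro!: integrable_exp[of "1 / real (Suc n)", simplified] simp: prob_space)
      then show "ennreal (expectation (\<lambda>\<omega>. real (Suc n) * (1 - exp (- (?t * X \<omega>))))) = ennreal (real (Suc n) * (1 - 1 / (1 + ?t)))"
        using laplace[of ?t] by simp
    qed
    also have "\<dots> \<le> ennreal 1"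
      by (intro ennreal_leI) (simp add: field_simps)
    finally show "(\<integral>\<^sup>+\<omega>. ?f n \<omega> \<partial>M) \<le> 1"
      by simp
  qed
  also have "\<dots> = 1" by (rule Liminf_const) simp
  finally show ?thesis by simp
qed

text \<open>The Euler integral writes \<open>Gamma (1/2)\<close> times the inverse root as an
  integral of exponentials, so the Laplace transform applies; the resulting integral of 1 / (sqrt t
  (1 + t)) is treated by Euler integrals again in \<open>swap\<close>. It controls the logarithm for
  small \<open>X\<close>.\<close>

lemma nn_integral_inverse_sqrt: "(\<integral>\<^sup>+\<omega>. ennreal (X \<omega> powr (- 1/2)) \<partial>M) = ennreal (Gamma (1/2))"
proof -
  have G: "0 < Gamma (1/2 :: real)" by (rule Gamma_real_pos) simp
  have swap: "(\<integral>\<^sup>+t. indicator {0<..} t * (ennreal (t powr (1/2 - 1)) * ennreal (1 / (1 + t))) \<partial>lborel) = ennreal (Gamma (1/2) * Gamma (1/2))"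
  proof -
    let ?I = "\<lambda>t x. indicator {0<..} t * (ennreal (t powr (1/2 - 1)) * (indicator {0<..} x * ennreal (x powr (1 - 1) * exp (- ((1 + t) * x)))))"
    have "(\<integral>\<^sup>+t. indicator {0<..} t * (ennreal (t powr (1/2 - 1)) * ennreal (1 / (1 + t))) \<partial>lborel)
        = (\<integral>\<^sup>+t. (\<integral>\<^sup>+x. ?I t x \<partial>lborel) \<partial>lborel)"
    proof (rule nn_integral_cong)
      fix t :: real
      show "indicator {0<..} t * (ennreal (t powr (1/2 - 1)) * ennreal (1 / (1 + t))) = (\<integral>\<^sup>+x. ?I t x \<partial>lborel)"
      proof (cases "0 < t")
        case True
        have "(\<integral>\<^sup>+x. ?I t x \<partial>lborel) = (\<integral>\<^sup>+x. ennreal (t powr (1/2 - 1)) * (indicator {0<..} x * ennreal (x powr (1 - 1) * exp (- ((1 + t) * x)))) \<partial>lborel)"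
          using True by simp
        also have "\<dots> = ennreal (t powr (1/2 - 1)) * ennreal (Gamma 1 / (1 + t) powr 1)"
          using True by (subst nn_integral_cmult, measurable) (subst nn_integral_Gamma_open, auto)
        finally show ?thesis using True by simp
      qed simp
    qed
    also have "\<dots> = (\<integral>\<^sup>+x. (\<integral>\<^sup>+t. ?I t x \<partial>lborel) \<partial>lborel)"
      by (rule lborel_pair.Fubini') measurable
    also have "\<dots> = (\<integral>\<^sup>+x. ennreal (Gamma (1/2)) * (indicator {0<..} x * ennreal (x powr (1/2 - 1) * exp (- (1 * x)))) \<partial>lborel)"
    proof (rule nn_integral_cong)
      fix x :: real
      show "(\<integral>\<^sup>+t. ?I t x \<partial>lborel) = ennreal (Gamma (1/2)) * (indicator {0<..} x * ennreal (x powr (1/2 - 1) * exp (- (1 * x))))"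
      proof (cases "0 < x")
        case True
        have "(\<integral>\<^sup>+t. ?I t x \<partial>lborel) = (\<integral>\<^sup>+t. ennreal (exp (- x)) * (indicator {0<..} t * ennreal (t powr (1/2 - 1) * exp (- (x * t)))) \<partial>lborel)"
        proof (rule nn_integral_cong)
          fix t :: real
          have "exp (- ((1 + t) * x)) = exp (- x) * exp (- (x * t))"
            by (simp add: algebra_simps flip: exp_add)
          then show "?I t x = ennreal (exp (- x)) * (indicator {0<..} t * ennreal (t powr (1/2 - 1) * exp (- (x * t))))"
            using True by (cases "0 < t") (simp_all add: ennreal_mult mult_ac)
        qed
        also have "\<dots> = ennreal (exp (- x)) * ennreal (Gamma (1/2) / x powr (1/2))"
          using True by (subst nn_integral_cmult, measurable) (subst nn_integral_Gamma_open, auto)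
        also have "\<dots> = ennreal (Gamma (1/2)) * ennreal (x powr (1/2 - 1) * exp (- (1 * x)))"
        proof -
          have e: "1/2 - 1 = - (1/2 :: real)" by simp
          have "Gamma (1/2) * (1 / x powr (1/2) * exp (- (1 * x))) = exp (- x) * (Gamma (1/2) / x powr (1/2))"
            by simp
          then show ?thesis
            unfolding e powr_minus_divide using G by (simp only: ennreal_mult'[symmetric] exp_ge_zero less_imp_le)
        qed
        finally show ?thesis using True by simp
      qed simp
    qed
    also have "\<dots> = ennreal (Gamma (1/2)) * ennreal (Gamma (1/2) / 1 powr (1/2))"
      by (subst nn_integral_cmult, measurable) (subst nn_integral_Gamma_open, auto)
    finally show ?thesis using G by (simp add: ennreal_mult'[symmetric])
  qed
  have "ennreal (Gamma (1/2)) * (\<integral>\<^sup>+\<omega>. ennreal (X \<omega> powr (- 1/2)) \<partial>M)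
     = (\<integral>\<^sup>+\<omega>. ennreal (Gamma (1/2)) * ennreal (X \<omega> powr (- 1/2)) \<partial>M)"
    by (rule nn_integral_cmult[symmetric]) measurable
  also have "\<dots> = (\<integral>\<^sup>+\<omega>. (\<integral>\<^sup>+t. indicator {0<..} t * ennreal (t powr (1/2 - 1) * exp (- (X \<omega> * t))) \<partial>lborel) \<partial>M)"
  proof (rule nn_integral_cong_AE, use AE_pos in eventually_elim)
    fix \<omega> assume "0 < X \<omega>"
    note pos = this
    have p: "X \<omega> powr (- 1/2) = 1 / X \<omega> powr (1/2)"
      using powr_minus_divide[of "X \<omega>" "1/2"] by simp
    have "(\<integral>\<^sup>+t. indicator {0<..} t * ennreal (t powr (1/2 - 1) * exp (- (X \<omega> * t))) \<partial>lborel) = ennreal (Gamma (1/2) / X \<omega> powr (1/2))"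
      using pos by (intro nn_integral_Gamma_open) auto
    also have "\<dots> = ennreal (Gamma (1/2)) * ennreal (X \<omega> powr (- 1/2))"
      unfolding p using G by (subst ennreal_mult'[symmetric]) simp_all
    finally show "ennreal (Gamma (1/2)) * ennreal (X \<omega> powr (- 1/2)) = (\<integral>\<^sup>+t. indicator {0<..} t * ennreal (t powr (1/2 - 1) * exp (- (X \<omega> * t))) \<partial>lborel)" ..
  qed
  also have "\<dots> = (\<integral>\<^sup>+t. (\<integral>\<^sup>+\<omega>. indicator {0<..} t * ennreal (t powr (1/2 - 1) * exp (- (X \<omega> * t))) \<partial>M) \<partial>lborel)"
  proof -
    interpret pair_sigma_finite M "lborel :: real measure" ..
    show ?thesis by (rule Fubini'[symmetric]) measurable
  qed
  also have "\<dots> = (\<integral>\<^sup>+t. indicator {0<..} t * (ennreal (t powr (1/2 - 1)) * ennreal (1 / (1 + t))) \<partial>lborel)"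
  proof (rule nn_integral_cong)
    fix t :: real
    show "(\<integral>\<^sup>+\<omega>. indicator {0<..} t * ennreal (t powr (1/2 - 1) * exp (- (X \<omega> * t))) \<partial>M)
       = indicator {0<..} t * (ennreal (t powr (1/2 - 1)) * ennreal (1 / (1 + t)))"
    proof (cases "0 < t")
      case True
      have "(\<integral>\<^sup>+\<omega>. indicator {0<..} t * ennreal (t powr (1/2 - 1) * exp (- (X \<omega> * t))) \<partial>M)
         = (\<integral>\<^sup>+\<omega>. ennreal (t powr (1/2 - 1)) * ennreal (exp (- (t * X \<omega>))) \<partial>M)"
        using True by (simp add: ennreal_mult mult.commute)
      also have "\<dots> = ennreal (t powr (1/2 - 1)) * (\<integral>\<^sup>+\<omega>. ennreal (exp (- (t * X \<omega>))) \<partial>M)"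
        by (rule nn_integral_cmult) measurable
      finally show ?thesis using True nn_laplace[of t] by simp
    qed simp
  qed
  also have "\<dots> = ennreal (Gamma (1/2)) * ennreal (Gamma (1/2))"
    unfolding swap using G by (simp add: ennreal_mult')
  finally show ?thesis using G by (simp add: ennreal_mult_cancel_left)
qed

lemma nn_integral_ln_squared: "(\<integral>\<^sup>+\<omega>. ennreal ((ln (X \<omega>))\<^sup>2) \<partial>M) \<le> ennreal (4 + 16 * Gamma (1/2))"
proof -
  have bound: "(ln x)\<^sup>2 \<le> 4 * x + 16 * x powr (- 1/2)" if x: "0 < x" for x :: real
  proof (cases "1 \<le> x")
    case True
    \<comment> \<open>The square root is taken so that the square of the bound is linear in
      \<open>x\<close>: the constant 4 is 2 squared.\<close>
    have "ln x = 2 * ln (x powr (1/2))" using x by (simp add: ln_powr)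
    also have "\<dots> \<le> 2 * x powr (1/2)"
      using x ln_le_minus_one[of "x powr (1/2)"] by simp
    finally have "(ln x)\<^sup>2 \<le> (2 * x powr (1/2))\<^sup>2"
      using True by (intro power_mono) auto
    also have "\<dots> = 4 * x" using x by (simp add: power_mult_distrib power2_eq_square flip: powr_add)
    finally show ?thesis using x by (simp add: add_increasing2)
  next
    case False
    \<comment> \<open>The fourth root is taken so that the square of the bound is
      \<open>x powr (- 1/2)\<close>: the constant 16 is 4 squared.\<close>
    have "- ln x = 4 * ln (x powr (- 1/4))" using x by (simp add: ln_powr)
    also have "\<dots> \<le> 4 * x powr (- 1/4)"
      using x ln_le_minus_one[of "x powr (- 1/4)"] by simp
    finally have "(- ln x)\<^sup>2 \<le> (4 * x powr (- 1/4))\<^sup>2"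
      using False x by (intro power_mono) auto
    also have "\<dots> = 16 * x powr (- 1/2)" using x by (simp add: power_mult_distrib power2_eq_square flip: powr_add)
    finally show ?thesis using x by (simp add: add_increasing)
  qed
  have G: "0 < Gamma (1/2 :: real)" by (rule Gamma_real_pos) simp
  have "(\<integral>\<^sup>+\<omega>. ennreal ((ln (X \<omega>))\<^sup>2) \<partial>M) \<le> (\<integral>\<^sup>+\<omega>. 4 * ennreal (X \<omega>) + 16 * ennreal (X \<omega> powr (- 1/2)) \<partial>M)"
  proof (rule nn_integral_mono_AE, use AE_pos in eventually_elim)
    fix \<omega> assume "0 < X \<omega>"
    then have "ennreal ((ln (X \<omega>))\<^sup>2) \<le> ennreal (4 * X \<omega> + 16 * X \<omega> powr (- 1/2))"
      by (intro ennreal_leI bound)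
    then show "ennreal ((ln (X \<omega>))\<^sup>2) \<le> 4 * ennreal (X \<omega>) + 16 * ennreal (X \<omega> powr (- 1/2))"
      using X_nonneg[of \<omega>] by (simp add: ennreal_plus ennreal_mult)
  qed
  also have "\<dots> = 4 * (\<integral>\<^sup>+\<omega>. ennreal (X \<omega>) \<partial>M) + 16 * (\<integral>\<^sup>+\<omega>. ennreal (X \<omega> powr (- 1/2)) \<partial>M)"
    by (subst nn_integral_add) (auto simp: nn_integral_cmult)
  also have "\<dots> \<le> 4 * 1 + 16 * ennreal (Gamma (1/2))"
    unfolding nn_integral_inverse_sqrt by (intro add_mono mult_left_mono nn_integral_X_le) auto
  also have "\<dots> = ennreal (4 + 16 * Gamma (1/2))"
    using G by (simp add: ennreal_plus ennreal_mult)
  finally show ?thesis .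
qed

lemma integrable_ln_squared: "integrable M (\<lambda>\<omega>. (ln (X \<omega>))\<^sup>2)"
  using nn_integral_ln_squared by (intro integrableI_bounded) (auto intro: le_less_trans)

lemma integrable_ln: "integrable M (\<lambda>\<omega>. ln (X \<omega>))"
  by (rule square_integrable_imp_integrable[OF _ integrable_ln_squared]) measurable

end

text \<open>The joint transform is that of the squared moduli of two standard complex Gaussians,
  with \<open>q\<close> the squared modulus of their correlation. Setting one argument to 0 recovers
  both exponential marginals.\<close>

locale exponential_pair = prob_space M for M :: "'w measure" +
  fixes X Y :: "'w \<Rightarrow> real" and q :: real
  assumes measurable_pair [measurable]: "X \<in> borel_measurable M" "Y \<in> borel_measurable M"
    and pair_nonneg: "0 \<le> X \<omega>" "0 \<le> Y \<omega>"
    and q: "0 \<le> q" "q \<le> 1"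
    and laplace_pair: "0 \<le> t \<Longrightarrow> 0 \<le> s \<Longrightarrow>
      expectation (\<lambda>\<omega>. exp (- (t * X \<omega>)) * exp (- (s * Y \<omega>))) = 1 / ((1 + t) * (1 + s) - t * s * q)"
begin

sublocale X: exponential_variable M X
  using laplace_pair[of _ 0] by unfold_locales (auto simp: pair_nonneg)

sublocale Y: exponential_variable M Y
  using laplace_pair[of 0] by unfold_locales (auto simp: pair_nonneg)

lemma exponential_variable_fst: "exponential_variable M X"
  by (rule X.exponential_variable_axioms)

lemma integrable_ln_mult: "integrable M (\<lambda>\<omega>. ln (X \<omega>) * ln (Y \<omega>))"
proof (rule Bochner_Integration.integrable_bound[OF Bochner_Integration.integrable_add[OF X.integrable_ln_squared Y.integrable_ln_squared]])
  have "\<bar>x * y\<bar> \<le> x\<^sup>2 + y\<^sup>2" for x y :: real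
  proof -
    have "0 \<le> (\<bar>x\<bar> - \<bar>y\<bar>)\<^sup>2" by simp
    then have "2 * (\<bar>x\<bar> * \<bar>y\<bar>) \<le> x\<^sup>2 + y\<^sup>2" by (simp add: power2_diff)
    moreover have "0 \<le> \<bar>x\<bar> * \<bar>y\<bar>" by simp
    ultimately show ?thesis unfolding abs_mult by linarith
  qed
  then show "AE \<omega> in M. norm (ln (X \<omega>) * ln (Y \<omega>)) \<le> norm ((ln (X \<omega>))\<^sup>2 + (ln (Y \<omega>))\<^sup>2)"
    by (intro AE_I2) auto
qed measurable

text \<open>Each logarithm is replaced by its Frullani integral. Absolute integrability on the
  probability space times the plane allows the expectation to be taken first, where the joint
  Laplace transform is known.\<close>

lemma covariance_ln:
  "expectation (\<lambda>\<omega>. ln (X \<omega>) * ln (Y \<omega>)) - expectation (\<lambda>\<omega>. ln (X \<omega>)) * expectation (\<lambda>\<omega>. ln (Y \<omega>)) = dilog q"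
proof -
  interpret P1: pair_sigma_finite M "lborel :: real measure" ..
  interpret P2: pair_sigma_finite M "lborel \<Otimes>\<^sub>M lborel :: (real \<times> real) measure" ..
  let ?fr = frullani
  have single: "expectation (\<lambda>\<omega>. ln (Z \<omega>)) = (\<integral>t. expectation (\<lambda>\<omega>. ?fr (Z \<omega>) t) \<partial>lborel)"
    "integrable lborel (\<lambda>t. expectation (\<lambda>\<omega>. ?fr (Z \<omega>) t))"
    if "exponential_variable M Z" for Z
  proof -
    interpret Z: exponential_variable M Z by fact
    have int: "integrable (M \<Otimes>\<^sub>M lborel) (\<lambda>(\<omega>, t). ?fr (Z \<omega>) t)"
    proof (rule integrableI_bounded)
      have "(\<integral>\<^sup>+p. ennreal (norm (case p of (\<omega>, t) \<Rightarrow> ?fr (Z \<omega>) t)) \<partial>(M \<Otimes>\<^sub>M lborel))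
         = (\<integral>\<^sup>+\<omega>. (\<integral>\<^sup>+t. ennreal \<bar>?fr (Z \<omega>) t\<bar> \<partial>lborel) \<partial>M)"
        by (subst lborel.nn_integral_fst[symmetric]) auto
      also have "\<dots> = (\<integral>\<^sup>+\<omega>. ennreal \<bar>ln (Z \<omega>)\<bar> \<partial>M)"
        by (rule nn_integral_cong_AE, use Z.AE_pos in eventually_elim) (rule nn_integral_frullani)
      also have "\<dots> < \<infinity>"
        using Z.integrable_ln by (simp add: integrable_iff_bounded)
      finally show "(\<integral>\<^sup>+p. ennreal (norm (case p of (\<omega>, t) \<Rightarrow> ?fr (Z \<omega>) t)) \<partial>(M \<Otimes>\<^sub>M lborel)) < \<infinity>" .
    qed measurable
    have "expectation (\<lambda>\<omega>. ln (Z \<omega>)) = expectation (\<lambda>\<omega>. \<integral>t. ?fr (Z \<omega>) t \<partial>lborel)"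
    proof (rule integral_cong_AE)
      show "AE \<omega> in M. ln (Z \<omega>) = (\<integral>t. ?fr (Z \<omega>) t \<partial>lborel)"
        using Z.AE_pos by eventually_elim (simp add: integral_frullani)
    qed measurable
    also have "\<dots> = (\<integral>t. expectation (\<lambda>\<omega>. ?fr (Z \<omega>) t) \<partial>lborel)"
      by (rule P1.Fubini_integral[OF int, symmetric])
    finally show "expectation (\<lambda>\<omega>. ln (Z \<omega>)) = (\<integral>t. expectation (\<lambda>\<omega>. ?fr (Z \<omega>) t) \<partial>lborel)" .
    show "integrable lborel (\<lambda>t. expectation (\<lambda>\<omega>. ?fr (Z \<omega>) t))"
      by (rule P1.integrable_snd[OF int])
  qed
  note sX = single[OF X.exponential_variable_axioms] and sY = single[OF Y.exponential_variable_axioms]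
  let ?GG = "\<lambda>\<omega> p. ?fr (X \<omega>) (fst p) * ?fr (Y \<omega>) (snd p)"
  have prod_nn: "(\<integral>\<^sup>+p. ennreal \<bar>?GG \<omega> p\<bar> \<partial>(lborel \<Otimes>\<^sub>M lborel)) = ennreal \<bar>ln (X \<omega>) * ln (Y \<omega>)\<bar>"
    and prod_int: "(\<integral>p. ?GG \<omega> p \<partial>(lborel \<Otimes>\<^sub>M lborel)) = ln (X \<omega>) * ln (Y \<omega>)"
    if pos: "0 < X \<omega>" "0 < Y \<omega>" for \<omega>
  proof -
    have "(\<integral>\<^sup>+p. ennreal \<bar>?GG \<omega> p\<bar> \<partial>(lborel \<Otimes>\<^sub>M lborel))
       = (\<integral>\<^sup>+t. (\<integral>\<^sup>+s. ennreal \<bar>?fr (X \<omega>) t\<bar> * ennreal \<bar>?fr (Y \<omega>) s\<bar> \<partial>lborel) \<partial>lborel)"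
      by (subst lborel.nn_integral_fst[symmetric]) (auto simp: abs_mult ennreal_mult)
    also have "\<dots> = (\<integral>\<^sup>+t. ennreal \<bar>?fr (X \<omega>) t\<bar> * ennreal \<bar>ln (Y \<omega>)\<bar> \<partial>lborel)"
      by (subst nn_integral_cmult, measurable) (simp only: nn_integral_frullani[OF pos(2)])
    also have "\<dots> = ennreal \<bar>ln (X \<omega>)\<bar> * ennreal \<bar>ln (Y \<omega>)\<bar>"
      by (subst nn_integral_multc, measurable) (simp only: nn_integral_frullani[OF pos(1)])
    finally show "(\<integral>\<^sup>+p. ennreal \<bar>?GG \<omega> p\<bar> \<partial>(lborel \<Otimes>\<^sub>M lborel)) = ennreal \<bar>ln (X \<omega>) * ln (Y \<omega>)\<bar>"
      by (simp add: abs_mult ennreal_mult)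
    then have int: "integrable (lborel \<Otimes>\<^sub>M lborel) (\<lambda>(t, s). ?fr (X \<omega>) t * ?fr (Y \<omega>) s)"
      by (intro integrableI_bounded) (auto simp: split_beta)
    have "(\<integral>p. ?GG \<omega> p \<partial>(lborel \<Otimes>\<^sub>M lborel)) = (\<integral>t. (\<integral>s. ?fr (X \<omega>) t * ?fr (Y \<omega>) s \<partial>lborel) \<partial>lborel)"
      using lborel_pair.integral_fst'[OF int] unfolding split_beta fst_conv snd_conv by (rule sym)
    also have "\<dots> = ln (X \<omega>) * ln (Y \<omega>)"
      by (simp add: integral_frullani(2)[OF pos(1)] integral_frullani(2)[OF pos(2)])
    finally show "(\<integral>p. ?GG \<omega> p \<partial>(lborel \<Otimes>\<^sub>M lborel)) = ln (X \<omega>) * ln (Y \<omega>)" .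
  qed
  have pos: "AE \<omega> in M. 0 < X \<omega> \<and> 0 < Y \<omega>"
    using X.AE_pos Y.AE_pos by eventually_elim simp
  \<comment> \<open>Tonelli's theorem turns the absolute integral into the expectation of the
    modulus of the product of logarithms, finite by the bounds on their squares.\<close>
  have int3: "integrable (M \<Otimes>\<^sub>M (lborel \<Otimes>\<^sub>M lborel)) (\<lambda>(\<omega>, p). ?GG \<omega> p)"
  proof (rule integrableI_bounded)
    have "(\<integral>\<^sup>+x. ennreal (norm (case x of (\<omega>, p) \<Rightarrow> ?GG \<omega> p)) \<partial>(M \<Otimes>\<^sub>M (lborel \<Otimes>\<^sub>M lborel)))
       = (\<integral>\<^sup>+\<omega>. (\<integral>\<^sup>+p. ennreal \<bar>?GG \<omega> p\<bar> \<partial>(lborel \<Otimes>\<^sub>M lborel)) \<partial>M)"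
      by (subst lborel_pair.P.nn_integral_fst[symmetric]) auto
    also have "\<dots> = (\<integral>\<^sup>+\<omega>. ennreal \<bar>ln (X \<omega>) * ln (Y \<omega>)\<bar> \<partial>M)"
      by (rule nn_integral_cong_AE, use pos in eventually_elim) (blast intro: prod_nn)
    also have "\<dots> < \<infinity>"
      using integrable_ln_mult by (simp add: integrable_iff_bounded)
    finally show "(\<integral>\<^sup>+x. ennreal (norm (case x of (\<omega>, p) \<Rightarrow> ?GG \<omega> p)) \<partial>(M \<Otimes>\<^sub>M (lborel \<Otimes>\<^sub>M lborel))) < \<infinity>" .
  qed measurable
  have EXY: "expectation (\<lambda>\<omega>. ln (X \<omega>) * ln (Y \<omega>)) = (\<integral>p. expectation (\<lambda>\<omega>. ?GG \<omega> p) \<partial>(lborel \<Otimes>\<^sub>M lborel))"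
  proof -
    have "expectation (\<lambda>\<omega>. ln (X \<omega>) * ln (Y \<omega>)) = expectation (\<lambda>\<omega>. \<integral>p. ?GG \<omega> p \<partial>(lborel \<Otimes>\<^sub>M lborel))"
    proof (rule integral_cong_AE)
      show "AE \<omega> in M. ln (X \<omega>) * ln (Y \<omega>) = (\<integral>p. ?GG \<omega> p \<partial>(lborel \<Otimes>\<^sub>M lborel))"
        using pos by eventually_elim (metis prod_int)
    qed measurable
    also have "\<dots> = (\<integral>p. expectation (\<lambda>\<omega>. ?GG \<omega> p) \<partial>(lborel \<Otimes>\<^sub>M lborel))"
      by (rule P2.Fubini_integral[OF int3, symmetric])
    finally show ?thesis .
  qed
  let ?eX = "\<lambda>t. expectation (\<lambda>\<omega>. ?fr (X \<omega>) t)" and ?eY = "\<lambda>t. expectation (\<lambda>\<omega>. ?fr (Y \<omega>) t)"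
  have int_prod: "integrable (lborel \<Otimes>\<^sub>M lborel) (\<lambda>(t, s). ?eX t * ?eY s)"
    by (rule lborel_pair.integrable_mult_prod) (use sX sY in auto)
  have EXEY: "expectation (\<lambda>\<omega>. ln (X \<omega>)) * expectation (\<lambda>\<omega>. ln (Y \<omega>)) = (\<integral>p. ?eX (fst p) * ?eY (snd p) \<partial>(lborel \<Otimes>\<^sub>M lborel))"
  proof -
    have "(\<integral>p. ?eX (fst p) * ?eY (snd p) \<partial>(lborel \<Otimes>\<^sub>M lborel)) = (\<integral>t. (\<integral>s. ?eX t * ?eY s \<partial>lborel) \<partial>lborel)"
      using lborel_pair.integral_fst'[OF int_prod] unfolding split_beta fst_conv snd_conv by (rule sym)
    then show ?thesis by (simp add: sX(1) sY(1))
  qed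
  \<comment> \<open>The terms containing \<open>exp (- t)\<close> or \<open>exp (- s)\<close> cancel
    in the covariance; the joint transform minus the product of the marginal ones remains.\<close>
  let ?d = "\<lambda>p. case p of (t, s) \<Rightarrow> indicat_real {0<..} t * indicat_real {0<..} s *
       ((1 / ((1 + t) * (1 + s) - t * s * q) - 1 / (1 + t) * (1 / (1 + s))) / (t * s))"
  have d: "expectation (\<lambda>\<omega>. ?GG \<omega> p) - ?eX (fst p) * ?eY (snd p) = ?d p" for p
  proof -
    obtain t s where p: "p = (t, s)" by (cases p)
    show ?thesis
    proof (cases "0 < t \<and> 0 < s")
      case True
      then have t: "0 < t" and s: "0 < s" by auto
      have eX: "?eX t = (exp (- t) - 1 / (1 + t)) / t" and eY: "?eY s = (exp (- s) - 1 / (1 + s)) / s"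
        using t s X.integrable_exp[of t] Y.integrable_exp[of s] X.laplace[of t] Y.laplace[of s]
        by (simp_all add: frullani_def prob_space)
      have i2: "integrable M (\<lambda>\<omega>. exp (- (t * X \<omega>)) * exp (- (s * Y \<omega>)))"
        using t s by (intro integrable_const_bound[where B=1]) (auto simp: pair_nonneg mult_le_one)
      have "?GG \<omega> (t, s) = (exp (- t) * exp (- s) - exp (- s) * exp (- (t * X \<omega>)) - exp (- t) * exp (- (s * Y \<omega>))
         + exp (- (t * X \<omega>)) * exp (- (s * Y \<omega>))) / (t * s)" for \<omega>
        using t s by (simp add: frullani_def algebra_simps)
      then have "expectation (\<lambda>\<omega>. ?GG \<omega> (t, s)) = (exp (- t) * exp (- s) - exp (- s) * (1 / (1 + t)) - exp (- t) * (1 / (1 + s))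
         + 1 / ((1 + t) * (1 + s) - t * s * q)) / (t * s)"
        using t s X.integrable_exp[of t] Y.integrable_exp[of s] X.laplace[of t] Y.laplace[of s] i2 laplace_pair[of t s]
        by (simp add: prob_space)
      then have "expectation (\<lambda>\<omega>. ?GG \<omega> (t, s)) - ?eX t * ?eY s
         = (exp (- t) * exp (- s) - exp (- s) * (1 / (1 + t)) - exp (- t) * (1 / (1 + s))
         + 1 / ((1 + t) * (1 + s) - t * s * q)) / (t * s) - (exp (- t) - 1 / (1 + t)) * (exp (- s) - 1 / (1 + s)) / (t * s)"
        unfolding eX eY by simp
      also have "\<dots> = (1 / ((1 + t) * (1 + s) - t * s * q) - 1 / (1 + t) * (1 / (1 + s))) / (t * s)"
        unfolding diff_divide_distrib[symmetric] by (simp add: algebra_simps)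
      finally show ?thesis using t s p by simp
    next
      case False
      then show ?thesis by (auto simp: p frullani_def)
    qed
  qed
  \<comment> \<open>Nonnegativity, read off the series expansion, allows the signed integral to be
    evaluated by \<open>nn_integral_log_kernel\<close>.\<close>
  have d0: "0 \<le> ?d p" for p
  proof -
    obtain t s where p: "p = (t, s)" by (cases p)
    show ?thesis
    proof (cases "0 < t \<and> 0 < s")
      case True
      have "0 \<le> (\<Sum>k. q ^ Suc k * ((t ^ k / (1 + t) ^ (k + 2)) * (s ^ k / (1 + s) ^ (k + 2))))"
        using True q by (intro suminf_nonneg sums_summable[OF log_kernel_expansion]) auto
      also have "\<dots> = (1 / ((1 + t) * (1 + s) - t * s * q) - 1 / (1 + t) * (1 / (1 + s))) / (t * s)"
        using True q by (intro sums_unique[symmetric] log_kernel_expansion) auto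
      finally show ?thesis using True p by simp
    qed (auto simp: p)
  qed
  have "expectation (\<lambda>\<omega>. ln (X \<omega>) * ln (Y \<omega>)) - expectation (\<lambda>\<omega>. ln (X \<omega>)) * expectation (\<lambda>\<omega>. ln (Y \<omega>))
     = (\<integral>p. expectation (\<lambda>\<omega>. ?GG \<omega> p) - ?eX (fst p) * ?eY (snd p) \<partial>(lborel \<Otimes>\<^sub>M lborel))"
    unfolding EXY EXEY using P2.integrable_snd[OF int3] int_prod
    by (intro Bochner_Integration.integral_diff[symmetric]) (auto simp: case_prod_unfold)
  also have "\<dots> = (\<integral>p. ?d p \<partial>(lborel \<Otimes>\<^sub>M lborel))"
    unfolding d ..
  also have "\<dots> = enn2real (\<integral>\<^sup>+p. ennreal (?d p) \<partial>(lborel \<Otimes>\<^sub>M lborel))"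
    by (rule integral_eq_nn_integral) (measurable, rule AE_I2, rule d0)
  also have "(\<integral>\<^sup>+p. ennreal (?d p) \<partial>(lborel \<Otimes>\<^sub>M lborel)) = ennreal (dilog q)"
    unfolding nn_integral_log_kernel[OF q, symmetric]
    by (intro nn_integral_cong) (auto simp: indicator_def)
  also have "enn2real (ennreal (dilog q)) = dilog q"
    using q unfolding dilog_def by (intro enn2real_ennreal suminf_nonneg summable_dilog) auto
  finally show ?thesis .
qed

end

section \<open>The variance of a random integral\<close>

text \<open>The bound \<open>b z * b w\<close> on mixed absolute moments is what Fubini needs. The
  square of the random integral is treated as \<open>V \<omega> z * I \<omega>\<close> integrated
  over \<open>z\<close>, so every exchange takes place on the product of \<open>M\<close> with one
  copy of \<open>N\<close>.\<close>

lemma (in prob_space) variance_random_integral: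
  fixes V :: "'a \<Rightarrow> 'b \<Rightarrow> real" and b :: "'b \<Rightarrow> real"
  assumes N: "sigma_finite_measure N"
    and V [measurable]: "(\<lambda>(\<omega>, z). V \<omega> z) \<in> borel_measurable (M \<Otimes>\<^sub>M N)"
    and b: "integrable N b" "\<And>z. z \<in> space N \<Longrightarrow> 0 \<le> b z"
    and V1: "\<And>z. z \<in> space N \<Longrightarrow> (\<integral>\<^sup>+\<omega>. ennreal \<bar>V \<omega> z\<bar> \<partial>M) \<le> ennreal (b z)"
    and V2: "\<And>z w. z \<in> space N \<Longrightarrow> w \<in> space N \<Longrightarrow> (\<integral>\<^sup>+\<omega>. ennreal \<bar>V \<omega> z * V \<omega> w\<bar> \<partial>M) \<le> ennreal (b z * b w)"
  shows "variance (\<lambda>\<omega>. \<integral>z. V \<omega> z \<partial>N)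
     = (\<integral>z. (\<integral>w. expectation (\<lambda>\<omega>. V \<omega> z * V \<omega> w) - expectation (\<lambda>\<omega>. V \<omega> z) * expectation (\<lambda>\<omega>. V \<omega> w) \<partial>N) \<partial>N)"
proof -
  interpret N: sigma_finite_measure N by fact
  interpret MN: pair_sigma_finite M N ..
  define I where "I \<omega> = (\<integral>z. V \<omega> z \<partial>N)" for \<omega>
  have V_z [measurable]: "(\<lambda>\<omega>. V \<omega> z) \<in> borel_measurable M" if "z \<in> space N" for z
    using that by measurable
  have V_\<omega> [measurable]: "V \<omega> \<in> borel_measurable N" if "\<omega> \<in> space M" for \<omega>
    using that by measurable
  have I_meas [measurable]: "I \<in> borel_measurable M"
    unfolding I_def by measurable
  have b_fin: "(\<integral>\<^sup>+z. ennreal (b z) \<partial>N) < \<infinity>"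
    using b by (subst nn_integral_eq_integral) auto
  have int1: "integrable (M \<Otimes>\<^sub>M N) (\<lambda>(\<omega>, z). V \<omega> z)"
  proof (rule integrableI_bounded)
    have "(\<integral>\<^sup>+p. ennreal (norm (case p of (\<omega>, z) \<Rightarrow> V \<omega> z)) \<partial>(M \<Otimes>\<^sub>M N)) = (\<integral>\<^sup>+z. (\<integral>\<^sup>+\<omega>. ennreal \<bar>V \<omega> z\<bar> \<partial>M) \<partial>N)"
      by (subst MN.nn_integral_snd[symmetric]) auto
    also have "\<dots> \<le> (\<integral>\<^sup>+z. ennreal (b z) \<partial>N)"
      by (intro nn_integral_mono V1)
    finally show "(\<integral>\<^sup>+p. ennreal (norm (case p of (\<omega>, z) \<Rightarrow> V \<omega> z)) \<partial>(M \<Otimes>\<^sub>M N)) < \<infinity>"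
      using b_fin by (rule le_less_trans)
  qed measurable
  have int2: "integrable (M \<Otimes>\<^sub>M N) (\<lambda>(\<omega>, w). V \<omega> z * V \<omega> w)" if z: "z \<in> space N" for z
  proof (rule integrableI_bounded)
    have [measurable]: "(\<lambda>\<omega>. V \<omega> z) \<in> borel_measurable M" by (rule V_z[OF z])
    show "(\<lambda>(\<omega>, w). V \<omega> z * V \<omega> w) \<in> borel_measurable (M \<Otimes>\<^sub>M N)" by measurable
    have "(\<integral>\<^sup>+p. ennreal (norm (case p of (\<omega>, w) \<Rightarrow> V \<omega> z * V \<omega> w)) \<partial>(M \<Otimes>\<^sub>M N)) = (\<integral>\<^sup>+w. (\<integral>\<^sup>+\<omega>. ennreal \<bar>V \<omega> z * V \<omega> w\<bar> \<partial>M) \<partial>N)"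
      by (subst MN.nn_integral_snd[symmetric]) auto
    also have "\<dots> \<le> (\<integral>\<^sup>+w. ennreal (b z) * ennreal (b w) \<partial>N)"
      using V2[OF z] b(2) z by (intro nn_integral_mono) (simp add: ennreal_mult)
    also have "\<dots> = ennreal (b z) * (\<integral>\<^sup>+w. ennreal (b w) \<partial>N)"
      using b(1) by (intro nn_integral_cmult) auto
    finally show "(\<integral>\<^sup>+p. ennreal (norm (case p of (\<omega>, w) \<Rightarrow> V \<omega> z * V \<omega> w)) \<partial>(M \<Otimes>\<^sub>M N)) < \<infinity>"
      using b_fin by (auto intro: le_less_trans simp: ennreal_mult_less_top)
  qed
  \<comment> \<open>Besides the exchange of integrals, this yields integrability of
    \<open>(I \<omega>)\<^sup>2\<close>: integrating over \<open>z\<close> produces a second factor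
    \<open>I \<omega>\<close>.\<close>
  have int3: "integrable (M \<Otimes>\<^sub>M N) (\<lambda>(\<omega>, z). V \<omega> z * I \<omega>)"
  proof (rule integrableI_bounded)
    show "(\<lambda>(\<omega>, z). V \<omega> z * I \<omega>) \<in> borel_measurable (M \<Otimes>\<^sub>M N)" by measurable
    have "(\<integral>\<^sup>+p. ennreal (norm (case p of (\<omega>, z) \<Rightarrow> V \<omega> z * I \<omega>)) \<partial>(M \<Otimes>\<^sub>M N)) = (\<integral>\<^sup>+z. (\<integral>\<^sup>+\<omega>. ennreal \<bar>V \<omega> z * I \<omega>\<bar> \<partial>M) \<partial>N)"
      by (subst MN.nn_integral_snd[symmetric]) auto
    also have "\<dots> \<le> (\<integral>\<^sup>+z. ennreal (b z) * (\<integral>\<^sup>+w. ennreal (b w) \<partial>N) \<partial>N)"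
    proof (rule nn_integral_mono)
      fix z assume z: "z \<in> space N"
      have [measurable]: "(\<lambda>\<omega>. V \<omega> z) \<in> borel_measurable M" by (rule V_z[OF z])
      have "(\<integral>\<^sup>+\<omega>. ennreal \<bar>V \<omega> z * I \<omega>\<bar> \<partial>M) \<le> (\<integral>\<^sup>+\<omega>. (\<integral>\<^sup>+w. ennreal \<bar>V \<omega> z * V \<omega> w\<bar> \<partial>N) \<partial>M)"
      proof (rule nn_integral_mono)
        fix \<omega> assume w: "\<omega> \<in> space M"
        have [measurable]: "V \<omega> \<in> borel_measurable N" by (rule V_\<omega>[OF w])
        have "ennreal \<bar>V \<omega> z * I \<omega>\<bar> = ennreal \<bar>V \<omega> z\<bar> * ennreal \<bar>I \<omega>\<bar>"
          by (simp add: abs_mult ennreal_mult)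
        \<comment> \<open>Where \<open>V \<omega>\<close> is not integrable,
          \<open>I \<omega>\<close> is the default value 0 and the bound holds trivially.\<close>
        also have "ennreal \<bar>I \<omega>\<bar> \<le> (\<integral>\<^sup>+w. ennreal \<bar>V \<omega> w\<bar> \<partial>N)"
          unfolding I_def
          using integral_norm_bound_ennreal[of N "V \<omega>"] not_integrable_integral_eq[of N "V \<omega>"]
          by (cases "integrable N (V \<omega>)") auto
        also have "ennreal \<bar>V \<omega> z\<bar> * (\<integral>\<^sup>+w. ennreal \<bar>V \<omega> w\<bar> \<partial>N) = (\<integral>\<^sup>+w. ennreal \<bar>V \<omega> z * V \<omega> w\<bar> \<partial>N)"
          by (subst nn_integral_cmult[symmetric]) (auto simp: abs_mult ennreal_mult)
        finally show "ennreal \<bar>V \<omega> z * I \<omega>\<bar> \<le> (\<integral>\<^sup>+w. ennreal \<bar>V \<omega> z * V \<omega> w\<bar> \<partial>N)"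
          by (simp add: mult_left_mono)
      qed
      also have "\<dots> = (\<integral>\<^sup>+w. (\<integral>\<^sup>+\<omega>. ennreal \<bar>V \<omega> z * V \<omega> w\<bar> \<partial>M) \<partial>N)"
        by (rule MN.Fubini'[symmetric]) measurable
      also have "\<dots> \<le> (\<integral>\<^sup>+w. ennreal (b z) * ennreal (b w) \<partial>N)"
        using V2[OF z] b(2) z by (intro nn_integral_mono) (simp add: ennreal_mult)
      also have "\<dots> = ennreal (b z) * (\<integral>\<^sup>+w. ennreal (b w) \<partial>N)"
        using b(1) by (intro nn_integral_cmult) auto
      finally show "(\<integral>\<^sup>+\<omega>. ennreal \<bar>V \<omega> z * I \<omega>\<bar> \<partial>M) \<le> ennreal (b z) * (\<integral>\<^sup>+w. ennreal (b w) \<partial>N)" .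
    qed
    also have "\<dots> = (\<integral>\<^sup>+z. ennreal (b z) \<partial>N) * (\<integral>\<^sup>+w. ennreal (b w) \<partial>N)"
      using b(1) by (intro nn_integral_multc) auto
    also have "\<dots> < \<infinity>" using b_fin by (simp add: ennreal_mult_less_top)
    finally show "(\<integral>\<^sup>+p. ennreal (norm (case p of (\<omega>, z) \<Rightarrow> V \<omega> z * I \<omega>)) \<partial>(M \<Otimes>\<^sub>M N)) < \<infinity>" .
  qed
  have II: "(\<integral>z. V \<omega> z * I \<omega> \<partial>N) = (I \<omega>)\<^sup>2" for \<omega>
    by (simp add: I_def power2_eq_square)
  have I_int: "integrable M I" "integrable M (\<lambda>\<omega>. (I \<omega>)\<^sup>2)"
    using MN.integrable_fst[OF int1] MN.integrable_fst[OF int3] by (simp_all add: I_def[symmetric] power2_eq_square)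
  have EI: "expectation I = (\<integral>z. expectation (\<lambda>\<omega>. V \<omega> z) \<partial>N)"
    unfolding I_def by (rule MN.Fubini_integral[OF int1, symmetric])
  have EVI: "expectation (\<lambda>\<omega>. V \<omega> z * I \<omega>) = (\<integral>w. expectation (\<lambda>\<omega>. V \<omega> z * V \<omega> w) \<partial>N)" if z: "z \<in> space N" for z
  proof -
    have "expectation (\<lambda>\<omega>. V \<omega> z * I \<omega>) = expectation (\<lambda>\<omega>. \<integral>w. V \<omega> z * V \<omega> w \<partial>N)"
      unfolding I_def by simp
    also have "\<dots> = (\<integral>w. expectation (\<lambda>\<omega>. V \<omega> z * V \<omega> w) \<partial>N)"
      by (rule MN.Fubini_integral[OF int2[OF z], symmetric])
    finally show ?thesis .
  qed
  have "variance I = expectation (\<lambda>\<omega>. (I \<omega>)\<^sup>2) - (expectation I)\<^sup>2"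
    by (rule variance_eq[OF I_int])
  also have "expectation (\<lambda>\<omega>. (I \<omega>)\<^sup>2) = (\<integral>z. expectation (\<lambda>\<omega>. V \<omega> z * I \<omega>) \<partial>N)"
    unfolding II[symmetric] by (rule MN.Fubini_integral[OF int3, symmetric])
  also have "(expectation I)\<^sup>2 = (\<integral>z. expectation (\<lambda>\<omega>. V \<omega> z) * expectation I \<partial>N)"
    by (simp add: EI power2_eq_square)
  also have "(\<integral>z. expectation (\<lambda>\<omega>. V \<omega> z * I \<omega>) \<partial>N) - (\<integral>z. expectation (\<lambda>\<omega>. V \<omega> z) * expectation I \<partial>N)
     = (\<integral>z. expectation (\<lambda>\<omega>. V \<omega> z * I \<omega>) - expectation (\<lambda>\<omega>. V \<omega> z) * expectation I \<partial>N)"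
    using MN.integrable_snd[OF int3] MN.integrable_snd[OF int1]
    by (intro Bochner_Integration.integral_diff[symmetric] integrable_mult_left) auto
  also have "\<dots> = (\<integral>z. (\<integral>w. expectation (\<lambda>\<omega>. V \<omega> z * V \<omega> w) - expectation (\<lambda>\<omega>. V \<omega> z) * expectation (\<lambda>\<omega>. V \<omega> w) \<partial>N) \<partial>N)"
  proof (rule Bochner_Integration.integral_cong[OF refl])
    fix z assume z: "z \<in> space N"
    have "(\<integral>w. expectation (\<lambda>\<omega>. V \<omega> z * V \<omega> w) - expectation (\<lambda>\<omega>. V \<omega> z) * expectation (\<lambda>\<omega>. V \<omega> w) \<partial>N)
       = (\<integral>w. expectation (\<lambda>\<omega>. V \<omega> z * V \<omega> w) \<partial>N) - (\<integral>w. expectation (\<lambda>\<omega>. V \<omega> z) * expectation (\<lambda>\<omega>. V \<omega> w) \<partial>N)"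
      using MN.integrable_snd[OF int2[OF z]] MN.integrable_snd[OF int1]
      by (intro Bochner_Integration.integral_diff integrable_mult_right) auto
    then show "expectation (\<lambda>\<omega>. V \<omega> z * I \<omega>) - expectation (\<lambda>\<omega>. V \<omega> z) * expectation I
       = (\<integral>w. expectation (\<lambda>\<omega>. V \<omega> z * V \<omega> w) - expectation (\<lambda>\<omega>. V \<omega> z) * expectation (\<lambda>\<omega>. V \<omega> w) \<partial>N)"
      by (simp add: EVI[OF z] EI)
  qed
  finally show ?thesis unfolding I_def .
qed

section \<open>Smooth forms\<close>

lemma frechet_derivative_cong_open:
  assumes "open S" "x \<in> S" "\<And>y. y \<in> S \<Longrightarrow> f y = g y" "f differentiable (at x)"
  shows "frechet_derivative g (at x) = frechet_derivative f (at x)" "g differentiable (at x)"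
proof -
  have "(f has_derivative frechet_derivative f (at x)) (at x)"
    using assms(4) by (simp add: frechet_derivative_works)
  then have g: "(g has_derivative frechet_derivative f (at x)) (at x)"
    by (rule has_derivative_transform_within_open[OF _ assms(1,2)]) (rule assms(3))
  show "frechet_derivative g (at x) = frechet_derivative f (at x)"
    by (rule frechet_derivative_at[OF g, symmetric])
  show "g differentiable (at x)"
    using g by (auto simp: differentiable_def)
qed

lemma frechet_derivative_zero_open:
  assumes "open S" "x \<in> S" "\<And>y. y \<in> S \<Longrightarrow> f y = 0"
  shows "frechet_derivative f (at x) v = 0"
  using frechet_derivative_cong_open(1)[of S x "\<lambda>_. 0" f] assms by simp

text \<open>On an open set derivatives depend only on nearby values, so formulas for derivatives
  valid on \<open>S\<close> alone can be used in the recursion defining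
  \<open>Ck_on\<close>.\<close>

lemma Ck_on_cong:
  assumes "open S" "\<And>y. y \<in> S \<Longrightarrow> f y = g y" "Ck_on k S f"
  shows "Ck_on k S g"
  using assms(2,3)
proof (induction k arbitrary: f g)
  case 0
  then show ?case by (simp cong: continuous_on_cong)
next
  case (Suc k)
  have d: "frechet_derivative g (at x) = frechet_derivative f (at x)" "g differentiable (at x)" if "x \<in> S" for x
    using frechet_derivative_cong_open[OF assms(1) that, of f g] Suc.prems that by auto
  have "Ck_on k S (\<lambda>x. frechet_derivative g (at x) v)" for v
    by (rule Suc.IH[of "\<lambda>x. frechet_derivative f (at x) v"]) (use Suc.prems d in auto)
  with d(2) show ?case by simp
qed

lemma Ck_on_const: "Ck_on k S (\<lambda>_. c)"
  by (induction k arbitrary: c) auto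

lemma Ck_on_bounded_linear:
  assumes "open S" "bounded_linear T" "Ck_on k S f"
  shows "Ck_on k S (\<lambda>x. T (f x))"
  using assms(3)
proof (induction k arbitrary: f)
  case 0
  then show ?case by (simp add: bounded_linear.continuous_on[OF assms(2)])
next
  case (Suc k)
  have d: "((\<lambda>x. T (f x)) has_derivative (\<lambda>v. T (frechet_derivative f (at x) v))) (at x)" if "x \<in> S" for x
    using Suc.prems that by (intro bounded_linear.has_derivative[OF assms(2)]) (auto simp: frechet_derivative_works)
  have e: "frechet_derivative (\<lambda>x. T (f x)) (at x) = (\<lambda>v. T (frechet_derivative f (at x) v))" if "x \<in> S" for x
    by (rule frechet_derivative_at[OF d[OF that], symmetric])
  have "Ck_on k S (\<lambda>x. frechet_derivative (\<lambda>x. T (f x)) (at x) v)" for v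
    by (rule Ck_on_cong[OF assms(1) _ Suc.IH[of "\<lambda>x. frechet_derivative f (at x) v"]]) (use Suc.prems e in auto)
  moreover have "(\<lambda>x. T (f x)) differentiable (at x)" if "x \<in> S" for x
    using d[OF that] by (auto simp: differentiable_def)
  ultimately show ?case by simp
qed

lemma Ck_on_add:
  assumes "open S" "Ck_on k S f" "Ck_on k S g"
  shows "Ck_on k S (\<lambda>x. f x + g x)"
  using assms(2,3)
proof (induction k arbitrary: f g)
  case 0
  then show ?case by (simp add: continuous_on_add)
next
  case (Suc k)
  have d: "((\<lambda>x. f x + g x) has_derivative (\<lambda>v. frechet_derivative f (at x) v + frechet_derivative g (at x) v)) (at x)"
    if "x \<in> S" for x
    using Suc.prems that by (intro has_derivative_add) (auto simp: frechet_derivative_works)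
  have e: "frechet_derivative (\<lambda>x. f x + g x) (at x) = (\<lambda>v. frechet_derivative f (at x) v + frechet_derivative g (at x) v)"
    if "x \<in> S" for x
    by (rule frechet_derivative_at[OF d[OF that], symmetric])
  have "Ck_on k S (\<lambda>x. frechet_derivative (\<lambda>x. f x + g x) (at x) v)" for v
    by (rule Ck_on_cong[OF assms(1) _ Suc.IH[of "\<lambda>x. frechet_derivative f (at x) v" "\<lambda>x. frechet_derivative g (at x) v"]])
       (use Suc.prems e in auto)
  moreover have "(\<lambda>x. f x + g x) differentiable (at x)" if "x \<in> S" for x
    using d[OF that] by (auto simp: differentiable_def)
  ultimately show ?case by simp
qed

lemma Ck_on_sum:
  assumes "open S" "\<And>i. i \<in> A \<Longrightarrow> Ck_on k S (f i)"
  shows "Ck_on k S (\<lambda>x. \<Sum>i\<in>A. f i x)"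
  using assms(2)
proof (induction A rule: infinite_finite_induct)
  case (insert i A)
  then show ?case by (simp add: Ck_on_add[OF assms(1)])
qed (simp_all add: Ck_on_const)

lemma Ck_on_cmult:
  fixes f :: "'a::real_normed_vector \<Rightarrow> complex"
  assumes "open S" "Ck_on k S f"
  shows "Ck_on k S (\<lambda>x. c * f x)"
  by (rule Ck_on_bounded_linear[OF assms(1) bounded_linear_mult_right assms(2)])

lemma Ck_on_wirtinger:
  assumes S: "open S" and f: "Ck_on (Suc k) S f"
  shows "Ck_on k S (wirtinger j f)" "Ck_on k S (wirtinger_bar j f)"
proof -
  have d: "Ck_on k S (\<lambda>x. frechet_derivative f (at x) v)" for v
    using f by simp
  have "Ck_on k S (\<lambda>x. (1/2) * frechet_derivative f (at x) (axis j 1) + c * frechet_derivative f (at x) (axis j \<i>))" for c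
    by (intro Ck_on_add Ck_on_cmult S d)
  from this[of "- \<i> / 2"] this[of "\<i> / 2"]
  show "Ck_on k S (wirtinger j f)" "Ck_on k S (wirtinger_bar j f)"
    unfolding wirtinger_def[abs_def] wirtinger_bar_def[abs_def]
    by (simp_all add: diff_divide_distrib add_divide_distrib)
qed

text \<open>For a fixed list of vectors the wedge factors are constants, so the value is a linear
  combination of the smooth coefficients.\<close>

lemma Ck_on_smooth_form:
  assumes "open S" "smooth_pq_form p q S \<phi>" "length vs = p + q"
  shows "Ck_on k S (\<lambda>z. \<phi> z vs)"
proof -
  obtain c where c: "\<And>js ks. smooth_on S (c js ks)"
    and \<phi>: "\<And>z. z \<in> S \<Longrightarrow> \<phi> z vs = (\<Sum>js\<in>{js. length js = p}. \<Sum>ks\<in>{ks. length ks = q}.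
        c js ks z * wedge_list (map dz js @ map dzbar ks) vs)"
    using assms(2,3) unfolding smooth_pq_form_def by blast
  have "Ck_on k S (\<lambda>z. \<Sum>js\<in>{js. length js = p}. \<Sum>ks\<in>{ks. length ks = q}.
        wedge_list (map dz js @ map dzbar ks) vs * c js ks z)"
    using c by (intro Ck_on_sum Ck_on_cmult assms(1)) (simp add: smooth_on_def)
  then show ?thesis
    by (rule Ck_on_cong[OF assms(1), rotated]) (simp add: \<phi> mult.commute)
qed

lemma Ck_on_del:
  assumes S: "open S" and \<phi>: "\<And>vs. length vs = m \<Longrightarrow> Ck_on (Suc k) S (\<lambda>z. \<phi> z vs)" and vs: "length vs = Suc m"
  shows "Ck_on k S (\<lambda>z. del \<phi> z vs)" "Ck_on k S (\<lambda>z. delbar \<phi> z vs)"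
proof -
  have l: "length (take i vs @ drop (Suc i) vs) = m" if "i < length vs" for i
    using that vs by simp
  show "Ck_on k S (\<lambda>z. del \<phi> z vs)"
    unfolding del_def wedge1_def mult.assoc
    by (intro Ck_on_sum Ck_on_cmult Ck_on_wirtinger S \<phi> l) simp
  show "Ck_on k S (\<lambda>z. delbar \<phi> z vs)"
    unfolding delbar_def wedge1_def mult.assoc
    by (intro Ck_on_sum Ck_on_cmult Ck_on_wirtinger S \<phi> l) simp
qed

lemma del_zero_on_open:
  assumes S: "open S" "z \<in> S" and \<phi>: "\<And>z vs. z \<in> S \<Longrightarrow> length vs = m \<Longrightarrow> \<phi> z vs = 0" and vs: "length vs = Suc m"
  shows "del \<phi> z vs = 0" "delbar \<phi> z vs = 0"
proof -
  have "frechet_derivative (\<lambda>w. \<phi> w (take i vs @ drop (Suc i) vs)) (at z) v = 0" if "i < length vs" for i v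
    by (rule frechet_derivative_zero_open[OF S]) (use that vs in \<open>auto intro!: \<phi>\<close>)
  then show "del \<phi> z vs = 0" "delbar \<phi> z vs = 0"
    by (simp_all add: del_def delbar_def wedge1_def wirtinger_def wirtinger_bar_def)
qed

lemma length_std_frame: "length (std_frame :: (complex ^ 'n::finite) list) = 2 * CARD('n)"
proof -
  define js where "js = (SOME js :: 'n list. distinct js \<and> set js = UNIV)"
  have "\<exists>js :: 'n list. distinct js \<and> set js = UNIV"
    using finite_distinct_list[OF finite_class.finite_UNIV] by blast
  then have "distinct js \<and> set js = UNIV"
    unfolding js_def by (rule someI_ex)
  then have "length js = CARD('n)"
    using distinct_card by fastforce
  moreover have "length (concat (map (\<lambda>j. [axis j 1, axis j \<i>]) js)) = 2 * length js" for js :: "'n list"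
    by (induction js) auto
  ultimately show ?thesis
    by (simp add: std_frame_def js_def)
qed

text \<open>Directional derivatives are bounded on the compact set and zero off it. The mean value
  inequality on the convex set \<open>S\<close> turns this bound into a Lipschitz constant.\<close>

lemma compact_support_C1_Lipschitz:
  fixes E :: "'a::euclidean_space \<Rightarrow> complex"
  assumes S: "open S" "convex S" and E: "Ck_on 1 S E"
    and K: "compact K" "K \<subseteq> S" and E0: "\<And>z. z \<in> S - K \<Longrightarrow> E z = 0"
  obtains B where "\<And>z w. z \<in> S \<Longrightarrow> w \<in> S \<Longrightarrow> norm (E z - E w) \<le> B * norm (z - w)"
proof -
  have "\<exists>B. \<forall>z\<in>S. norm (frechet_derivative E (at z) b) \<le> B" for b
  proof -
    have "compact ((\<lambda>z. frechet_derivative E (at z) b) ` K)"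
      using E K by (intro compact_continuous_image continuous_on_subset[OF _ K(2)]) auto
    then obtain B where B: "\<And>z. z \<in> K \<Longrightarrow> norm (frechet_derivative E (at z) b) \<le> B"
      by (meson bounded_iff compact_imp_bounded imageI)
    have "frechet_derivative E (at z) b = 0" if "z \<in> S - K" for z
      by (rule frechet_derivative_zero_open[of "S - K"]) (use S K E0 that in \<open>auto intro: open_Diff compact_imp_closed\<close>)
    then have "norm (frechet_derivative E (at z) b) \<le> max B 0" if "z \<in> S" for z
      using B[of z] that by (cases "z \<in> K") auto
    then show ?thesis by blast
  qed
  then obtain B where B: "\<And>b z. z \<in> S \<Longrightarrow> norm (frechet_derivative E (at z) b) \<le> B b"
    by metis
  have d: "(E has_derivative frechet_derivative E (at z)) (at z)" if "z \<in> S" for z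
    using E that by (simp add: frechet_derivative_works)
  \<comment> \<open>\<open>Ck_on\<close> gives continuity of the derivative in each fixed direction
    only, so the operator norm is bounded through the finite basis.\<close>
  have on: "onorm (frechet_derivative E (at z)) \<le> (\<Sum>b\<in>Basis. B b)" if z: "z \<in> S" for z
  proof (rule onorm_le)
    fix v
    let ?D = "frechet_derivative E (at z)"
    have lin: "bounded_linear ?D" using d[OF z] by (rule has_derivative_bounded_linear)
    have "?D v = ?D (\<Sum>b\<in>Basis. inner v b *\<^sub>R b)" by (simp add: euclidean_representation)
    also have "\<dots> = (\<Sum>b\<in>Basis. inner v b *\<^sub>R ?D b)"
      using lin by (simp add: linear_sum linear_scale bounded_linear.linear)
    finally have "norm (?D v) \<le> (\<Sum>b\<in>Basis. norm (inner v b *\<^sub>R ?D b))"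
      by (simp only: norm_sum)
    also have "\<dots> \<le> (\<Sum>b\<in>Basis. norm v * B b)"
      by (intro sum_mono) (auto intro!: mult_mono B z Basis_le_norm)
    finally show "norm (?D v) \<le> (\<Sum>b\<in>Basis. B b) * norm v"
      by (simp add: sum_distrib_left mult.commute)
  qed
  have "norm (E z - E w) \<le> (\<Sum>b\<in>Basis. B b) * norm (z - w)" if "z \<in> S" "w \<in> S" for z w
    by (rule differentiable_bound[OF S(2) _ on]) (use d that in \<open>auto intro: has_derivative_at_withinI\<close>)
  then show thesis by (rule that)
qed

text \<open>The real part of the Lebesgue density \<open>E\<close> is \<open>D\<close> times the
  invariant density, so \<open>D\<close> is the product of that real part with the polynomial
  \<open>h\<close>. Both factors are bounded and Lipschitz on the ball.\<close>

lemma form_density_Lipschitz: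
  fixes \<phi> :: "'n::finite form"
  assumes smooth: "smooth_pq_form (CARD('n) - 1) (CARD('n) - 1) (ball 0 1) \<phi>"
    and support: "compactly_supported_form (2 * (CARD('n) - 1)) (ball 0 1) \<phi>"
    and D: "\<And>z. z \<in> ball 0 1 \<Longrightarrow> top_density (i_del_delbar \<phi> z) = of_real (D z * invariant_density z)"
  obtains K C where "compact K" "K \<subseteq> ball 0 1" "\<And>z. z \<in> ball 0 1 - K \<Longrightarrow> D z = 0"
    "\<And>z w. z \<in> ball 0 1 \<Longrightarrow> w \<in> ball 0 1 \<Longrightarrow> \<bar>D z - D w\<bar> \<le> C * norm (z - w)"
proof -
  let ?S = "ball (0 :: complex ^ 'n) 1"
  define m where "m = 2 * (CARD('n) - 1)"
  have m: "2 * CARD('n) = Suc (Suc m)" unfolding m_def using zero_less_card_finite[where 'a='n] by arith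
  obtain K where K: "compact K" "K \<subseteq> ?S" and K0: "\<And>z vs. z \<in> ?S - K \<Longrightarrow> length vs = m \<Longrightarrow> \<phi> z vs = 0"
    using support unfolding compactly_supported_form_def m_def by blast
  define E where "E z = top_density (i_del_delbar \<phi> z)" for z
  \<comment> \<open>Order of differentiability: \<open>delbar\<close> leaves class 2, hence
    \<open>del (delbar \<phi>)\<close> has the class 1 that the Lipschitz bound requires.\<close>
  have C2: "Ck_on (Suc 1) ?S (\<lambda>z. delbar \<phi> z vs)" if "length vs = Suc m" for vs
    by (rule Ck_on_del(2)[OF open_ball _ that]) (auto intro!: Ck_on_smooth_form[OF _ smooth] simp: m_def mult_2 simp del: Ck_on.simps)
  have "Ck_on 1 ?S (\<lambda>z. del (delbar \<phi>) z std_frame)"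
    by (rule Ck_on_del(1)[OF open_ball C2]) (auto simp: length_std_frame m)
  then have E_C1: "Ck_on 1 ?S E"
    unfolding E_def[abs_def] top_density_def i_del_delbar_def by (intro Ck_on_cmult open_ball)
  have op: "open (?S - K)" using K by (intro open_Diff open_ball compact_imp_closed)
  have E0: "E z = 0" if z: "z \<in> ?S - K" for z
  proof -
    have "del (delbar \<phi>) z std_frame = 0"
      by (rule del_zero_on_open(1)[OF op z, where m="Suc m"])
         (auto simp: length_std_frame m intro!: del_zero_on_open(2)[OF op, where m=m] K0)
    then show ?thesis by (simp add: E_def top_density_def i_del_delbar_def)
  qed
  obtain B where B: "\<And>z w. z \<in> ?S \<Longrightarrow> w \<in> ?S \<Longrightarrow> norm (E z - E w) \<le> B * norm (z - w)"
    using compact_support_C1_Lipschitz[OF open_ball convex_ball E_C1 K E0] by blast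
  define V where "V = measure lborel ?S"
  have V: "0 < V" unfolding V_def by (rule content_ball_pos) simp
  \<comment> \<open>The reciprocal of \<open>invariant_density\<close>, which unlike the density
    itself stays bounded up to the sphere.\<close>
  define h where "h z = V * (1 - (norm z)\<^sup>2) ^ (CARD('n) + 1)" for z :: "complex ^ 'n"
  have n1: "0 \<le> 1 - (norm z)\<^sup>2" "1 - (norm z)\<^sup>2 \<le> 1" "0 < 1 - (norm z)\<^sup>2" if "z \<in> ?S" for z
    using that by (auto simp: abs_square_le_1 abs_square_less_1)
  have DE: "D z = Re (E z) * h z" if z: "z \<in> ?S" for z
  proof -
    have "Re (E z) = D z * invariant_density z" unfolding E_def D[OF z] by simp
    then show ?thesis using V n1[OF z] by (simp add: h_def invariant_density_def V_def)
  qed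
  have h_le: "\<bar>h z\<bar> \<le> V" if "z \<in> ?S" for z
    using n1[OF that] V power_le_one[of "1 - (norm z)\<^sup>2" "CARD('n) + 1"]
    by (simp add: h_def abs_mult mult_left_le)
  have pow_lip: "\<bar>x ^ k - y ^ k\<bar> \<le> real k * \<bar>x - y\<bar>" if xy: "0 \<le> x" "x \<le> 1" "0 \<le> y" "y \<le> 1" for x y :: real and k
  proof (induction k)
    case (Suc k)
    have "x ^ Suc k - y ^ Suc k = x * (x ^ k - y ^ k) + (x - y) * y ^ k" by (simp add: algebra_simps)
    also have "\<bar>\<dots>\<bar> \<le> \<bar>x\<bar> * \<bar>x ^ k - y ^ k\<bar> + \<bar>x - y\<bar> * \<bar>y ^ k\<bar>"
      by (metis abs_mult abs_triangle_ineq)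
    also have "\<dots> \<le> 1 * (real k * \<bar>x - y\<bar>) + \<bar>x - y\<bar> * 1"
      using xy by (intro add_mono mult_mono Suc.IH) (auto intro: power_le_one)
    finally show ?case by (simp add: algebra_simps)
  qed simp
  define H where "H = V * real (CARD('n) + 1) * 2"
  have h_lip: "\<bar>h z - h w\<bar> \<le> H * norm (z - w)" if z: "z \<in> ?S" and w: "w \<in> ?S" for z w
  proof -
    have "\<bar>(1 - (norm z)\<^sup>2) - (1 - (norm w)\<^sup>2)\<bar> = (norm z + norm w) * \<bar>norm z - norm w\<bar>"
    proof -
      have "(1 - (norm z)\<^sup>2) - (1 - (norm w)\<^sup>2) = (norm z + norm w) * (norm w - norm z)"
        by (simp add: algebra_simps power2_eq_square)
      then show ?thesis by (simp add: abs_mult abs_minus_commute)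
    qed
    also have "\<dots> \<le> 2 * norm (z - w)"
      using z w norm_triangle_ineq3[of z w] by (intro mult_mono) auto
    finally have "\<bar>(1 - (norm z)\<^sup>2) ^ (CARD('n) + 1) - (1 - (norm w)\<^sup>2) ^ (CARD('n) + 1)\<bar> \<le> real (CARD('n) + 1) * (2 * norm (z - w))"
      by (intro order_trans[OF pow_lip] mult_left_mono) (use n1[OF z] n1[OF w] in auto)
    then have "V * \<bar>(1 - (norm z)\<^sup>2) ^ (CARD('n) + 1) - (1 - (norm w)\<^sup>2) ^ (CARD('n) + 1)\<bar> \<le> V * (real (CARD('n) + 1) * (2 * norm (z - w)))"
      using V by (intro mult_left_mono) auto
    moreover have "\<bar>h z - h w\<bar> = V * \<bar>(1 - (norm z)\<^sup>2) ^ (CARD('n) + 1) - (1 - (norm w)\<^sup>2) ^ (CARD('n) + 1)\<bar>"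
      using V by (simp add: h_def abs_mult flip: right_diff_distrib)
    ultimately show ?thesis by (simp only: H_def mult.assoc)
  qed
  have E_le: "\<bar>Re (E z)\<bar> \<le> norm (E 0) + \<bar>B\<bar>" if z: "z \<in> ?S" for z
  proof -
    have "norm (E z) \<le> norm (E 0) + norm (E z - E 0)" using norm_triangle_sub[of "E z" "E 0"] by simp
    also have "norm (E z - E 0) \<le> B * norm (z - 0)" using B[OF z, of 0] by simp
    also have "\<dots> \<le> \<bar>B\<bar> * 1" using z by (intro mult_mono) auto
    finally show ?thesis using abs_Re_le_cmod[of "E z"] by simp
  qed
  have lip: "\<bar>D z - D w\<bar> \<le> (V * B + (norm (E 0) + \<bar>B\<bar>) * H) * norm (z - w)" if z: "z \<in> ?S" and w: "w \<in> ?S" for z w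
  proof -
    have "D z - D w = (Re (E z) - Re (E w)) * h z + Re (E w) * (h z - h w)"
      unfolding DE[OF z] DE[OF w] by (simp add: algebra_simps)
    also have "\<bar>\<dots>\<bar> \<le> \<bar>Re (E z) - Re (E w)\<bar> * \<bar>h z\<bar> + \<bar>Re (E w)\<bar> * \<bar>h z - h w\<bar>"
      by (metis abs_mult abs_triangle_ineq)
    also have "\<dots> \<le> (B * norm (z - w)) * V + (norm (E 0) + \<bar>B\<bar>) * (H * norm (z - w))"
    proof (intro add_mono mult_mono h_le E_le h_lip z w)
      show "\<bar>Re (E z) - Re (E w)\<bar> \<le> B * norm (z - w)"
        using B[OF z w] abs_Re_le_cmod[of "E z - E w"] by simp
      show "0 \<le> B * norm (z - w)" using B[OF z w] norm_ge_zero order_trans by blast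
    qed auto
    finally show ?thesis by (simp add: algebra_simps)
  qed
  show thesis
    by (rule that[OF K _ lip]) (use DE E0 in auto)
qed

section \<open>Integrals of powers of the normalised kernel\<close>

lemma sets_invariant_measure [simp, measurable_cong]: "sets (invariant_measure :: (complex ^ 'n::finite) measure) = sets borel"
  by (simp add: invariant_measure_eq_density)

lemma space_invariant_measure [simp]: "space (invariant_measure :: (complex ^ 'n::finite) measure) = UNIV"
  by (simp add: invariant_measure_eq_density)

lemma invariant_density_measurable [measurable]: "(invariant_density :: complex ^ 'n::finite \<Rightarrow> real) \<in> borel_measurable borel"
  unfolding invariant_density_def by measurable

lemma invariant_density_nonneg: "norm (z :: complex ^ 'n::finite) < 1 \<Longrightarrow> 0 \<le> invariant_density z"
  by (simp add: invariant_density_def abs_square_le_1)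

lemma sigma_finite_invariant_measure: "sigma_finite_measure (invariant_measure :: (complex ^ 'n::finite) measure)"
proof -
  have [measurable]: "ball (0 :: complex ^ 'n) 1 \<in> sets borel" by simp
  show ?thesis
    unfolding invariant_measure_eq_density
    by (subst sigma_finite_measure.sigma_finite_iff_density_finite[OF sigma_finite_lborel]) auto
qed

text \<open>Equal to 1 - |phi(w)|^2 on the ball, where phi is the automorphism of the ball
  exchanging \<open>z\<close> and 0; it measures invariant distance and equals 1 on the
  diagonal.\<close>

definition kernel_ratio :: "complex ^ 'n::finite \<Rightarrow> complex ^ 'n \<Rightarrow> real" where
  "kernel_ratio z w = (1 - (norm z)\<^sup>2) * (1 - (norm w)\<^sup>2) / (cmod (1 - herm z w))\<^sup>2"

lemma kernel_ratio_measurable [measurable (raw)]: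
  assumes "f \<in> borel_measurable M" "g \<in> borel_measurable M"
  shows "(\<lambda>x. kernel_ratio (f x) (g x)) \<in> borel_measurable M"
  unfolding kernel_ratio_def using assms by measurable

lemma kernel_ratio_commute: "kernel_ratio z w = kernel_ratio w z"
proof -
  have "cmod (1 - herm z w) = cmod (cnj (1 - herm z w))" by (simp only: complex_mod_cnj)
  then show ?thesis by (simp add: kernel_ratio_def cnj_herm mult.commute)
qed

lemma herm_norm_less: "norm z < 1 \<Longrightarrow> norm w < 1 \<Longrightarrow> cmod (herm z w) < 1"
  using Cauchy_Schwarz_herm[of z w] mult_strict_mono'[of "norm z" 1 "norm w" 1] by simp

text \<open>The middle estimate says that 1 - \<open>kernel_ratio\<close> dominates the squared
  Euclidean distance away from the sphere. This makes a Lipschitz function comparable with the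
  kernel.\<close>

lemma one_minus_kernel_ratio:
  fixes z w :: "complex ^ 'n::finite"
  assumes z: "norm z < 1" and w: "norm w < 1"
  shows "0 < kernel_ratio z w" "(1 - (norm z)\<^sup>2) * (norm (z - w))\<^sup>2 / 4 \<le> 1 - kernel_ratio z w" "kernel_ratio z w \<le> 1"
proof -
  have n1: "0 < 1 - (norm z)\<^sup>2" "0 < 1 - (norm w)\<^sup>2" using z w by (auto simp: abs_square_less_1)
  have ne: "0 < cmod (1 - herm z w)" using herm_norm_less[OF z w] by auto
  show "0 < kernel_ratio z w" unfolding kernel_ratio_def using n1 ne by simp
  define a where "a = (norm z)\<^sup>2"
  define b where "b = (norm w)\<^sup>2"
  define r where "r = Re (herm z w)"
  define c where "c = (cmod (herm z w))\<^sup>2"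
  define d where "d = (norm (z - w))\<^sup>2"
  have d: "d = a + b - 2 * r"
    unfolding d_def a_def b_def r_def Re_herm power2_norm_eq_inner
    by (simp add: inner_diff_left inner_diff_right inner_commute)
  have den: "(cmod (1 - herm z w))\<^sup>2 = 1 - 2 * r + c"
    unfolding r_def c_def cmod_power2 by (simp add: power2_eq_square algebra_simps)
  \<comment> \<open>Nonnegativity of | |z|^2 - <z,w> |^2 bounds the Cauchy-Schwarz defect
    \<open>a * b - c\<close> by \<open>a * d\<close>, leaving \<open>(1 - a) * d\<close> in the
    numerator.\<close>
  have "0 \<le> (cmod (of_real a - herm z w))\<^sup>2" by simp
  also have "\<dots> = a\<^sup>2 - 2 * a * r + c"
    unfolding r_def c_def cmod_power2 by (simp add: power2_eq_square algebra_simps)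
  finally have cs: "a * b - c \<le> a * d" unfolding d by (simp add: algebra_simps power2_eq_square)
  have num: "(cmod (1 - herm z w))\<^sup>2 - (1 - a) * (1 - b) = d - (a * b - c)"
    unfolding den d by (simp add: algebra_simps)
  \<comment> \<open>The squared denominator is at most 4, and this is the constant in the
    estimate.\<close>
  have "cmod (1 - herm z w) \<le> 2"
    using norm_triangle_ineq4[of 1 "herm z w"] herm_norm_less[OF z w] by simp
  then have den4: "(cmod (1 - herm z w))\<^sup>2 \<le> 2\<^sup>2"
    by (intro power_mono) auto
  have "1 - kernel_ratio z w = ((cmod (1 - herm z w))\<^sup>2 - (1 - a) * (1 - b)) / (cmod (1 - herm z w))\<^sup>2"
    using ne by (simp add: kernel_ratio_def a_def b_def diff_divide_distrib)
  also have "\<dots> \<ge> ((1 - a) * d) / (cmod (1 - herm z w))\<^sup>2"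
    unfolding num using cs by (intro divide_right_mono) (auto simp: algebra_simps)
  finally have ge: "((1 - a) * d) / (cmod (1 - herm z w))\<^sup>2 \<le> 1 - kernel_ratio z w" .
  have pos: "0 \<le> (1 - a) * d" using n1 by (simp add: a_def d_def)
  then have "(1 - a) * d / 4 \<le> ((1 - a) * d) / (cmod (1 - herm z w))\<^sup>2"
    using den4 ne by (intro divide_left_mono) auto
  from order_trans[OF this ge] show *: "(1 - (norm z)\<^sup>2) * (norm (z - w))\<^sup>2 / 4 \<le> 1 - kernel_ratio z w"
    unfolding a_def d_def .
  show "kernel_ratio z w \<le> 1"
    using * pos by (simp add: a_def d_def)
qed

text \<open>The total mass J(s) of the \<open>s\<close>-th power of the kernel ratio in dimension
  \<open>n\<close>.\<close>

definition kernel_mass :: "nat \<Rightarrow> real \<Rightarrow> real" where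
  "kernel_mass n s = fact n * Gamma (s - real n) / Gamma s"

text \<open>The invariant density lowers the exponent of 1 - |z|^2 from \<open>s\<close> to s - n -
  1, as in \<open>nn_integral_ball_kernel\<close>. The factor (1 - |w|^2)^s cancels the dependence
  of that integral on \<open>w\<close>.\<close>

lemma nn_integral_kernel_ratio:
  fixes w :: "complex ^ 'n::finite"
  assumes w: "norm w < 1" and s: "real CARD('n) + 1 < s"
  shows "(\<integral>\<^sup>+z. ennreal (kernel_ratio z w powr s) \<partial>invariant_measure) = ennreal (kernel_mass CARD('n) s)"
proof -
  have [measurable]: "ball (0 :: complex ^ 'n) 1 \<in> sets borel" by simp
  define V where "V = measure lborel (ball (0 :: complex ^ 'n) 1)"
  have V: "0 < V" unfolding V_def by (rule content_ball_pos) simp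
  have em: "emeasure lborel (ball (0 :: complex ^ 'n) 1) = ennreal V"
    unfolding V_def using emeasure_lborel_ball_finite[of "0 :: complex ^ 'n" 1]
    by (simp add: emeasure_eq_ennreal_measure)
  have w1: "0 < 1 - (norm w)\<^sup>2" using w by (simp add: abs_square_less_1)
  have pos: "0 \<le> kernel_mass CARD('n) s"
    unfolding kernel_mass_def using s by (auto intro!: divide_nonneg_nonneg mult_nonneg_nonneg less_imp_le[OF Gamma_real_pos])
  have "(\<integral>\<^sup>+z. ennreal (kernel_ratio z w powr s) \<partial>invariant_measure)
      = (\<integral>\<^sup>+z. ennreal (indicator (ball 0 1) z * invariant_density z) * ennreal (kernel_ratio z w powr s) \<partial>lborel)"
    unfolding invariant_measure_eq_density by (subst nn_integral_density) auto
  also have "\<dots> = (\<integral>\<^sup>+z. ennreal ((1 - (norm w)\<^sup>2) powr s / V) * ennreal (indicator (ball 0 1) z * (1 - (norm z)\<^sup>2) powr (s - real CARD('n) - 1)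
              * cmod (1 - herm z w) powr (- (2 * s))) \<partial>lborel)"
  proof (rule nn_integral_cong)
    fix z :: "complex ^ 'n"
    show "ennreal (indicator (ball 0 1) z * invariant_density z) * ennreal (kernel_ratio z w powr s)
      = ennreal ((1 - (norm w)\<^sup>2) powr s / V) * ennreal (indicator (ball 0 1) z * (1 - (norm z)\<^sup>2) powr (s - real CARD('n) - 1)
              * cmod (1 - herm z w) powr (- (2 * s)))"
    proof (cases "norm z < 1")
      case True
      then have z1: "0 < 1 - (norm z)\<^sup>2" by (simp add: abs_square_less_1)
      have ne: "0 < cmod (1 - herm z w)" using herm_norm_less[OF True w] by auto
      have "invariant_density z = 1 / (V * (1 - (norm z)\<^sup>2) powr (real CARD('n) + 1))"
      proof -
        have "(1 - (norm z)\<^sup>2) powr (real CARD('n) + 1) = (1 - (norm z)\<^sup>2) ^ (CARD('n) + 1)"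
          using powr_realpow[OF z1, of "CARD('n) + 1"] by (simp add: add.commute)
        then show ?thesis unfolding invariant_density_def V_def by simp
      qed
      moreover have "kernel_ratio z w powr s = (1 - (norm z)\<^sup>2) powr s * (1 - (norm w)\<^sup>2) powr s * cmod (1 - herm z w) powr (- (2 * s))"
      proof -
        have "(cmod (1 - herm z w))\<^sup>2 = cmod (1 - herm z w) powr 2" using ne by simp
        then have "(cmod (1 - herm z w))\<^sup>2 powr s = cmod (1 - herm z w) powr (2 * s)" by (simp only: powr_powr)
        then show ?thesis
          unfolding kernel_ratio_def using z1 w1 ne by (simp add: powr_divide powr_mult powr_minus_divide)
      qed
      moreover have "(1 - (norm z)\<^sup>2) powr (s - real CARD('n) - 1) = (1 - (norm z)\<^sup>2) powr s / (1 - (norm z)\<^sup>2) powr (real CARD('n) + 1)"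
        by (simp add: powr_diff[symmetric] algebra_simps)
      ultimately have "invariant_density z * kernel_ratio z w powr s
        = (1 - (norm w)\<^sup>2) powr s / V * ((1 - (norm z)\<^sup>2) powr (s - real CARD('n) - 1) * cmod (1 - herm z w) powr (- (2 * s)))"
        by simp
      then show ?thesis
        using True V invariant_density_nonneg[OF True] by (simp add: ennreal_mult'[symmetric])
    qed simp
  qed
  also have "\<dots> = ennreal ((1 - (norm w)\<^sup>2) powr s / V) * (ennreal V * ennreal (kernel_mass CARD('n) s * (1 - (norm w)\<^sup>2) powr (- s)))"
    unfolding em[symmetric] kernel_mass_def nn_integral_ball_kernel[OF w s, symmetric]
    by (rule nn_integral_cmult) measurable
  also have "\<dots> = ennreal ((1 - (norm w)\<^sup>2) powr s / V * (V * (kernel_mass CARD('n) s * (1 - (norm w)\<^sup>2) powr (- s))))"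
    using V pos by (simp add: ennreal_mult'[symmetric])
  also have "(1 - (norm w)\<^sup>2) powr s / V * (V * (kernel_mass CARD('n) s * (1 - (norm w)\<^sup>2) powr (- s))) = kernel_mass CARD('n) s"
    using V w1 by (simp add: powr_minus field_simps)
  finally show ?thesis .
qed

lemma AE_invariant_measure: "AE z in (invariant_measure :: (complex ^ 'n::finite) measure). norm z < 1"
  unfolding invariant_measure_eq_density by (subst AE_density) (auto simp: indicator_def)

text \<open>Integrating out the variable on which \<open>f\<close> does not depend gives the
  constant kernel mass; symmetry of the kernel covers the other order.\<close>

lemma kernel_ratio_product_integral:
  fixes f :: "complex ^ 'n::finite \<Rightarrow> real"
  assumes f: "integrable invariant_measure f" and s: "real CARD('n) + 1 < s"
  shows "integrable (invariant_measure \<Otimes>\<^sub>M invariant_measure) (\<lambda>(z, w). f z * kernel_ratio z w powr s)"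
    and "(\<integral>p. (case p of (z, w) \<Rightarrow> f z * kernel_ratio z w powr s) \<partial>(invariant_measure \<Otimes>\<^sub>M invariant_measure))
       = kernel_mass CARD('n) s * (\<integral>z. f z \<partial>invariant_measure)"
    and "integrable (invariant_measure \<Otimes>\<^sub>M invariant_measure) (\<lambda>(z, w). f w * kernel_ratio z w powr s)"
    and "(\<integral>p. (case p of (z, w) \<Rightarrow> f w * kernel_ratio z w powr s) \<partial>(invariant_measure \<Otimes>\<^sub>M invariant_measure))
       = kernel_mass CARD('n) s * (\<integral>z. f z \<partial>invariant_measure)"
proof -
  let ?\<mu> = "invariant_measure :: (complex ^ 'n) measure"
  interpret \<mu>: sigma_finite_measure ?\<mu> by (rule sigma_finite_invariant_measure)
  interpret \<mu>\<mu>: pair_sigma_finite ?\<mu> ?\<mu> ..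
  have [measurable]: "f \<in> borel_measurable borel"
    using borel_measurable_integrable[OF f] by simp
  let ?F = "\<lambda>(z, w). f z * kernel_ratio z w powr s"
  have nn: "(\<integral>\<^sup>+w. ennreal (kernel_ratio z w powr s) \<partial>?\<mu>) = ennreal (kernel_mass CARD('n) s)" if "norm z < 1" for z :: "complex ^ 'n"
    using nn_integral_kernel_ratio[OF that s] by (simp add: kernel_ratio_commute)
  have pos: "0 \<le> kernel_mass CARD('n) s"
    unfolding kernel_mass_def using s by (auto intro!: divide_nonneg_nonneg mult_nonneg_nonneg less_imp_le[OF Gamma_real_pos])
  have kint: "integrable ?\<mu> (\<lambda>w. kernel_ratio z w powr s)" if "norm z < 1" for z :: "complex ^ 'n"
    by (rule integrableI_bounded) (auto simp: nn[OF that])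
  have kval: "(\<integral>w. kernel_ratio z w powr s \<partial>?\<mu>) = kernel_mass CARD('n) s" if "norm z < 1" for z :: "complex ^ 'n"
    using pos by (subst integral_eq_nn_integral) (auto simp: nn[OF that])
  show int: "integrable (?\<mu> \<Otimes>\<^sub>M ?\<mu>) ?F"
  proof (rule \<mu>\<mu>.Fubini_integrable)
    show "?F \<in> borel_measurable (?\<mu> \<Otimes>\<^sub>M ?\<mu>)" by measurable
    show "integrable ?\<mu> (\<lambda>z. \<integral>w. norm (case (z, w) of (z, w) \<Rightarrow> f z * kernel_ratio z w powr s) \<partial>?\<mu>)"
    proof (rule integrable_cong_AE_imp)
      show "integrable ?\<mu> (\<lambda>z. \<bar>f z\<bar> * kernel_mass CARD('n) s)" using f by simp
      show "AE z in ?\<mu>. \<bar>f z\<bar> * kernel_mass CARD('n) s = (\<integral>w. norm (case (z, w) of (z, w) \<Rightarrow> f z * kernel_ratio z w powr s) \<partial>?\<mu>)"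
        using AE_invariant_measure by eventually_elim (simp add: abs_mult kval)
    qed measurable
    show "AE z in ?\<mu>. integrable ?\<mu> (\<lambda>w. case (z, w) of (z, w) \<Rightarrow> f z * kernel_ratio z w powr s)"
      using AE_invariant_measure by eventually_elim (simp add: kint)
  qed
  show val: "(\<integral>p. ?F p \<partial>(?\<mu> \<Otimes>\<^sub>M ?\<mu>)) = kernel_mass CARD('n) s * (\<integral>z. f z \<partial>?\<mu>)"
  proof -
    have "(\<integral>p. ?F p \<partial>(?\<mu> \<Otimes>\<^sub>M ?\<mu>)) = (\<integral>z. (\<integral>w. f z * kernel_ratio z w powr s \<partial>?\<mu>) \<partial>?\<mu>)"
      using \<mu>\<mu>.integral_fst'[OF int] by simp
    also have "\<dots> = (\<integral>z. f z * kernel_mass CARD('n) s \<partial>?\<mu>)"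
    proof (rule integral_cong_AE)
      show "AE z in ?\<mu>. (\<integral>w. f z * kernel_ratio z w powr s \<partial>?\<mu>) = f z * kernel_mass CARD('n) s"
        using AE_invariant_measure by eventually_elim (simp add: kval)
    qed measurable
    finally show ?thesis by (simp add: mult.commute)
  qed
  have sw: "(\<lambda>(z, w). ?F (w, z)) = (\<lambda>(z, w). f w * kernel_ratio z w powr s)"
    by (auto simp: kernel_ratio_commute)
  show "integrable (?\<mu> \<Otimes>\<^sub>M ?\<mu>) (\<lambda>(z, w). f w * kernel_ratio z w powr s)"
    using \<mu>\<mu>.integrable_product_swap[OF int] unfolding sw .
  show "(\<integral>p. (case p of (z, w) \<Rightarrow> f w * kernel_ratio z w powr s) \<partial>(?\<mu> \<Otimes>\<^sub>M ?\<mu>))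
       = kernel_mass CARD('n) s * (\<integral>z. f z \<partial>?\<mu>)"
    using \<mu>\<mu>.integral_product_swap[OF borel_measurable_integrable[OF int]] unfolding sw val .
qed

text \<open>Since \<open>2 D(z) D(w) = D(z)\<^sup>2 + D(w)\<^sup>2 - (D(z) - D(w))\<^sup>2\<close> and the last term is dominated by
  \<open>1 - kernel_ratio z w\<close>, the error is controlled by the difference of two consecutive kernel masses.\<close>

lemma kernel_ratio_quadratic_form:
  fixes D :: "complex ^ 'n::finite \<Rightarrow> real"
  assumes D2: "integrable invariant_measure (\<lambda>z. (D z)\<^sup>2)" and [measurable]: "D \<in> borel_measurable borel"
    and K: "integrable invariant_measure (indicator K :: complex ^ 'n \<Rightarrow> real)"
    and C: "\<And>z w. norm z < 1 \<Longrightarrow> norm w < 1 \<Longrightarrow> (D z - D w)\<^sup>2 \<le> C * (indicator K z + indicator K w) * (1 - kernel_ratio z w)"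
    and s: "real CARD('n) + 1 < s"
  shows "\<bar>(\<integral>p. (case p of (z, w) \<Rightarrow> D z * D w * kernel_ratio z w powr s) \<partial>(invariant_measure \<Otimes>\<^sub>M invariant_measure))
      - kernel_mass CARD('n) s * (\<integral>z. (D z)\<^sup>2 \<partial>invariant_measure)\<bar>
      \<le> C * (\<integral>z. indicator K z \<partial>invariant_measure) * (kernel_mass CARD('n) s - kernel_mass CARD('n) (s + 1))"
proof -
  let ?\<mu> = "invariant_measure :: (complex ^ 'n) measure"
  let ?\<mu>2 = "?\<mu> \<Otimes>\<^sub>M ?\<mu>"
  interpret \<mu>: sigma_finite_measure ?\<mu> by (rule sigma_finite_invariant_measure)
  interpret \<mu>\<mu>: pair_sigma_finite ?\<mu> ?\<mu> ..
  have s': "real CARD('n) + 1 < s + 1" using s by simp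
  have [measurable]: "(indicator K :: complex ^ 'n \<Rightarrow> real) \<in> borel_measurable borel"
    using borel_measurable_integrable[OF K] by simp
  note D = kernel_ratio_product_integral[OF D2 s]
  note K1 = kernel_ratio_product_integral[OF K s] and K2 = kernel_ratio_product_integral[OF K s']
  let ?A = "\<lambda>p. (case p of (z, w) \<Rightarrow> (D z)\<^sup>2 * kernel_ratio z w powr s)"
  let ?B = "\<lambda>p. (case p of (z, w) \<Rightarrow> (D w)\<^sup>2 * kernel_ratio z w powr s)"
  let ?R = "\<lambda>p. (case p of (z, w) \<Rightarrow> (D z - D w)\<^sup>2 * kernel_ratio z w powr s)"
  let ?k1 = "\<lambda>t p. (case p of (z, w) \<Rightarrow> indicator K z * kernel_ratio z w powr t)"
  let ?k2 = "\<lambda>t p. (case p of (z, w) \<Rightarrow> indicator K w * kernel_ratio z w powr t)"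
  \<comment> \<open>Multiplying 1 - \<open>kernel_ratio\<close> by the \<open>s\<close>-th power
    gives the difference of the powers \<open>s\<close> and \<open>s + 1\<close>, and the indicators
    make both integrable over the product.\<close>
  let ?E = "\<lambda>p. C * ((?k1 s p - ?k1 (s + 1) p) + (?k2 s p - ?k2 (s + 1) p))"
  have E_int: "integrable ?\<mu>2 ?E"
    by (intro integrable_mult_right Bochner_Integration.integrable_add Bochner_Integration.integrable_diff K1 K2)
  have pair_AE: "AE p in ?\<mu>2. norm (fst p) < 1 \<and> norm (snd p) < 1"
  proof -
    have "AE z in ?\<mu>. AE w in ?\<mu>. norm z < 1 \<and> norm w < 1"
      using AE_invariant_measure
    proof eventually_elim
      case (elim z)
      show ?case using AE_invariant_measure by eventually_elim (simp add: elim)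
    qed
    then have *: "AE z in ?\<mu>. AE w in ?\<mu>. norm (fst (z, w)) < 1 \<and> norm (snd (z, w)) < 1" by simp
    have "{p \<in> space ?\<mu>2. norm (fst p) < 1 \<and> norm (snd p) < 1} \<in> sets ?\<mu>2" by measurable
    from \<mu>\<mu>.AE_pair_measure[OF this *] show ?thesis .
  qed
  have R_le: "AE p in ?\<mu>2. ?R p \<le> ?E p"
    using pair_AE
  proof eventually_elim
    case (elim p)
    obtain z w where p: "p = (z, w)" by (cases p)
    have zw: "norm z < 1" "norm w < 1" using elim p by auto
    note k = one_minus_kernel_ratio[OF zw]
    have "?R p \<le> C * (indicator K z + indicator K w) * (1 - kernel_ratio z w) * kernel_ratio z w powr s"
      using mult_right_mono[OF C[OF zw], of "kernel_ratio z w powr s"] by (simp add: p)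
    also have "\<dots> = ?E p"
      using k by (simp add: p powr_add algebra_simps)
    finally show ?case .
  qed
  have R_int: "integrable ?\<mu>2 ?R"
  proof (rule Bochner_Integration.integrable_bound[OF E_int])
    show "AE p in ?\<mu>2. norm (?R p) \<le> norm (?E p)"
      using R_le
    proof eventually_elim
      case (elim p)
      have "0 \<le> ?R p" by (simp add: split_beta)
      then have "norm (?R p) = ?R p" by (simp only: real_norm_def abs_of_nonneg)
      then show ?case using order_trans[OF elim abs_ge_self] by (simp only: real_norm_def)
    qed
  qed measurable
  have lin1: "(\<integral>p. (A p + B p - R p) / 2 \<partial>?\<mu>2) = ((\<integral>p. A p \<partial>?\<mu>2) + (\<integral>p. B p \<partial>?\<mu>2) - (\<integral>p. R p \<partial>?\<mu>2)) / 2"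
    if "integrable ?\<mu>2 A" "integrable ?\<mu>2 B" "integrable ?\<mu>2 R" for A B R :: "_ \<Rightarrow> real"
    using that by simp
  have lin2: "(\<integral>p. C * ((f p - g p) + (h p - k p)) \<partial>?\<mu>2)
     = C * (((\<integral>p. f p \<partial>?\<mu>2) - (\<integral>p. g p \<partial>?\<mu>2)) + ((\<integral>p. h p \<partial>?\<mu>2) - (\<integral>p. k p \<partial>?\<mu>2)))"
    if "integrable ?\<mu>2 f" "integrable ?\<mu>2 g" "integrable ?\<mu>2 h" "integrable ?\<mu>2 k" for f g h k :: "_ \<Rightarrow> real"
    using that by simp
  have split: "(case p of (z, w) \<Rightarrow> D z * D w * kernel_ratio z w powr s) = (?A p + ?B p - ?R p) / 2" for p
    by (cases p) (simp add: power2_diff algebra_simps)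
  have "(\<integral>p. (case p of (z, w) \<Rightarrow> D z * D w * kernel_ratio z w powr s) \<partial>?\<mu>2) = ((\<integral>p. ?A p \<partial>?\<mu>2) + (\<integral>p. ?B p \<partial>?\<mu>2) - (\<integral>p. ?R p \<partial>?\<mu>2)) / 2"
    unfolding split by (rule lin1[OF D(1,3) R_int])
  also have "\<dots> = kernel_mass CARD('n) s * (\<integral>z. (D z)\<^sup>2 \<partial>?\<mu>) - (\<integral>p. ?R p \<partial>?\<mu>2) / 2"
    unfolding D(2,4) by simp
  finally have eq: "(\<integral>p. (case p of (z, w) \<Rightarrow> D z * D w * kernel_ratio z w powr s) \<partial>?\<mu>2)
     = kernel_mass CARD('n) s * (\<integral>z. (D z)\<^sup>2 \<partial>?\<mu>) - (\<integral>p. ?R p \<partial>?\<mu>2) / 2" .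
  have R0: "0 \<le> (\<integral>p. ?R p \<partial>?\<mu>2)"
    by (intro Bochner_Integration.integral_nonneg) (simp add: split_beta)
  have "(\<integral>p. ?R p \<partial>?\<mu>2) \<le> (\<integral>p. ?E p \<partial>?\<mu>2)"
    by (rule integral_mono_AE[OF R_int E_int R_le])
  also have "\<dots> = C * (((\<integral>p. ?k1 s p \<partial>?\<mu>2) - (\<integral>p. ?k1 (s + 1) p \<partial>?\<mu>2)) + ((\<integral>p. ?k2 s p \<partial>?\<mu>2) - (\<integral>p. ?k2 (s + 1) p \<partial>?\<mu>2)))"
    by (rule lin2[OF K1(1) K2(1) K1(3) K2(3)])
  also have "\<dots> = 2 * (C * (\<integral>z. indicator K z \<partial>?\<mu>) * (kernel_mass CARD('n) s - kernel_mass CARD('n) (s + 1)))"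
    unfolding K1(2,4) K2(2,4) by (simp add: algebra_simps)
  finally show ?thesis
    unfolding eq using R0 by simp
qed

section \<open>Linear statistics of the Gaussian analytic function\<close>

text \<open>The condition separates the sum from its default value 0 in terms of an extended
  nonnegative series, which makes joint measurability in the sample point and \<open>z\<close>
  apparent.\<close>

lemma infsum_complex_eq_suminf:
  fixes f :: "nat \<Rightarrow> complex"
  shows "infsum f UNIV = (if (\<Sum>k. ennreal (cmod (f k))) < \<infinity> then suminf f else 0)"
proof (cases "summable (\<lambda>k. cmod (f k))")
  case True
  have "(f has_sum suminf f) UNIV"
    by (rule norm_summable_imp_has_sum[OF True summable_sums[OF summable_norm_cancel[OF True]]])
  moreover have "(\<Sum>k. ennreal (cmod (f k))) = ennreal (\<Sum>k. cmod (f k))"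
    by (rule suminf_ennreal_eq[OF _ summable_sums[OF True]]) simp
  ultimately show ?thesis by (simp add: infsumI)
next
  case False
  have "\<not> f summable_on UNIV"
    using False by (simp add: summable_on_iff_abs_summable_on_complex summable_on_UNIV_nonneg_real_iff)
  moreover have "(\<Sum>k. ennreal (cmod (f k))) = \<infinity>"
  proof (rule ccontr)
    assume "(\<Sum>k. ennreal (cmod (f k))) \<noteq> \<infinity>"
    then have "summable (\<lambda>k. cmod (f k))"
      by (intro summable_suminf_not_top) simp_all
    with False show False ..
  qed
  ultimately show ?thesis by (simp add: infsum_not_exists)
qed

locale hyperbolic_gaf = prob_space M for M :: "'w measure" +
  fixes a :: "('n::finite \<Rightarrow> nat) \<Rightarrow> 'w \<Rightarrow> complex"
  assumes indep: "indep_vars (\<lambda>_. borel) a UNIV"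
    and gaussian: "std_complex_gaussian M (a \<alpha>)"
begin

text \<open>An enumeration of the multi-indices, under which the unordered random sum becomes a
  series indexed by natural numbers.\<close>

definition enum :: "nat \<Rightarrow> 'n \<Rightarrow> nat" where
  "enum = from_nat_into UNIV"

lemma bij_enum: "bij enum"
proof -
  have "infinite (UNIV :: ('n \<Rightarrow> nat) set)"
  proof
    assume "finite (UNIV :: ('n \<Rightarrow> nat) set)"
    then have "finite (range (\<lambda>k :: nat. (\<lambda>_ :: 'n. k)))" by (rule rev_finite_subset) simp
    then have "finite (UNIV :: nat set)" by (rule finite_imageD) (auto simp: inj_def fun_eq_iff)
    then show False by simp
  qed
  then show ?thesis
    unfolding enum_def by (intro bij_betw_from_nat_into) auto
qed

sublocale gaussian_sequence M "\<lambda>k. a (enum k)"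
proof
  show "std_complex_gaussian M (a (enum k))" for k by (rule gaussian)
  have "inj enum" using bij_enum by (rule bij_is_inj)
  have rv: "\<And>\<alpha>. random_variable borel (a \<alpha>)" using indep by (simp add: indep_vars_def)
  show "indep_vars (\<lambda>_. borel) (\<lambda>k. a (enum k)) UNIV"
    unfolding indep_vars_def2
  proof (intro conjI ballI)
    show "random_variable borel (a (enum k))" for k by (rule rv)
    have ind: "indep_sets (\<lambda>\<alpha>. {a \<alpha> -` A \<inter> space M | A. A \<in> sets borel}) UNIV"
      using indep by (simp add: indep_vars_def2)
    show "indep_sets (\<lambda>k. {a (enum k) -` A \<inter> space M | A. A \<in> sets borel}) UNIV"
    proof (rule indep_setsI)
      show "{a (enum k) -` A \<inter> space M |A. A \<in> sets borel} \<subseteq> events" for k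
        using rv by (auto simp: measurable_sets)
      fix B J assume J: "(J :: nat set) \<noteq> {}" "J \<subseteq> UNIV" "finite J"
        "\<forall>k\<in>J. B k \<in> {a (enum k) -` A \<inter> space M |A. A \<in> sets borel}"
      have e: "inv enum (enum k) = k" for k using \<open>inj enum\<close> by simp
      \<comment> \<open>Independence is stated over multi-indices, so the events indexed by
        \<open>J\<close> are carried over through the inverse enumeration.\<close>
      have "prob (\<Inter>\<alpha>\<in>enum ` J. B (inv enum \<alpha>)) = (\<Prod>\<alpha>\<in>enum ` J. prob (B (inv enum \<alpha>)))"
        by (rule indep_setsD[OF ind]) (use J e in auto)
      then show "prob (\<Inter>k\<in>J. B k) = (\<Prod>k\<in>J. prob (B k))"
        using \<open>inj enum\<close> by (simp add: e prod.reindex inj_on_subset)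
    qed
  qed
qed

definition field :: "real \<Rightarrow> complex ^ 'n \<Rightarrow> 'w \<Rightarrow> complex" where
  "field L z \<omega> = hyperbolic_series L (\<lambda>\<alpha>. a \<alpha> \<omega>) z"

lemma field_eq:
  "field L z \<omega> = (if (\<Sum>k. ennreal (cmod (a (enum k) \<omega> * gaf_basis L z (enum k)))) < \<infinity>
      then (\<Sum>k. a (enum k) \<omega> * gaf_basis L z (enum k)) else 0)"
proof -
  have "field L z \<omega> = (\<Sum>\<^sub>\<infinity>\<alpha>. a \<alpha> \<omega> * gaf_basis L z \<alpha>)"
    by (simp add: field_def hyperbolic_series_def gaf_basis_def gaf_coeff_def mult.assoc)
  also have "\<dots> = (\<Sum>\<^sub>\<infinity>k. a (enum k) \<omega> * gaf_basis L z (enum k))"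
    by (rule infsum_reindex_bij_betw[OF bij_enum, symmetric])
  finally show ?thesis by (simp only: infsum_complex_eq_suminf)
qed

lemma gaf_basis_measurable [measurable]: "(\<lambda>z. gaf_basis L z \<alpha>) \<in> borel_measurable borel"
proof -
  have "continuous_on UNIV (\<lambda>z. gaf_basis L z \<alpha>)"
    unfolding gaf_basis_def by (intro continuous_intros)
  then show ?thesis by (rule borel_measurable_continuous_onI)
qed

text \<open>Measurability in both variables jointly is what the exchange of expectation and
  integration over the ball requires.\<close>

lemma field_measurable [measurable]: "(\<lambda>(\<omega>, z). field L z \<omega>) \<in> borel_measurable (M \<Otimes>\<^sub>M borel)"
proof -
  have "(\<lambda>p. if (\<Sum>k. ennreal (cmod (F k p))) < \<infinity> then (\<Sum>k. F k p) else 0) \<in> borel_measurable N"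
    if [measurable]: "\<And>k. F k \<in> borel_measurable N" for F :: "nat \<Rightarrow> ('w \<times> (complex ^ 'n)) \<Rightarrow> complex" and N
    by measurable
  from this[of "\<lambda>k p. a (enum k) (fst p) * gaf_basis L (snd p) (enum k)" "M \<Otimes>\<^sub>M borel"]
  show ?thesis unfolding field_eq case_prod_unfold by measurable
qed

lemma basis_abs_summable:
  assumes "0 < L" "norm z < 1"
  shows "summable (\<lambda>k. cmod (gaf_basis L z (enum k)))"
proof -
  have "(\<lambda>k. cmod (gaf_basis L z (enum k))) summable_on UNIV"
    using gaf_basis_abs_summable[OF assms] summable_on_reindex_bij_betw[OF bij_enum, of "\<lambda>\<alpha>. cmod (gaf_basis L z \<alpha>)"] by simp
  then show ?thesis
    by (simp add: summable_on_UNIV_nonneg_real_iff)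
qed

text \<open>The exceptional null set depends on \<open>z\<close>. This suffices, because
  expectations are always taken at one or two fixed points.\<close>

lemma AE_field_eq_series:
  assumes "0 < L" "norm z < 1"
  shows "AE \<omega> in M. field L z \<omega> = series (\<lambda>k. gaf_basis L z (enum k)) \<omega>"
proof -
  show ?thesis
    using AE_summable[OF basis_abs_summable[OF assms]]
  proof eventually_elim
    case (elim \<omega>)
    have "(\<Sum>k. ennreal (cmod (a (enum k) \<omega> * gaf_basis L z (enum k)))) = ennreal (\<Sum>k. cmod (a (enum k) \<omega> * gaf_basis L z (enum k)))"
      by (rule suminf_ennreal_eq[OF _ summable_sums[OF elim]]) simp
    then show ?case by (simp add: field_eq series_def)
  qed
qed

lemma basis_kernel_sums:
  assumes L: "0 < L" and z: "norm z < 1" and w: "norm w < 1"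
  shows "(\<lambda>k. gaf_basis L z (enum k) * cnj (gaf_basis L w (enum k))) sums (1 - herm z w) powr (- of_real L)"
    and "(\<lambda>k. (cmod (gaf_basis L z (enum k)))\<^sup>2) sums (1 - (norm z)\<^sup>2) powr (- L)"
proof -
  have *: "(\<lambda>k. gaf_basis L z (enum k) * cnj (gaf_basis L w (enum k))) sums (1 - herm z w) powr (- of_real L)"
    if "norm z < 1" "norm w < 1" for z w
    using gaf_basis_kernel(2)[OF L that] has_sum_reindex_bij_betw[OF bij_enum, of "\<lambda>\<alpha>. gaf_basis L z \<alpha> * cnj (gaf_basis L w \<alpha>)"]
    by (intro has_sum_imp_sums) simp
  then show "(\<lambda>k. gaf_basis L z (enum k) * cnj (gaf_basis L w (enum k))) sums (1 - herm z w) powr (- of_real L)"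
    using z w .
  have "0 < 1 - (norm z)\<^sup>2" using z by (simp add: abs_square_less_1)
  then have r: "(1 - herm z z) powr (- of_real L) = complex_of_real ((1 - (norm z)\<^sup>2) powr (- L))"
    using powr_of_real[of "1 - (norm z)\<^sup>2" "- L"] by (simp add: herm_self)
  from sums_Re[OF *[OF z z]] show "(\<lambda>k. (cmod (gaf_basis L z (enum k)))\<^sup>2) sums (1 - (norm z)\<^sup>2) powr (- L)"
    unfolding complex_norm_square[symmetric] r Re_complex_of_real .
qed

text \<open>The squared modulus divided by its mean \<open>K\<^sub>L(z, z)\<close>, so that it is
  exponential of rate 1.\<close>

definition intensity :: "real \<Rightarrow> complex ^ 'n \<Rightarrow> 'w \<Rightarrow> real" where
  "intensity L z \<omega> = (1 - (norm z)\<^sup>2) powr L * (cmod (field L z \<omega>))\<^sup>2"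

lemma field_measurable_fst [measurable]: "field L z \<in> borel_measurable M"
proof -
  have "(\<lambda>\<omega>. (case (\<omega>, z) of (\<omega>, z) \<Rightarrow> field L z \<omega>)) \<in> borel_measurable M"
    by (rule measurable_compose[OF _ field_measurable]) measurable
  then show ?thesis by simp
qed

lemma intensity_measurable [measurable]: "intensity L z \<in> borel_measurable M"
  unfolding intensity_def[abs_def] by measurable

text \<open>The joint Laplace transform of the series is evaluated at \<open>t\<close> and
  \<open>s\<close> divided by the kernel on the diagonal; the correlation term then becomes a power
  of the kernel ratio.\<close>

lemma exponential_pair_intensity:
  assumes L: "0 < L" and z: "norm z < 1" and w: "norm w < 1"
  shows "exponential_pair M (intensity L z) (intensity L w) (kernel_ratio z w powr L)"
proof
  have z1: "0 < 1 - (norm z)\<^sup>2" and w1: "0 < 1 - (norm w)\<^sup>2" using z w by (auto simp: abs_square_less_1)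
  note k = one_minus_kernel_ratio[OF z w]
  show "0 \<le> kernel_ratio z w powr L" by simp
  show "kernel_ratio z w powr L \<le> 1" using k L by (intro powr_le1) auto
  show "0 \<le> intensity L z \<omega>" "0 \<le> intensity L w \<omega>" for \<omega> by (auto simp: intensity_def)
  show "intensity L z \<in> borel_measurable M" "intensity L w \<in> borel_measurable M" by measurable
  fix t s :: real assume t: "0 \<le> t" and s: "0 \<le> s"
  define a where "a = (1 - (norm z)\<^sup>2) powr L"
  define b where "b = (1 - (norm w)\<^sup>2) powr L"
  have ab: "0 < a" "0 < b" using z1 w1 by (auto simp: a_def b_def)
  let ?u = "\<lambda>k. gaf_basis L z (enum k)" and ?v = "\<lambda>k. gaf_basis L w (enum k)"
  have "expectation (\<lambda>\<omega>. exp (- (t * intensity L z \<omega>)) * exp (- (s * intensity L w \<omega>)))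
      = expectation (\<lambda>\<omega>. exp (- (t * a * (cmod (series ?u \<omega>))\<^sup>2)) * exp (- (s * b * (cmod (series ?v \<omega>))\<^sup>2)))"
  proof (rule integral_cong_AE)
    show "AE \<omega> in M. exp (- (t * intensity L z \<omega>)) * exp (- (s * intensity L w \<omega>))
      = exp (- (t * a * (cmod (series ?u \<omega>))\<^sup>2)) * exp (- (s * b * (cmod (series ?v \<omega>))\<^sup>2))"
      using AE_field_eq_series[OF L z] AE_field_eq_series[OF L w]
      by eventually_elim (simp add: intensity_def a_def b_def mult.assoc)
  qed measurable
  also have "\<dots> = 1 / ((1 + t * a * (1 - (norm z)\<^sup>2) powr (- L)) * (1 + s * b * (1 - (norm w)\<^sup>2) powr (- L))
      - t * a * (s * b) * (cmod ((1 - herm z w) powr (- of_real L)))\<^sup>2)"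
    using t s ab
    by (intro laplace_pair basis_abs_summable basis_kernel_sums[OF L z w] basis_kernel_sums(2)[OF L _ w, of z] basis_kernel_sums(2)[OF L w w] L z w) auto
  also have "t * a * (1 - (norm z)\<^sup>2) powr (- L) = t" using z1 by (simp add: a_def powr_minus)
  also have "s * b * (1 - (norm w)\<^sup>2) powr (- L) = s" using w1 by (simp add: b_def powr_minus)
  also have "t * a * (s * b) * (cmod ((1 - herm z w) powr (- of_real L)))\<^sup>2 = t * s * kernel_ratio z w powr L"
  proof -
    have ne: "1 - herm z w \<noteq> 0" using herm_norm_less[OF z w] by auto
    \<comment> \<open>The exponent is real, so the modulus of the complex power depends only on the
      modulus of its base.\<close>
    have "(cmod ((1 - herm z w) powr (- of_real L)))\<^sup>2 = exp (- (2 * L * ln (cmod (1 - herm z w))))"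
      using ne by (simp add: powr_def norm_exp_eq_Re exp_double[symmetric])
    also have "\<dots> = 1 / (cmod (1 - herm z w))\<^sup>2 powr L"
      using ne by (simp add: powr_def ln_realpow exp_minus divide_inverse)
    finally show ?thesis
      unfolding kernel_ratio_def using z1 w1 ne by (simp add: a_def b_def powr_divide powr_mult)
  qed
  finally show "expectation (\<lambda>\<omega>. exp (- (t * intensity L z \<omega>)) * exp (- (s * intensity L w \<omega>)))
     = 1 / ((1 + t) * (1 + s) - t * s * kernel_ratio z w powr L)" .
qed

lemma exponential_variable_intensity:
  assumes "0 < L" "norm z < 1"
  shows "exponential_variable M (intensity L z)"
  by (rule exponential_pair.exponential_variable_fst[OF exponential_pair_intensity[OF assms assms(2)]])

definition log_field :: "real \<Rightarrow> complex ^ 'n \<Rightarrow> 'w \<Rightarrow> real" where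
  "log_field L z \<omega> = ln ((cmod (field L z \<omega>))\<^sup>2)"

lemma log_field_measurable [measurable]: "(\<lambda>(\<omega>, z). log_field L z \<omega>) \<in> borel_measurable (M \<Otimes>\<^sub>M borel)"
  unfolding log_field_def by measurable

lemma log_field_measurable_fst [measurable]: "log_field L z \<in> borel_measurable M"
  unfolding log_field_def[abs_def] by measurable

text \<open>At a zero of the field the logarithm takes a default value and the identity may fail;
  positivity of the intensity excludes this almost surely.\<close>

lemma AE_log_field:
  assumes L: "0 < L" and z: "norm z < 1"
  shows "AE \<omega> in M. log_field L z \<omega> = ln (intensity L z \<omega>) - L * ln (1 - (norm z)\<^sup>2)"
proof -
  have z1: "0 < 1 - (norm z)\<^sup>2" using z by (simp add: abs_square_less_1)
  show ?thesis using exponential_variable.AE_pos[OF exponential_variable_intensity[OF L z]]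
  proof eventually_elim
    case (elim \<omega>)
    then have "cmod (field L z \<omega>) \<noteq> 0" by (auto simp: intensity_def)
    then show ?case using z1 by (simp add: log_field_def intensity_def ln_mult ln_powr)
  qed
qed

text \<open>The logarithm of the field differs from that of the intensity by a deterministic
  constant, which does not affect covariances. The explicit second-moment bound gives uniformity on
  compact subsets of the ball.\<close>

lemma log_field_moments:
  assumes L: "0 < L" and z: "norm z < 1" and w: "norm w < 1"
  shows "integrable M (log_field L z)" "integrable M (\<lambda>\<omega>. (log_field L z \<omega>)\<^sup>2)"
    "expectation (\<lambda>\<omega>. (log_field L z \<omega>)\<^sup>2) \<le> 2 * (4 + 16 * Gamma (1/2)) + 2 * (L * ln (1 - (norm z)\<^sup>2))\<^sup>2"
    "expectation (\<lambda>\<omega>. log_field L z \<omega> * log_field L w \<omega>) - expectation (log_field L z) * expectation (log_field L w)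
      = dilog (kernel_ratio z w powr L)"
proof -
  note pair = exponential_pair_intensity[OF L z w]
  note X = exponential_variable_intensity[OF L z] and Y = exponential_variable_intensity[OF L w]
  note X_ln = exponential_variable.integrable_ln[OF X] and Y_ln = exponential_variable.integrable_ln[OF Y]
  note X_ln2 = exponential_variable.integrable_ln_squared[OF X]
  define c where "c = L * ln (1 - (norm z)\<^sup>2)"
  define d where "d = L * ln (1 - (norm w)\<^sup>2)"
  let ?x = "\<lambda>\<omega>. ln (intensity L z \<omega>)" and ?y = "\<lambda>\<omega>. ln (intensity L w \<omega>)"
  have az: "AE \<omega> in M. log_field L z \<omega> = ?x \<omega> - c" and aw: "AE \<omega> in M. log_field L w \<omega> = ?y \<omega> - d"
    using AE_log_field[OF L z] AE_log_field[OF L w] by (simp_all add: c_def d_def)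
  have Ez: "expectation (log_field L z) = expectation (\<lambda>\<omega>. ?x \<omega> - c)"
    by (rule integral_cong_AE) (use az in auto)
  have Ew: "expectation (log_field L w) = expectation (\<lambda>\<omega>. ?y \<omega> - d)"
    by (rule integral_cong_AE) (use aw in auto)
  show "integrable M (log_field L z)"
    by (rule integrable_cong_AE_imp[of _ "\<lambda>\<omega>. ?x \<omega> - c"]) (use az X_ln in \<open>auto elim: eventually_mono\<close>)
  have sq: "integrable M (\<lambda>\<omega>. (?x \<omega> - c)\<^sup>2)"
    using X_ln X_ln2 by (simp add: power2_diff)
  have az2: "AE \<omega> in M. (log_field L z \<omega>)\<^sup>2 = (?x \<omega> - c)\<^sup>2"
    using az by eventually_elim simp
  show int2: "integrable M (\<lambda>\<omega>. (log_field L z \<omega>)\<^sup>2)"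
    by (rule integrable_cong_AE_imp[OF sq]) (use az2 in \<open>auto elim: eventually_mono\<close>)
  have G: "0 < Gamma (1/2 :: real)" by (rule Gamma_real_pos) simp
  have Ex2: "expectation (\<lambda>\<omega>. (?x \<omega>)\<^sup>2) \<le> 4 + 16 * Gamma (1/2)"
  proof -
    have "ennreal (expectation (\<lambda>\<omega>. (?x \<omega>)\<^sup>2)) \<le> ennreal (4 + 16 * Gamma (1/2))"
      using exponential_variable.nn_integral_ln_squared[OF X] by (simp add: nn_integral_eq_integral[OF X_ln2])
    then show ?thesis using G by (subst (asm) ennreal_le_iff) auto
  qed
  have "expectation (\<lambda>\<omega>. (log_field L z \<omega>)\<^sup>2) = expectation (\<lambda>\<omega>. (?x \<omega> - c)\<^sup>2)"
    by (rule integral_cong_AE) (use az2 in auto)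
  also have "\<dots> \<le> expectation (\<lambda>\<omega>. 2 * (?x \<omega>)\<^sup>2 + 2 * c\<^sup>2)"
  proof (rule integral_mono[OF sq])
    show "integrable M (\<lambda>\<omega>. 2 * (?x \<omega>)\<^sup>2 + 2 * c\<^sup>2)" using X_ln2 by simp
    show "(?x \<omega> - c)\<^sup>2 \<le> 2 * (?x \<omega>)\<^sup>2 + 2 * c\<^sup>2" for \<omega>
      using zero_le_power2[of "?x \<omega> + c"] by (simp add: power2_sum power2_diff)
  qed
  also have "\<dots> = 2 * expectation (\<lambda>\<omega>. (?x \<omega>)\<^sup>2) + 2 * c\<^sup>2"
    using X_ln2 by (simp add: prob_space)
  also have "\<dots> \<le> 2 * (4 + 16 * Gamma (1/2)) + 2 * c\<^sup>2"
    by (intro add_right_mono mult_left_mono Ex2) simp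
  finally show "expectation (\<lambda>\<omega>. (log_field L z \<omega>)\<^sup>2) \<le> 2 * (4 + 16 * Gamma (1/2)) + 2 * (L * ln (1 - (norm z)\<^sup>2))\<^sup>2"
    by (simp only: c_def)
  have "expectation (\<lambda>\<omega>. log_field L z \<omega> * log_field L w \<omega>) = expectation (\<lambda>\<omega>. (?x \<omega> - c) * (?y \<omega> - d))"
  proof (rule integral_cong_AE)
    show "AE \<omega> in M. log_field L z \<omega> * log_field L w \<omega> = (?x \<omega> - c) * (?y \<omega> - d)"
      using az aw by eventually_elim simp
  qed measurable
  also have "\<dots> = expectation (\<lambda>\<omega>. ?x \<omega> * ?y \<omega> - d * ?x \<omega> - c * ?y \<omega> + c * d)"
    by (simp add: algebra_simps)
  also have "\<dots> = expectation (\<lambda>\<omega>. ?x \<omega> * ?y \<omega>) - d * expectation ?x - c * expectation ?y + c * d"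
    using X_ln Y_ln exponential_pair.integrable_ln_mult[OF pair] by (simp add: prob_space)
  finally have E1: "expectation (\<lambda>\<omega>. log_field L z \<omega> * log_field L w \<omega>)
     = expectation (\<lambda>\<omega>. ?x \<omega> * ?y \<omega>) - d * expectation ?x - c * expectation ?y + c * d" .
  have E2: "expectation (\<lambda>\<omega>. ?x \<omega> - c) = expectation ?x - c" "expectation (\<lambda>\<omega>. ?y \<omega> - d) = expectation ?y - d"
    using X_ln Y_ln by (simp_all add: prob_space)
  show "expectation (\<lambda>\<omega>. log_field L z \<omega> * log_field L w \<omega>) - expectation (log_field L z) * expectation (log_field L w)
      = dilog (kernel_ratio z w powr L)"
    unfolding E1 Ez Ew E2 exponential_pair.covariance_ln[OF pair, symmetric] by (simp add: algebra_simps)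
qed

text \<open>The support of \<open>g\<close> stays within radius \<open>r < 1\<close>, where the
  second moments of the log field are uniformly bounded for fixed \<open>L\<close>; a multiple of
  the modulus of \<open>g\<close> then serves as the dominating function.\<close>

lemma variance_log_field_integral:
  fixes g :: "complex ^ 'n \<Rightarrow> real"
  assumes L: "0 < L" and g: "integrable invariant_measure g" and r: "r < 1" "\<And>z. g z \<noteq> 0 \<Longrightarrow> norm z \<le> r"
  shows "variance (\<lambda>\<omega>. \<integral>z. g z * log_field L z \<omega> \<partial>invariant_measure)
     = (\<integral>z. (\<integral>w. g z * g w * dilog (kernel_ratio z w powr L) \<partial>invariant_measure) \<partial>invariant_measure)"
proof -
  have [measurable]: "g \<in> borel_measurable borel" using borel_measurable_integrable[OF g] by simp
  have G: "0 < Gamma (1/2 :: real)" by (rule Gamma_real_pos) simp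
  define C0 where "C0 = 2 * (4 + 16 * Gamma (1/2)) + 2 * (L * ln (1 - r\<^sup>2))\<^sup>2"
  \<comment> \<open>Adding 1 makes one constant serve both hypotheses: it dominates 1 and
    \<open>C0\<close> for the first moment, and \<open>C * C\<close> dominates \<open>C0\<close> for
    the mixed one.\<close>
  define C where "C = 1 + C0"
  have C0: "0 \<le> C0" using G by (auto simp: C0_def intro!: add_nonneg_nonneg)
  have E2: "expectation (\<lambda>\<omega>. (log_field L z \<omega>)\<^sup>2) \<le> C0" if "norm z \<le> r" for z
  proof -
    have z: "norm z < 1" using that r by simp
    have z1: "0 < 1 - (norm z)\<^sup>2" "1 - (norm z)\<^sup>2 \<le> 1" using z by (auto simp: abs_square_less_1)
    have "(norm z)\<^sup>2 \<le> r\<^sup>2" using that by (intro power_mono) auto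
    moreover have "r\<^sup>2 < 1" using r that norm_ge_zero[of z] by (subst abs_square_less_1) linarith
    ultimately have "ln (1 - r\<^sup>2) \<le> ln (1 - (norm z)\<^sup>2)" "ln (1 - (norm z)\<^sup>2) \<le> 0"
      using z1 by auto
    then have "\<bar>ln (1 - (norm z)\<^sup>2)\<bar> \<le> \<bar>ln (1 - r\<^sup>2)\<bar>" by linarith
    then have "(L * ln (1 - (norm z)\<^sup>2))\<^sup>2 \<le> (L * ln (1 - r\<^sup>2))\<^sup>2"
      using L by (simp add: abs_le_square_iff[symmetric] abs_mult)
    then show ?thesis using log_field_moments(3)[OF L z z] by (simp add: C0_def)
  qed
  define V where "V \<omega> z = g z * log_field L z \<omega>" for \<omega> z
  have nn2: "(\<integral>\<^sup>+\<omega>. ennreal ((log_field L z \<omega>)\<^sup>2) \<partial>M) \<le> ennreal C0" if "norm z \<le> r" for z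
    using E2[OF that] log_field_moments(2)[OF L, of z z] that r
    by (subst nn_integral_eq_integral) (auto intro: ennreal_leI)
  have half: "(\<integral>\<^sup>+\<omega>. ennreal (x * ((f \<omega>)\<^sup>2 + (h \<omega>)\<^sup>2)) \<partial>M) \<le> ennreal (x * (2 * c))"
    if "0 \<le> x" "0 \<le> c" and [measurable]: "f \<in> borel_measurable M" "h \<in> borel_measurable M"
      and "(\<integral>\<^sup>+\<omega>. ennreal ((f \<omega>)\<^sup>2) \<partial>M) \<le> ennreal c" "(\<integral>\<^sup>+\<omega>. ennreal ((h \<omega>)\<^sup>2) \<partial>M) \<le> ennreal c"
    for x c :: real and f h
  proof -
    have "(\<integral>\<^sup>+\<omega>. ennreal (x * ((f \<omega>)\<^sup>2 + (h \<omega>)\<^sup>2)) \<partial>M) = ennreal x * ((\<integral>\<^sup>+\<omega>. ennreal ((f \<omega>)\<^sup>2) \<partial>M) + (\<integral>\<^sup>+\<omega>. ennreal ((h \<omega>)\<^sup>2) \<partial>M))"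
      using that(1) by (simp add: ennreal_mult ennreal_plus nn_integral_cmult nn_integral_add)
    also have "\<dots> \<le> ennreal x * (ennreal c + ennreal c)"
      using that by (intro mult_left_mono add_mono) auto
    also have "\<dots> = ennreal (x * (2 * c))" using that by (simp add: ennreal_mult[symmetric] ennreal_plus[symmetric] del: ennreal_plus)
    finally show ?thesis .
  qed
  have amgm: "\<bar>p * q\<bar> \<le> (p\<^sup>2 + q\<^sup>2) / 2" for p q :: real
    using zero_le_power2[of "\<bar>p\<bar> - \<bar>q\<bar>"] by (simp add: power2_diff abs_mult)
  have one: "(\<integral>\<^sup>+\<omega>. ennreal ((1 :: real)\<^sup>2) \<partial>M) \<le> ennreal C" using C0 by (simp add: emeasure_space_1 C_def)
  have C0C: "ennreal C0 \<le> ennreal C" by (intro ennreal_leI) (simp add: C_def)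
  have N: "sigma_finite_measure (invariant_measure :: (complex ^ 'n) measure)" by (rule sigma_finite_invariant_measure)
  have "variance (\<lambda>\<omega>. \<integral>z. V \<omega> z \<partial>invariant_measure)
     = (\<integral>z. (\<integral>w. expectation (\<lambda>\<omega>. V \<omega> z * V \<omega> w) - expectation (\<lambda>\<omega>. V \<omega> z) * expectation (\<lambda>\<omega>. V \<omega> w) \<partial>invariant_measure) \<partial>invariant_measure)"
  proof (rule variance_random_integral[OF N, where b="\<lambda>z. \<bar>g z\<bar> * C"])
    show "(\<lambda>(\<omega>, z). V \<omega> z) \<in> borel_measurable (M \<Otimes>\<^sub>M invariant_measure)"
      unfolding V_def by measurable
    show "integrable invariant_measure (\<lambda>z. \<bar>g z\<bar> * C)" using g by simp
    show "0 \<le> \<bar>g z\<bar> * C" for z using C0 by (simp add: C_def)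
    show "(\<integral>\<^sup>+\<omega>. ennreal \<bar>V \<omega> z\<bar> \<partial>M) \<le> ennreal (\<bar>g z\<bar> * C)" for z
    proof (cases "g z = 0")
      case False
      have "(\<integral>\<^sup>+\<omega>. ennreal \<bar>V \<omega> z\<bar> \<partial>M) \<le> (\<integral>\<^sup>+\<omega>. ennreal ((\<bar>g z\<bar> / 2) * (1\<^sup>2 + (log_field L z \<omega>)\<^sup>2)) \<partial>M)"
      proof (intro nn_integral_mono ennreal_leI)
        fix \<omega>
        show "\<bar>V \<omega> z\<bar> \<le> (\<bar>g z\<bar> / 2) * (1\<^sup>2 + (log_field L z \<omega>)\<^sup>2)"
          using mult_left_mono[OF amgm[of 1 "log_field L z \<omega>"], of "\<bar>g z\<bar>"] by (simp add: V_def abs_mult)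
      qed
      also have "\<dots> \<le> ennreal ((\<bar>g z\<bar> / 2) * (2 * C))"
        using C0 order_trans[OF nn2[OF r(2)[OF False]] C0C] one by (intro half) (auto simp: C_def)
      finally show ?thesis by simp
    qed (simp add: V_def)
    show "(\<integral>\<^sup>+\<omega>. ennreal \<bar>V \<omega> z * V \<omega> w\<bar> \<partial>M) \<le> ennreal (\<bar>g z\<bar> * C * (\<bar>g w\<bar> * C))" for z w
    proof (cases "g z = 0 \<or> g w = 0")
      case False
      have "(\<integral>\<^sup>+\<omega>. ennreal \<bar>V \<omega> z * V \<omega> w\<bar> \<partial>M) \<le> (\<integral>\<^sup>+\<omega>. ennreal ((\<bar>g z\<bar> * \<bar>g w\<bar> / 2) * ((log_field L z \<omega>)\<^sup>2 + (log_field L w \<omega>)\<^sup>2)) \<partial>M)"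
      proof (intro nn_integral_mono ennreal_leI)
        fix \<omega>
        show "\<bar>V \<omega> z * V \<omega> w\<bar> \<le> (\<bar>g z\<bar> * \<bar>g w\<bar> / 2) * ((log_field L z \<omega>)\<^sup>2 + (log_field L w \<omega>)\<^sup>2)"
          using mult_left_mono[OF amgm[of "log_field L z \<omega>" "log_field L w \<omega>"], of "\<bar>g z\<bar> * \<bar>g w\<bar>"]
          by (simp add: V_def abs_mult mult_ac)
      qed
      also have "\<dots> \<le> ennreal ((\<bar>g z\<bar> * \<bar>g w\<bar> / 2) * (2 * C0))"
        using C0 nn2 r(2) False by (intro half) auto
      also have "\<dots> \<le> ennreal (\<bar>g z\<bar> * C * (\<bar>g w\<bar> * C))"
      proof (rule ennreal_leI)
        have "C0 * 1 \<le> C * C" using C0 by (intro mult_mono) (auto simp: C_def)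
        then have "(\<bar>g z\<bar> * \<bar>g w\<bar>) * C0 \<le> (\<bar>g z\<bar> * \<bar>g w\<bar>) * (C * C)" by (intro mult_left_mono) auto
        then show "(\<bar>g z\<bar> * \<bar>g w\<bar> / 2) * (2 * C0) \<le> \<bar>g z\<bar> * C * (\<bar>g w\<bar> * C)" by (simp add: mult_ac)
      qed
      finally show ?thesis .
    qed (auto simp: V_def)
  qed
  also have "\<dots> = (\<integral>z. (\<integral>w. g z * g w * dilog (kernel_ratio z w powr L) \<partial>invariant_measure) \<partial>invariant_measure)"
  proof (intro Bochner_Integration.integral_cong refl)
    fix z w :: "complex ^ 'n"
    show "expectation (\<lambda>\<omega>. V \<omega> z * V \<omega> w) - expectation (\<lambda>\<omega>. V \<omega> z) * expectation (\<lambda>\<omega>. V \<omega> w)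
       = g z * g w * dilog (kernel_ratio z w powr L)"
    proof (cases "g z = 0 \<or> g w = 0")
      case False
      then have zw: "norm z < 1" "norm w < 1" using r by force+
      have "V \<omega> z * V \<omega> w = (g z * g w) * (log_field L z \<omega> * log_field L w \<omega>)" for \<omega> by (simp add: V_def)
      then have "expectation (\<lambda>\<omega>. V \<omega> z * V \<omega> w) - expectation (\<lambda>\<omega>. V \<omega> z) * expectation (\<lambda>\<omega>. V \<omega> w)
        = (g z * g w) * (expectation (\<lambda>\<omega>. log_field L z \<omega> * log_field L w \<omega>) - expectation (log_field L z) * expectation (log_field L w))"
        by (simp add: V_def algebra_simps)
      then show ?thesis by (simp only: log_field_moments(4)[OF L zw])
    qed (auto simp: V_def)
  qed
  finally show ?thesis unfolding V_def .
qed

end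

section \<open>Asymptotics of the variance\<close>

text \<open>The Gamma quotient is the reciprocal of the product (s - n) ... (s - 1), whose factors
  lie between s - n and s. The recursion J(s + 1) = J(s) (s - n) / s gives the difference exactly as
  J(s) n / s.\<close>

lemma kernel_mass_bounds:
  fixes n :: nat
  assumes s: "real n < s" "2 * (real n)\<^sup>2 \<le> s"
  shows "\<bar>kernel_mass n s - fact n / s ^ n\<bar> \<le> 2 * (real n)\<^sup>2 * fact n / s ^ (n + 1)"
    and "kernel_mass n s - kernel_mass n (s + 1) \<le> 2 * fact n * real n / s ^ (n + 1)"
proof -
  have s0: "0 < s" using s(1) by linarith
  have x: "0 < s - real n" using s by simp
  then have npos: "s - real n \<notin> \<int>\<^sub>\<le>\<^sub>0" by (auto elim!: nonpos_Ints_cases)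
  have G: "0 < Gamma (s - real n)" "0 < Gamma s" using x s0 by (auto intro: Gamma_real_pos)
  define p where "p = pochhammer (s - real n) n"
  have p: "p = Gamma s / Gamma (s - real n)"
    unfolding p_def using pochhammer_Gamma[OF npos, of n] by simp
  have p0: "0 < p" unfolding p using G by simp
  have mass: "kernel_mass n s = fact n / p"
    unfolding kernel_mass_def p using G by simp
  have pp: "p = (\<Prod>i = 0..<n. s - real n + real i)"
    unfolding p_def pochhammer_prod ..
  have p_le: "p \<le> s ^ n"
    using prod_mono[of "{0..<n}" "\<lambda>i. s - real n + real i" "\<lambda>_. s"] x unfolding pp by simp
  have p_ge: "(s - real n) ^ n \<le> p"
    using prod_mono[of "{0..<n}" "\<lambda>_. s - real n" "\<lambda>i. s - real n + real i"] x unfolding pp by simp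
  \<comment> \<open>The relative loss in Bernoulli's inequality for (1 - n/s)^n; the hypothesis
    \<open>2 * (real n)\<^sup>2 \<le> s\<close> is precisely \<open>y \<le> 1/2\<close>.\<close>
  define y where "y = (real n)\<^sup>2 / s"
  have y: "0 \<le> y" "y \<le> 1/2" using s s0 by (auto simp: y_def field_simps)
  have "1 - y = 1 + real n * (- (real n / s))" by (simp add: y_def power2_eq_square)
  also have "\<dots> \<le> (1 + - (real n / s)) ^ n"
    using s s0 by (intro Bernoulli_inequality) (simp add: field_simps)
  also have "\<dots> = (s - real n) ^ n / s ^ n"
    using s0 by (simp add: power_divide[symmetric] diff_divide_distrib)
  finally have "(1 - y) * s ^ n \<le> (s - real n) ^ n" using s0 by (simp add: pos_le_divide_eq)
  then have yp: "(1 - y) * s ^ n \<le> p" using p_ge by linarith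
  have le: "fact n / p \<le> fact n / s ^ n * (1 + 2 * y)"
  proof -
    have "fact n / p \<le> fact n / ((1 - y) * s ^ n)"
      using yp y s0 p0 by (intro divide_left_mono) auto
    also have "\<dots> = fact n / s ^ n * (1 / (1 - y))" by simp
    also have "\<dots> \<le> fact n / s ^ n * (1 + 2 * y)"
    proof (rule mult_left_mono)
      have "0 \<le> y * (1 - 2 * y)" using y by simp
      then have "1 \<le> (1 + 2 * y) * (1 - y)" by (simp add: algebra_simps)
      then show "1 / (1 - y) \<le> 1 + 2 * y" using y by (simp add: divide_le_eq)
    qed (use s0 in simp)
    finally show ?thesis .
  qed
  have ge: "fact n / s ^ n \<le> fact n / p"
    using p_le p0 s0 by (intro divide_left_mono) auto
  have y2: "fact n / s ^ n * (2 * y) = 2 * (real n)\<^sup>2 * fact n / s ^ (n + 1)"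
    by (simp add: y_def mult_ac)
  show "\<bar>kernel_mass n s - fact n / s ^ n\<bar> \<le> 2 * (real n)\<^sup>2 * fact n / s ^ (n + 1)"
    unfolding mass y2[symmetric] using le ge by (simp add: algebra_simps)
  have "kernel_mass n (s + 1) = kernel_mass n s * ((s - real n) / s)"
  proof -
    have "Gamma (s + 1) = s * Gamma s" using s0 by (intro Gamma_plus1) (auto elim!: nonpos_Ints_cases)
    moreover have "Gamma (s + 1 - real n) = (s - real n) * Gamma (s - real n)"
      using Gamma_plus1[OF npos] by (simp add: algebra_simps)
    ultimately show ?thesis unfolding kernel_mass_def by (simp add: mult_ac)
  qed
  moreover have "x - x * ((s - real n) / s) = x * (real n / s)" for x
    using s0 by (simp add: diff_divide_distrib right_diff_distrib)
  ultimately have "kernel_mass n s - kernel_mass n (s + 1) = fact n / p * (real n / s)"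
    by (simp only: mass)
  \<comment> \<open>Here \<open>1 + 2 * y \<le> 2\<close>, which produces the factor 2 in the
    bound.\<close>
  also have "\<dots> \<le> (fact n / s ^ n * (1 + 1)) * (real n / s)"
    using le y s0 by (intro mult_right_mono order_trans[OF le] mult_left_mono) auto
  also have "\<dots> = 2 * fact n * real n / s ^ (n + 1)" by (simp add: mult_ac)
  finally show "kernel_mass n s - kernel_mass n (s + 1) \<le> 2 * fact n * real n / s ^ (n + 1)" .
qed

lemma dilog_powr: "0 < x \<Longrightarrow> dilog (x powr L) = (\<Sum>k. x powr (real (Suc k) * L) / (real (Suc k))\<^sup>2)"
  unfolding dilog_def by (intro suminf_cong) (simp add: powr_power mult.commute del: of_nat_Suc power_Suc)

lemma dilog_measurable [measurable]: "dilog \<in> borel_measurable borel"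
  unfolding dilog_def by measurable

lemma summable_inverse_squares: "summable (\<lambda>k. 1 / (real (Suc k))\<^sup>2)"
  using summable_dilog[of 1] by simp

text \<open>The kernel ratio is at most 1 on the support, so the terms are dominated by |D z| |D w|
  / (k + 1)^2, which is both integrable and summable; sum and double integral may be
  exchanged.\<close>

lemma integral_dilog_series:
  fixes D :: "complex ^ 'n::finite \<Rightarrow> real"
  assumes D: "integrable invariant_measure D" and out: "\<And>z. D z \<noteq> 0 \<Longrightarrow> norm z < 1" and L: "0 < L"
  defines "Q \<equiv> \<lambda>s. \<integral>p. (case p of (z, w) \<Rightarrow> D z * D w * kernel_ratio z w powr s) \<partial>(invariant_measure \<Otimes>\<^sub>M invariant_measure)"
  shows "summable (\<lambda>k. Q (real (Suc k) * L) / (real (Suc k))\<^sup>2)"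
    and "(\<integral>z. (\<integral>w. D z * D w * dilog (kernel_ratio z w powr L) \<partial>invariant_measure) \<partial>invariant_measure)
      = (\<Sum>k. Q (real (Suc k) * L) / (real (Suc k))\<^sup>2)"
proof -
  let ?\<mu> = "invariant_measure :: (complex ^ 'n) measure"
  let ?\<mu>2 = "?\<mu> \<Otimes>\<^sub>M ?\<mu>"
  interpret \<mu>: sigma_finite_measure ?\<mu> by (rule sigma_finite_invariant_measure)
  interpret \<mu>\<mu>: pair_sigma_finite ?\<mu> ?\<mu> ..
  have [measurable]: "D \<in> borel_measurable borel"
    using borel_measurable_integrable[OF D] by simp
  let ?f = "\<lambda>k p. (case p of (z, w) \<Rightarrow> D z * D w * kernel_ratio z w powr (real (Suc k) * L)) / (real (Suc k))\<^sup>2"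
  let ?g = "\<lambda>p. (case p of (z, w) \<Rightarrow> \<bar>D z\<bar> * \<bar>D w\<bar>)"
  have g_int: "integrable ?\<mu>2 ?g"
    using D by (intro \<mu>\<mu>.integrable_mult_prod) auto
  have ratio: "D z * D w \<noteq> 0 \<Longrightarrow> 0 < kernel_ratio z w \<and> kernel_ratio z w \<le> 1" for z w
    using one_minus_kernel_ratio[of z w] out[of z] out[of w] by auto
  have f_le: "norm (?f k p) \<le> ?g p * (1 / (real (Suc k))\<^sup>2)" for k p
  proof -
    obtain z w where p: "p = (z, w)" by (cases p)
    have "\<bar>D z * D w\<bar> * kernel_ratio z w powr (real (Suc k) * L) \<le> \<bar>D z * D w\<bar> * 1"
    proof (cases "D z * D w = 0")
      case False
      then show ?thesis using ratio[OF False] L by (intro mult_left_mono powr_le1) auto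
    next
      case True
      show ?thesis unfolding True by simp
    qed
    then show ?thesis by (simp add: p abs_mult divide_right_mono del: of_nat_Suc)
  qed
  have f_int: "integrable ?\<mu>2 (?f k)" for k
  proof (rule Bochner_Integration.integrable_bound)
    show "integrable ?\<mu>2 (\<lambda>p. ?g p * (1 / (real (Suc k))\<^sup>2))" using g_int by (rule integrable_mult_left)
    show "AE p in ?\<mu>2. norm (?f k p) \<le> norm (?g p * (1 / (real (Suc k))\<^sup>2))"
    proof (rule AE_I2)
      fix p
      show "norm (?f k p) \<le> norm (?g p * (1 / (real (Suc k))\<^sup>2))"
        using order_trans[OF f_le[of k p] abs_ge_self] by (simp only: real_norm_def)
    qed
  qed measurable
  have sm_f: "summable (\<lambda>k. norm (?f k p))" for p
  proof (rule summable_comparison_test'[where N=0])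
    show "summable (\<lambda>k. ?g p * (1 / (real (Suc k))\<^sup>2))"
      by (intro summable_mult summable_inverse_squares)
    show "norm (norm (?f k p)) \<le> ?g p * (1 / (real (Suc k))\<^sup>2)" for k
      using f_le[of k p] by (simp only: real_norm_def abs_idempotent)
  qed
  have sm_int: "summable (\<lambda>k. \<integral>p. norm (?f k p) \<partial>?\<mu>2)"
  proof (rule summable_comparison_test'[where N=0])
    show "summable (\<lambda>k. (\<integral>p. ?g p \<partial>?\<mu>2) * (1 / (real (Suc k))\<^sup>2))"
      by (intro summable_mult summable_inverse_squares)
    show "norm (\<integral>p. norm (?f k p) \<partial>?\<mu>2) \<le> (\<integral>p. ?g p \<partial>?\<mu>2) * (1 / (real (Suc k))\<^sup>2)" for k
    proof -
      have "(\<integral>p. norm (?f k p) \<partial>?\<mu>2) \<le> (\<integral>p. ?g p * (1 / (real (Suc k))\<^sup>2) \<partial>?\<mu>2)"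
        by (rule integral_mono[OF integrable_norm[OF f_int] integrable_mult_left[OF g_int] f_le])
      moreover have "0 \<le> (\<integral>p. norm (?f k p) \<partial>?\<mu>2)" by (rule Bochner_Integration.integral_nonneg) simp
      ultimately show ?thesis by (simp only: real_norm_def abs_of_nonneg integral_mult_left_zero)
    qed
  qed
  have AE_sm: "AE p in ?\<mu>2. summable (\<lambda>k. norm (?f k p))" using sm_f by simp
  have Q: "(\<integral>p. ?f k p \<partial>?\<mu>2) = Q (real (Suc k) * L) / (real (Suc k))\<^sup>2" for k
    unfolding Q_def by (rule integral_divide_zero)
  have sums: "(\<lambda>k. \<integral>p. ?f k p \<partial>?\<mu>2) sums (\<integral>p. (\<Sum>k. ?f k p) \<partial>?\<mu>2)"
    by (rule sums_integral[OF f_int AE_sm sm_int])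
  then show "summable (\<lambda>k. Q (real (Suc k) * L) / (real (Suc k))\<^sup>2)"
    unfolding Q by (rule sums_summable)
  have eq: "(\<Sum>k. ?f k p) = (case p of (z, w) \<Rightarrow> D z * D w * dilog (kernel_ratio z w powr L))" for p
  proof -
    obtain z w where p: "p = (z, w)" by (cases p)
    show ?thesis
    proof (cases "D z * D w = 0")
      case False
      have r: "0 < kernel_ratio z w" using ratio[OF False] by simp
      have e: "?f k p = D z * D w * (kernel_ratio z w powr (real (Suc k) * L) / (real (Suc k))\<^sup>2)" for k
        by (simp add: p del: of_nat_Suc)
      have "summable (\<lambda>k. ?f k p)" using sm_f[of p] by (rule summable_norm_cancel)
      then have "summable (\<lambda>k. kernel_ratio z w powr (real (Suc k) * L) / (real (Suc k))\<^sup>2)"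
        unfolding e using False by (rule summable_mult_D)
      from suminf_mult[OF this, of "D z * D w"] show ?thesis
        unfolding e by (simp add: p dilog_powr[OF r] del: of_nat_Suc)
    qed (auto simp: p)
  qed
  have dil_int: "integrable ?\<mu>2 (\<lambda>p. case p of (z, w) \<Rightarrow> D z * D w * dilog (kernel_ratio z w powr L))"
    using integrable_suminf[OF f_int AE_sm sm_int] unfolding eq .
  have "(\<integral>z. (\<integral>w. D z * D w * dilog (kernel_ratio z w powr L) \<partial>?\<mu>) \<partial>?\<mu>)
     = (\<integral>p. (\<Sum>k. ?f k p) \<partial>?\<mu>2)"
    unfolding eq using \<mu>\<mu>.integral_fst'[OF dil_int] by simp
  also have "\<dots> = (\<Sum>k. Q (real (Suc k) * L) / (real (Suc k))\<^sup>2)"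
    using sums unfolding Q by (simp only: sums_iff)
  finally show "(\<integral>z. (\<integral>w. D z * D w * dilog (kernel_ratio z w powr L) \<partial>?\<mu>) \<partial>?\<mu>)
      = (\<Sum>k. Q (real (Suc k) * L) / (real (Suc k))\<^sup>2)" .
qed

lemma zeta_series_sums: "(\<lambda>k. 1 / real (Suc k) ^ (n + 2)) sums zeta (real n + 2)"
proof -
  have "real (Suc k) powr (real n + 2) = real (Suc k) ^ (n + 2)" for k
  proof -
    have "real (Suc k) powr real (n + 2) = real (Suc k) ^ (n + 2)" by (rule powr_realpow) simp
    then show ?thesis by (simp only: of_nat_add of_nat_numeral)
  qed
  moreover have "summable (\<lambda>k. 1 / real (Suc k) ^ (n + 2))"
  proof (rule summable_comparison_test'[OF summable_inverse_squares, where N=0])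
    fix k :: nat
    have "real (Suc k) ^ 2 \<le> real (Suc k) ^ (n + 2)" by (intro power_increasing) auto
    then show "norm (1 / real (Suc k) ^ (n + 2)) \<le> 1 / (real (Suc k))\<^sup>2"
      by (simp add: frac_le del: of_nat_Suc)
  qed
  ultimately show ?thesis
    unfolding zeta_def by (simp add: summable_sums del: of_nat_Suc)
qed

text \<open>The current acts by integrating the logarithm against the density of the form, so the
  statistic is real for every sample point. The indicator discards the values of \<open>D\<close>
  outside the ball, about which nothing is known.\<close>

lemma (in hyperbolic_gaf) linear_statistic_eq:
  fixes \<phi> :: "'n form"
  assumes \<omega>: "\<omega> \<in> space M" and D_meas: "(\<lambda>z. indicator (ball 0 1) z * D z) \<in> borel_measurable borel"
    and D: "\<And>z. z \<in> ball 0 1 \<Longrightarrow> top_density (i_del_delbar \<phi> z) = of_real (D z * invariant_density z)"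
  shows "linear_statistic a L \<phi> \<omega> = of_real (\<integral>z. (indicator (ball 0 1) z * D z) * log_field L z \<omega> \<partial>invariant_measure)"
proof -
  let ?B = "ball (0 :: complex ^ 'n) 1"
  define h where "h z = indicator ?B z * D z" for z
  have [measurable]: "h \<in> borel_measurable borel" using D_meas by (simp add: h_def[abs_def])
  have [measurable]: "?B \<in> sets borel" by simp
  have lf [measurable]: "(\<lambda>z. log_field L z \<omega>) \<in> borel_measurable borel"
    using measurable_Pair2[OF log_field_measurable \<omega>, of L] by simp
  have "linear_statistic a L \<phi> \<omega> = (\<integral>z. indicator ?B z *\<^sub>R (of_real (log_field L z \<omega>) * top_density (i_del_delbar \<phi> z)) \<partial>lborel)"
    by (simp add: linear_statistic_def zero_current_def i_del_delbar_current_def form_integral_def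
        set_lebesgue_integral_def top_density_def log_field_def field_def)
  also have "\<dots> = (\<integral>z. of_real ((indicator ?B z * invariant_density z) * (h z * log_field L z \<omega>)) \<partial>lborel)"
    by (intro Bochner_Integration.integral_cong refl) (auto simp: D h_def indicator_def)
  also have "\<dots> = of_real (\<integral>z. (indicator ?B z * invariant_density z) * (h z * log_field L z \<omega>) \<partial>lborel)"
    by (rule integral_complex_of_real)
  also have "(\<integral>z. (indicator ?B z * invariant_density z) * (h z * log_field L z \<omega>) \<partial>lborel)
     = (\<integral>z. h z * log_field L z \<omega> \<partial>invariant_measure)"
    unfolding invariant_measure_eq_density
  proof (subst integral_density)
    show "AE z in lborel. 0 \<le> indicator ?B z * invariant_density z"
      by (rule AE_I2) (auto simp: indicator_def invariant_density_nonneg)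
    show "(\<lambda>z. h z * log_field L z \<omega>) \<in> borel_measurable lborel" by measurable
    show "(\<lambda>z. indicat_real ?B z * invariant_density z) \<in> borel_measurable lborel" by measurable
  qed simp
  finally show ?thesis by (simp only: h_def)
qed

theorem theorem1:
  fixes M :: "'w measure"
    and a :: "('n::finite \<Rightarrow> nat) \<Rightarrow> 'w \<Rightarrow> complex"
    and \<phi> :: "'n form"
    and D\<phi> :: "complex ^ 'n \<Rightarrow> real"
  assumes "prob_space M"
    and "prob_space.indep_vars M (\<lambda>_. borel) a UNIV"
    and "\<And>\<alpha>. std_complex_gaussian M (a \<alpha>)"
    and "smooth_pq_form (CARD('n) - 1) (CARD('n) - 1) (ball 0 1) \<phi>"
    and "compactly_supported_form (2 * (CARD('n) - 1)) (ball 0 1) \<phi>"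
    and "\<And>z. z \<in> ball 0 1 \<Longrightarrow>
           top_density (i_del_delbar \<phi> z) = of_real (D\<phi> z * invariant_density z)"
  shows "(\<lambda>L. complex_variance M (linear_statistic a L \<phi>)
            - fact (CARD('n)) * zeta (real (CARD('n)) + 2)
              * (LINT z:ball 0 1|invariant_measure. (D\<phi> z)\<^sup>2) * (1 / L ^ CARD('n)))
         \<in> O[at_top](\<lambda>L. ln L / L ^ (CARD('n) + 1))"
proof -
  interpret prob_space M by fact
  interpret hyperbolic_gaf M a
    by unfold_locales (use assms(2,3) in auto)
  let ?B = "ball (0 :: complex ^ 'n) 1"
  let ?\<mu> = "invariant_measure :: (complex ^ 'n) measure"
  let ?n = "CARD('n)"
  obtain K C where K: "compact K" "K \<subseteq> ?B" "\<And>z. z \<in> ?B - K \<Longrightarrow> D\<phi> z = 0"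
    and lip: "\<And>z w. z \<in> ?B \<Longrightarrow> w \<in> ?B \<Longrightarrow> \<bar>D\<phi> z - D\<phi> w\<bar> \<le> C * norm (z - w)"
    using form_density_Lipschitz[OF assms(4-6)] by blast
  \<comment> \<open>A radius strictly below 1 containing the support: it bounds the invariant
    density and keeps 1 - |z|^2 away from 0.\<close>
  obtain r where r: "0 \<le> r" "r < 1" "\<And>z. z \<in> K \<Longrightarrow> norm z \<le> r"
  proof (cases "K = {}")
    case False
    obtain x where "x \<in> K" "\<forall>y\<in>K. norm y \<le> norm x"
      using continuous_attains_sup[OF K(1) False, of norm] by (auto intro: continuous_intros)
    then show thesis using K(2) by (intro that[of "norm x"]) auto
  qed (use that[of 0] in auto)
  have r1: "0 < 1 - r\<^sup>2" using r by (simp add: abs_square_less_1)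
  have [measurable]: "?B \<in> sets borel" "K \<in> sets borel"
    using K(1) by (auto intro: borel_compact)
  define D where "D z = indicator ?B z * D\<phi> z" for z
  have D_meas [measurable]: "D \<in> borel_measurable borel"
  proof -
    have "continuous_on ?B D\<phi>"
    proof (rule continuous_on_subset[OF lipschitz_on_continuous_on, of "max C 0"])
      show "(max C 0)-lipschitz_on ?B D\<phi>"
      proof (rule lipschitz_onI)
        fix x y assume xy: "x \<in> ?B" "y \<in> ?B"
        have "C * norm (x - y) \<le> max C 0 * norm (x - y)" by (intro mult_right_mono) auto
        with lip[OF xy] show "dist (D\<phi> x) (D\<phi> y) \<le> max C 0 * dist x y"
          by (simp add: dist_norm)
      qed simp
    qed simp
    then show ?thesis
      unfolding D_def[abs_def] using borel_measurable_continuous_on_indicator[of ?B D\<phi>] by simp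
  qed
  have D_eq: "D z = D\<phi> z" if "z \<in> ?B" for z using that by (simp add: D_def)
  have D_K: "z \<in> K" if "D z \<noteq> 0" for z
    using that K(3)[of z] by (auto simp: D_def indicator_def split: if_splits)
  have D_r: "norm z \<le> r" if "D z \<noteq> 0" for z
    using r(3)[OF D_K[OF that]] .
  define b where "b = \<bar>D\<phi> 0\<bar> + \<bar>C\<bar>"
  have b0: "0 \<le> b" by (simp add: b_def)
  have D_le: "\<bar>D z\<bar> \<le> b * indicator K z" for z
  proof (cases "D z = 0")
    case False
    then have "z \<in> K" by (rule D_K)
    then have z: "z \<in> K" "z \<in> ?B" using K(2) by blast+
    have "C * norm (z - 0) \<le> \<bar>C\<bar> * 1" using z(2) by (intro mult_mono) auto
    with lip[OF z(2), of 0] have "\<bar>D\<phi> z\<bar> \<le> b" by (simp add: b_def)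
    then show ?thesis using z by (simp add: D_def)
  qed (use b0 in simp)
  have K_int: "integrable ?\<mu> (indicator K :: complex ^ 'n \<Rightarrow> real)"
  proof (rule integrableI_bounded)
    define V where "V = measure lborel ?B"
    have V: "0 < V" unfolding V_def by (rule content_ball_pos) simp
    have dens: "invariant_density z \<le> 1 / (V * (1 - r\<^sup>2) ^ (?n + 1))" if z: "z \<in> K" for z
    proof -
      have "(norm z)\<^sup>2 \<le> r\<^sup>2" using r(3)[OF z] by (intro power_mono) auto
      then have "(1 - r\<^sup>2) ^ (?n + 1) \<le> (1 - (norm z)\<^sup>2) ^ (?n + 1)" using r1 by (intro power_mono) auto
      then have "V * (1 - r\<^sup>2) ^ (?n + 1) \<le> V * (1 - (norm z)\<^sup>2) ^ (?n + 1)" using V by simp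
      moreover have "0 < V * (1 - r\<^sup>2) ^ (?n + 1)" using V r1 by simp
      ultimately show ?thesis
        unfolding invariant_density_def V_def[symmetric] by (intro divide_left_mono) auto
    qed
    have "(\<integral>\<^sup>+z. ennreal (norm (indicator K z :: real)) \<partial>?\<mu>)
       = (\<integral>\<^sup>+z. ennreal (indicator ?B z * invariant_density z) * ennreal (norm (indicator K z :: real)) \<partial>lborel)"
      unfolding invariant_measure_eq_density by (subst nn_integral_density) auto
    also have "\<dots> \<le> (\<integral>\<^sup>+z. ennreal (1 / (V * (1 - r\<^sup>2) ^ (?n + 1))) * indicator ?B z \<partial>lborel)"
      using K(2) dens by (intro nn_integral_mono) (auto simp: indicator_def intro!: ennreal_leI)
    also have "\<dots> < \<infinity>"
      using emeasure_lborel_ball_finite[of "0 :: complex ^ 'n" 1]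
      by (subst nn_integral_cmult_indicator) (auto simp: ennreal_mult_less_top)
    finally show "(\<integral>\<^sup>+z. ennreal (norm (indicator K z :: real)) \<partial>?\<mu>) < \<infinity>" .
  qed measurable
  have D_int: "integrable ?\<mu> D"
    by (rule Bochner_Integration.integrable_bound[OF integrable_mult_right[OF K_int, of b]])
       (use D_le in \<open>auto intro!: AE_I2 intro: order_trans[OF D_le abs_ge_self]\<close>)
  have D2_int: "integrable ?\<mu> (\<lambda>z. (D z)\<^sup>2)"
  proof (rule Bochner_Integration.integrable_bound[OF integrable_mult_right[OF K_int, of "b\<^sup>2"]])
    show "AE z in ?\<mu>. norm ((D z)\<^sup>2) \<le> norm (b\<^sup>2 * indicator K z)"
    proof (rule AE_I2)
      fix z
      show "norm ((D z)\<^sup>2) \<le> norm (b\<^sup>2 * indicator K z)"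
        using power_mono[OF D_le[of z], of 2] by (cases "z \<in> K") (auto simp: power_mult_distrib)
    qed
  qed measurable
  \<comment> \<open>From \<open>C\<close> squared times |z - w|^2 and the lower bound (1 - r^2) |z -
    w|^2 / 4 for 1 - \<open>kernel_ratio\<close>, valid when \<open>z\<close> lies in
    \<open>K\<close>.\<close>
  define C1 where "C1 = 4 * C\<^sup>2 / (1 - r\<^sup>2)"
  have C1: "0 \<le> C1" using r1 by (simp add: C1_def)
  have C1_half: "(D z - D w)\<^sup>2 \<le> C1 * (1 - kernel_ratio z w)" if zw: "z \<in> K" "norm w < 1" for z w
  proof -
    have z: "z \<in> ?B" "norm z < 1" using zw K(2) by auto
    have "(D z - D w)\<^sup>2 \<le> (C * norm (z - w))\<^sup>2"
      using lip[OF z(1), of w] zw z by (subst abs_le_square_iff[symmetric]) (simp add: D_eq)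
    also have "\<dots> = C1 * ((1 - r\<^sup>2) * (norm (z - w))\<^sup>2 / 4)"
      using r1 by (simp add: C1_def power_mult_distrib)
    also have "\<dots> \<le> C1 * (1 - kernel_ratio z w)"
    proof (intro mult_left_mono C1)
      have "(norm z)\<^sup>2 \<le> r\<^sup>2" using r(3)[OF zw(1)] by (intro power_mono) auto
      then have "(1 - r\<^sup>2) * (norm (z - w))\<^sup>2 / 4 \<le> (1 - (norm z)\<^sup>2) * (norm (z - w))\<^sup>2 / 4"
        by (intro divide_right_mono mult_right_mono) auto
      also note one_minus_kernel_ratio(2)[OF z(2) zw(2)]
      finally show "(1 - r\<^sup>2) * (norm (z - w))\<^sup>2 / 4 \<le> 1 - kernel_ratio z w" .
    qed
    finally show ?thesis .
  qed
  \<comment> \<open>If either point lies in \<open>K\<close>, symmetry reduces to the previous bound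
    and the indicators sum to at least 1; otherwise the left side vanishes.\<close>
  have C1_ineq: "(D z - D w)\<^sup>2 \<le> C1 * (indicator K z + indicator K w) * (1 - kernel_ratio z w)"
    if zw: "norm z < 1" "norm w < 1" for z w
  proof -
    have k: "0 \<le> 1 - kernel_ratio z w" using one_minus_kernel_ratio(3)[OF zw] by simp
    have ck: "0 \<le> C1 * (1 - kernel_ratio z w)" using C1 k by simp
    have fin: "x \<le> C1 * i * (1 - kernel_ratio z w)" if "x \<le> C1 * (1 - kernel_ratio z w)" "1 \<le> i" for x i
    proof -
      have "C1 * (1 - kernel_ratio z w) * 1 \<le> C1 * (1 - kernel_ratio z w) * i"
        using ck that(2) by (rule mult_left_mono[rotated])
      with that(1) show ?thesis by (simp add: mult_ac)
    qed
    consider "z \<in> K" | "w \<in> K" | "z \<notin> K" "w \<notin> K" by blast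
    then show ?thesis
    proof cases
      case 1
      then show ?thesis by (intro fin C1_half[OF 1 zw(2)]) simp
    next
      case 2
      have "(D z - D w)\<^sup>2 \<le> C1 * (1 - kernel_ratio z w)"
        using C1_half[OF 2 zw(1)] by (simp add: kernel_ratio_commute power2_commute)
      then show ?thesis using 2 by (intro fin) simp_all
    next
      case 3
      then have "D z = 0" "D w = 0" using D_K by blast+
      then show ?thesis using 3 by simp
    qed
  qed
  define I2 where "I2 = (\<integral>z. (D z)\<^sup>2 \<partial>?\<mu>)"
  have I2: "(LINT z:?B|?\<mu>. (D\<phi> z)\<^sup>2) = I2" "0 \<le> I2"
  proof -
    show "(LINT z:?B|?\<mu>. (D\<phi> z)\<^sup>2) = I2"
      unfolding I2_def set_lebesgue_integral_def
      by (intro Bochner_Integration.integral_cong refl) (auto simp: D_def indicator_def)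
    show "0 \<le> I2" unfolding I2_def by (intro Bochner_Integration.integral_nonneg) auto
  qed
  define A where "A = (\<integral>z. indicat_real K z \<partial>?\<mu>)"
  have A: "0 \<le> A" unfolding A_def by (intro Bochner_Integration.integral_nonneg) auto
  define Q where "Q s = (\<integral>p. (case p of (z, w) \<Rightarrow> D z * D w * kernel_ratio z w powr s) \<partial>(?\<mu> \<Otimes>\<^sub>M ?\<mu>))" for s
  \<comment> \<open>Two errors are added: that of replacing \<open>D z * D w\<close> by squares, and
    that of replacing the kernel mass by its leading term.\<close>
  define C3 where "C3 = C1 * A * (2 * fact ?n * real ?n) + I2 * (2 * (real ?n)\<^sup>2 * fact ?n)"
  \<comment> \<open>Large enough for both thresholds: \<open>s > n + 1\<close> for convergence of
    the kernel integral and \<open>s \<ge> 2 * n\<^sup>2\<close> for the mass bounds.\<close>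
  define L0 where "L0 = 2 * (real ?n)\<^sup>2 + real ?n + 2"
  have C3: "0 \<le> C3" using C1 A I2 by (simp add: C3_def)
  have Q_est: "\<bar>Q s - fact ?n * I2 / s ^ ?n\<bar> \<le> C3 / s ^ (?n + 1)" if s: "L0 \<le> s" for s
  proof -
    have s1: "real ?n + 1 < s" "real ?n < s" using s zero_le_power2[of "real ?n"] unfolding L0_def by linarith+
    have s2: "2 * (real ?n)\<^sup>2 \<le> s" using s unfolding L0_def by linarith
    note mass = kernel_mass_bounds[OF s1(2) s2]
    have "\<bar>Q s - kernel_mass ?n s * I2\<bar> \<le> C1 * A * (kernel_mass ?n s - kernel_mass ?n (s + 1))"
      unfolding Q_def I2_def A_def
      by (rule kernel_ratio_quadratic_form[OF D2_int D_meas K_int C1_ineq s1(1)])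
    also have "\<dots> \<le> C1 * A * (2 * fact ?n * real ?n / s ^ (?n + 1))"
      using C1 A by (intro mult_left_mono mass) auto
    finally have 1: "\<bar>Q s - kernel_mass ?n s * I2\<bar> \<le> C1 * A * (2 * fact ?n * real ?n / s ^ (?n + 1))" .
    have "kernel_mass ?n s * I2 - fact ?n * I2 / s ^ ?n = I2 * (kernel_mass ?n s - fact ?n / s ^ ?n)"
      by (simp add: algebra_simps)
    then have "\<bar>kernel_mass ?n s * I2 - fact ?n * I2 / s ^ ?n\<bar> \<le> I2 * (2 * (real ?n)\<^sup>2 * fact ?n / s ^ (?n + 1))"
      using mult_left_mono[OF mass(1) I2(2)] I2(2) by (simp only: abs_mult abs_of_nonneg)
    with 1 have "\<bar>Q s - fact ?n * I2 / s ^ ?n\<bar>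
        \<le> C1 * A * (2 * fact ?n * real ?n / s ^ (?n + 1)) + I2 * (2 * (real ?n)\<^sup>2 * fact ?n / s ^ (?n + 1))"
      by linarith
    also have "\<dots> = C3 / s ^ (?n + 1)" by (simp only: C3_def add_divide_distrib times_divide_eq_right)
    finally show ?thesis .
  qed
  define Z where "Z = (\<Sum>k. 1 / (real (Suc k))\<^sup>2)"
  have var: "complex_variance M (linear_statistic a L \<phi>) = (\<Sum>k. Q (real (Suc k) * L) / (real (Suc k))\<^sup>2)"
    "summable (\<lambda>k. Q (real (Suc k) * L) / (real (Suc k))\<^sup>2)" if L: "0 < L" for L
  proof -
    \<comment> \<open>The statistic agrees with a real random variable on the whole sample space, so
      its complex variance is an ordinary variance.\<close>
    define R where "R \<omega> = (\<integral>z. D z * log_field L z \<omega> \<partial>?\<mu>)" for \<omega>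
    have lin: "linear_statistic a L \<phi> \<omega> = of_real (R \<omega>)" if "\<omega> \<in> space M" for \<omega>
      unfolding R_def D_def
      by (rule linear_statistic_eq[OF that _ assms(6)]) (use D_meas in \<open>auto simp: D_def[abs_def]\<close>)
    have ER: "(LINT \<omega>|M. linear_statistic a L \<phi> \<omega>) = of_real (expectation R)"
      unfolding integral_complex_of_real[symmetric] by (intro Bochner_Integration.integral_cong refl lin)
    have "complex_variance M (linear_statistic a L \<phi>) = variance R"
      unfolding complex_variance_def ER
    proof (intro Bochner_Integration.integral_cong refl)
      fix \<omega> assume \<omega>: "\<omega> \<in> space M"
      show "(cmod (linear_statistic a L \<phi> \<omega> - of_real (expectation R)))\<^sup>2 = (R \<omega> - expectation R)\<^sup>2"
        unfolding lin[OF \<omega>] by (simp flip: of_real_diff)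
    qed
    also have "\<dots> = (\<integral>z. (\<integral>w. D z * D w * dilog (kernel_ratio z w powr L) \<partial>?\<mu>) \<partial>?\<mu>)"
      unfolding R_def by (rule variance_log_field_integral[OF L D_int r(2) D_r])
    also have "\<dots> = (\<Sum>k. Q (real (Suc k) * L) / (real (Suc k))\<^sup>2)"
      unfolding Q_def using D_r r(2) by (intro integral_dilog_series(2)[OF D_int _ L]) force
    finally show "complex_variance M (linear_statistic a L \<phi>) = (\<Sum>k. Q (real (Suc k) * L) / (real (Suc k))\<^sup>2)" .
    show "summable (\<lambda>k. Q (real (Suc k) * L) / (real (Suc k))\<^sup>2)"
      unfolding Q_def using D_r r(2) by (intro integral_dilog_series(1)[OF D_int _ L]) force
  qed
  have bound: "\<bar>complex_variance M (linear_statistic a L \<phi>) - fact ?n * zeta (real ?n + 2) * I2 * (1 / L ^ ?n)\<bar>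
      \<le> C3 * Z * (1 / L ^ (?n + 1))" if L: "L0 \<le> L" for L
  proof -
    have L1: "0 < L" using L zero_le_power2[of "real ?n"] unfolding L0_def by linarith
    \<comment> \<open>The leading term n! I2 / (m L)^n, divided by m^2 from the dilogarithm, has
      m^(n + 2) in its denominator; summation produces the zeta value.\<close>
    let ?d = "\<lambda>k. Q (real (Suc k) * L) / (real (Suc k))\<^sup>2 - fact ?n * I2 / L ^ ?n * (1 / real (Suc k) ^ (?n + 2))"
    have sums: "?d sums (complex_variance M (linear_statistic a L \<phi>) - fact ?n * I2 / L ^ ?n * zeta (real ?n + 2))"
      unfolding var(1)[OF L1] by (intro sums_diff summable_sums var(2)[OF L1] sums_mult zeta_series_sums)
    have d_le: "norm (?d k) \<le> C3 * (1 / L ^ (?n + 1)) * (1 / (real (Suc k))\<^sup>2)" for k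
    proof -
      define m where "m = real (Suc k)"
      have m: "1 \<le> m" by (simp add: m_def)
      have mL: "L \<le> m * L" using m L1 by simp
      have "?d k = (Q (m * L) - fact ?n * I2 / (m * L) ^ ?n) / m\<^sup>2"
        using m L1 unfolding m_def[symmetric] by (simp add: field_simps power_add power2_eq_square)
      also have "norm \<dots> = \<bar>Q (m * L) - fact ?n * I2 / (m * L) ^ ?n\<bar> / m\<^sup>2" by simp
      also have "\<dots> \<le> (C3 / (m * L) ^ (?n + 1)) / m\<^sup>2"
        using L mL by (intro divide_right_mono Q_est) auto
      \<comment> \<open>In the error \<open>m * L\<close> may be replaced by \<open>L\<close>,
        because the factor 1 / m^2 already makes the series converge.\<close>
      also have "\<dots> \<le> (C3 / L ^ (?n + 1)) / m\<^sup>2"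
        using L1 mL C3 m by (intro divide_right_mono divide_left_mono power_mono mult_pos_pos zero_less_power) auto
      finally show ?thesis by (simp add: m_def del: of_nat_Suc power_Suc)
    qed
    have sm: "summable (\<lambda>k. C3 * (1 / L ^ (?n + 1)) * (1 / (real (Suc k))\<^sup>2))"
      by (intro summable_mult summable_inverse_squares)
    have "norm (suminf ?d) \<le> (\<Sum>k. C3 * (1 / L ^ (?n + 1)) * (1 / (real (Suc k))\<^sup>2))"
      by (rule norm_suminf_le[OF d_le sm])
    also have "\<dots> = C3 * (1 / L ^ (?n + 1)) * Z"
      unfolding Z_def by (rule suminf_mult[OF summable_inverse_squares])
    finally show ?thesis
      unfolding sums_unique[OF sums, symmetric] by (simp add: mult_ac)
  qed
  show ?thesis
    unfolding I2(1)
  proof (rule bigoI)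
    show "\<forall>\<^sub>F L in at_top. norm (complex_variance M (linear_statistic a L \<phi>) - fact ?n * zeta (real ?n + 2) * I2 * (1 / L ^ ?n))
        \<le> C3 * Z * norm (ln L / L ^ (?n + 1))"
      \<comment> \<open>Beyond \<open>exp 1\<close> the logarithm is at least 1, so the bound of
        order 1 / L^(n + 1) passes to the stated rate.\<close>
      using eventually_ge_at_top[of L0] eventually_ge_at_top[of "exp 1"]
    proof eventually_elim
      case (elim L)
      have L: "0 < L" using elim(2) exp_gt_zero[of 1] by linarith
      have Z: "0 \<le> Z" unfolding Z_def by (intro suminf_nonneg summable_inverse_squares) auto
      have "1 \<le> ln L" using elim(2) L by (simp add: ln_ge_iff)
      then have "1 / L ^ (?n + 1) \<le> norm (ln L / L ^ (?n + 1))"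
        using L by (simp add: divide_right_mono)
      then have "C3 * Z * (1 / L ^ (?n + 1)) \<le> C3 * Z * norm (ln L / L ^ (?n + 1))"
        using C3 Z by (intro mult_left_mono) auto
      with bound[OF elim(1)] show ?case by (simp only: real_norm_def)
    qed
  qed
qed

end
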